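(* Let $\mathbb{M},\mu,L,\Gamma,\Gamma^Z,P_t$ be as in the context. Assume: (a) there is an increasing sequence $h_k\in C_0^\infty(\mathbb{M})$ with $h_k\nearrow1$ on $\mathbb{M}$ and $\|\Gamma(h_k)\|_\infty+\|\Gamma^Z(h_k)\|_\infty\to0$ as $k\to\infty$; (b) $\Gamma(f,\Gamma^Z(f))=\Gamma^Z(f,\Gamma(f))$ for every $f\in C^\infty(\mathbb{M})$; (c) $P_t1=1$ for every $t\ge0$, and for every $f\in C_0^\infty(\mathbb{M})$ and $T\ge0$, $\sup_{t\in[0,T]}(\|\Gamma(P_tf)\|_\infty+\|\Gamma^Z(P_tf)\|_\infty)<\infty$; (d) for some $\rho_1\in\mathbb{R}$, $\rho_2>0$, $\kappa\ge0$, $0<d<\infty$, the inequality $\Gamma_2(f)+\nu\Gamma_2^Z(f)\ge\frac1d(Lf)^2+(\rho_1-\frac\kappa\nu)\Gamma(f)+\rho_2\Gamma^Z(f)$ holds for every $f\in C^\infty(\mathbb{M})$ and every $\nu>0$. Let $f\in C_0^\infty(\mathbb{M})$, $f\ge0$, $f\not\equiv0$. Then for every $t>0$, on $\mathbb{M}$, $$\Gamma(\ln P_tf)+\frac{2\rho_2}{3}t\,\Gamma^Z(\ln P_tf)\le\Big(1+\frac{3\kappa}{2\rho_2}-\frac{2\rho_1}{3}t\Big)\frac{LP_tf}{P_tf}+\frac{d\rho_1^2}{6}t-\frac{\rho_1d}{2}\Big(1+\frac{3\kappa}{2\rho_2}\Big)+\frac{d\big(1+\frac{3\kappa}{2\r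ho_2}\big)^2}{2t}.$$
   Context: $\mathbb{M}$ is a smooth connected manifold with a smooth measure $\mu$; $L$ is a smooth second-order diffusion operator with real coefficients, $L1=0$, symmetric and non-positive: $\int fLg\,d\mu=\int gLf\,d\mu$, $\int fLf\,d\mu\le0$ for $f,g\in C_0^\infty(\mathbb{M})$ (smooth compactly supported). $L$ is locally subelliptic (Fefferman-Phong): locally, $\|f\|_{H^\epsilon}^2\le C(\int|fLf|d\mu+\int f^2d\mu)$-type estimates $\|f\|^2_{H^\epsilon}\le C(-\int fLf\,d\mu+\int f^2d\mu)$ hold for test functions, for some $\epsilon>0$. $\Gamma(f,g)=\frac12(L(fg)-fLg-gLf)$, $\Gamma(f)=\Gamma(f,f)\ge 0$. Locally $L=-\sum_iX_i^*X_i$ with Lipschitz vector fields $X_i$; $v\in T_x\mathbb{M}$ is subunit if $v=\sum a_iX_i(x)$ with $\sum a_i^2\le1$; a Lipschitz path is subunit if its velocity is subunit a.e. Any two points are assumed to be joined by a subunit path, and $d(x,y)=\sup\{|f(x)-f(y)|:f\in C^\infty(\mathbb{M}),\|\Gamma(f)\|_\infty\le1\}$, which equals the minimal time (infimum of $T$) of subunit paths $[0,T]\to\mathbb{M}$ from $x$ to $y$; $(\mathbb{M},d)$ is assumed complete (the distance is not to be confused with the constant $d$). $\Gamma^Z$ is a symmetric first-order differential bilinear form on $C^\infty(\mathbb{M})$ with values in functions, $\Gamma^Z(fg,h)=f\Gamma^Z(g,h)+g\Gamma^Z(f,h)$, smooth, with $\Gamma^Z(f)=\Gamma^Z(f,f)\ge0$.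 $\Gamma_2(f)=\frac12[L\Gamma(f)-2\Gamma(f,Lf)]$, $\Gamma_2^Z(f)=\frac12[L\Gamma^Z(f)-2\Gamma^Z(f,Lf)]$. $L$ is essentially self-adjoint on $C_0^\infty(\mathbb{M})$; $P_t=e^{tL}$ is the heat semigroup, with smooth positive symmetric heat kernel $p(x,y,t)$, $P_tf(x)=\int p(x,y,t)f(y)d\mu(y)$. *)

theory Defs
  imports "HOL-Analysis.Analysis"
begin

section \<open>Smooth functions on open subsets of a Euclidean space\<close>

primrec Ck_on :: "nat \<Rightarrow> 'e::euclidean_space set \<Rightarrow> ('e \<Rightarrow> 'b::real_normed_vector) \<Rightarrow> bool" where
  "Ck_on 0 S f \<longleftrightarrow> continuous_on S f"
| "Ck_on (Suc k) S f \<longleftrightarrow>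
     f differentiable_on S \<and> (\<forall>v. Ck_on k S (\<lambda>z. frechet_derivative f (at z) v))"

(* only meaningful for open S: "at z" ignores S *)
definition smooth_on :: "'e::euclidean_space set \<Rightarrow> ('e \<Rightarrow> 'b::real_normed_vector) \<Rightarrow> bool" where
  "smooth_on S f \<longleftrightarrow> (\<forall>k. Ck_on k S f)"

definition dir_deriv :: "'e::euclidean_space \<Rightarrow> ('e \<Rightarrow> real) \<Rightarrow> 'e \<Rightarrow> real" where
  "dir_deriv v f z = frechet_derivative f (at z) v"


section \<open>Smooth manifolds\<close>

text \<open>The manifold is a whole type of class Hausdorff and second countable. A chart is an open set
  together with a coordinate map into the Euclidean model space; the values of the coordinate
  map outside the open set are irrelevant.\<close>

type_synonym ('m, 'e) chart = "'m set \<times> ('m \<Rightarrow> 'e)"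

definition is_chart :: "('m::topological_space, 'e::euclidean_space) chart \<Rightarrow> bool" where
  "is_chart = (\<lambda>(U, \<phi>). open U \<and> inj_on \<phi> U \<and> open (\<phi> ` U) \<and>
     homeomorphism U (\<phi> ` U) \<phi> (inv_into U \<phi>))"

definition smooth_atlas :: "('m::topological_space, 'e::euclidean_space) chart set \<Rightarrow> bool" where
  "smooth_atlas A \<longleftrightarrow>
     (\<forall>c\<in>A. is_chart c) \<and> (\<Union>(U, \<phi>)\<in>A. U) = UNIV \<and>
     (\<forall>(U, \<phi>)\<in>A. \<forall>(V, \<psi>)\<in>A. smooth_on (\<phi> ` (U \<inter> V)) (\<psi> \<circ> inv_into U \<phi>))"

definition Cinf :: "('m, 'e::euclidean_space) chart set \<Rightarrow> ('m \<Rightarrow> real) set" where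
  "Cinf A = {f. \<forall>(U, \<phi>)\<in>A. smooth_on (\<phi> ` U) (f \<circ> inv_into U \<phi>)}"

definition Cinf0_on ::
  "('m::topological_space, 'e::euclidean_space) chart set \<Rightarrow> 'm set \<Rightarrow> ('m \<Rightarrow> real) set" where
  "Cinf0_on A W =
     {f \<in> Cinf A. compact (closure {x. f x \<noteq> 0}) \<and> closure {x. f x \<noteq> 0} \<subseteq> W}"

abbreviation Cinf0 ::
  "('m::topological_space, 'e::euclidean_space) chart set \<Rightarrow> ('m \<Rightarrow> real) set" where
  "Cinf0 A \<equiv> Cinf0_on A UNIV"

definition smooth_measure ::
  "('m::topological_space, 'e::euclidean_space) chart set \<Rightarrow> 'm measure \<Rightarrow> bool" where
  "smooth_measure A \<mu> \<longleftrightarrow> sets \<mu> = sets borel \<and>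
     (\<forall>(U, \<phi>)\<in>A. \<exists>\<rho> :: 'e \<Rightarrow> real. smooth_on (\<phi> ` U) \<rho> \<and> (\<forall>z\<in>\<phi> ` U. 0 < \<rho> z) \<and>
        (\<forall>B\<in>sets borel. B \<subseteq> U \<longrightarrow>
           emeasure \<mu> B = (\<integral>\<^sup>+z. ennreal (\<rho> z) * indicator (\<phi> ` B) z \<partial>lborel)))"

definition supnorm :: "('m \<Rightarrow> real) \<Rightarrow> ennreal" where
  "supnorm f = (SUP x. ennreal \<bar>f x\<bar>)"


section \<open>Diffusion operators\<close>

text \<open>Operators on functions are total; only their values on smooth functions matter.
  A zeroth-order coefficient is allowed here, since \<open>L 1 = 0\<close> is a separate assumption.\<close>

definition second_order_diffusion ::
  "('m, 'e::euclidean_space) chart set \<Rightarrow> (('m \<Rightarrow> real) \<Rightarrow> 'm \<Rightarrow> real) \<Rightarrow> bool" where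
  "second_order_diffusion A L \<longleftrightarrow>
     (\<forall>(U, \<phi>)\<in>A. \<exists>(a :: 'e \<Rightarrow> 'e \<Rightarrow> 'e \<Rightarrow> real) (b :: 'e \<Rightarrow> 'e \<Rightarrow> real) (c :: 'e \<Rightarrow> real).
        (\<forall>i\<in>Basis. \<forall>j\<in>Basis. smooth_on (\<phi> ` U) (a i j)) \<and>
        (\<forall>i\<in>Basis. smooth_on (\<phi> ` U) (b i)) \<and> smooth_on (\<phi> ` U) c \<and>
        (\<forall>z\<in>\<phi> ` U. \<forall>i\<in>Basis. \<forall>j\<in>Basis. a i j z = a j i z) \<and>
        (\<forall>z\<in>\<phi> ` U. \<forall>\<xi>. 0 \<le> (\<Sum>i\<in>Basis. \<Sum>j\<in>Basis. a i j z * (\<xi> \<bullet> i) * (\<xi> \<bullet> j))) \<and>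
        (\<forall>f\<in>Cinf A. \<forall>z\<in>\<phi> ` U. L f (inv_into U \<phi> z) =
            (\<Sum>i\<in>Basis. \<Sum>j\<in>Basis. a i j z * dir_deriv i (dir_deriv j (f \<circ> inv_into U \<phi>)) z)
            + (\<Sum>i\<in>Basis. b i z * dir_deriv i (f \<circ> inv_into U \<phi>) z)
            + c z * f (inv_into U \<phi> z)))"

definition Gam :: "(('m \<Rightarrow> real) \<Rightarrow> 'm \<Rightarrow> real) \<Rightarrow> ('m \<Rightarrow> real) \<Rightarrow> ('m \<Rightarrow> real) \<Rightarrow> 'm \<Rightarrow> real" where
  "Gam L f g = (\<lambda>x. (L (\<lambda>y. f y * g y) x - f x * L g x - g x * L f x) / 2)"

definition Gam2 :: "(('m \<Rightarrow> real) \<Rightarrow> 'm \<Rightarrow> real) \<Rightarrow> ('m \<Rightarrow> real) \<Rightarrow> 'm \<Rightarrow> real" where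
  "Gam2 L f = (\<lambda>x. (L (Gam L f f) x - 2 * Gam L f (L f) x) / 2)"

definition GamZ2 ::
  "(('m \<Rightarrow> real) \<Rightarrow> 'm \<Rightarrow> real) \<Rightarrow> (('m \<Rightarrow> real) \<Rightarrow> ('m \<Rightarrow> real) \<Rightarrow> 'm \<Rightarrow> real) \<Rightarrow>
   ('m \<Rightarrow> real) \<Rightarrow> 'm \<Rightarrow> real" where
  "GamZ2 L GZ f = (\<lambda>x. (L (GZ f f) x - 2 * GZ f (L f) x) / 2)"

definition first_order_form ::
  "('m, 'e::euclidean_space) chart set \<Rightarrow>
   (('m \<Rightarrow> real) \<Rightarrow> ('m \<Rightarrow> real) \<Rightarrow> 'm \<Rightarrow> real) \<Rightarrow> bool" where
  "first_order_form A GZ \<longleftrightarrow>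
     (\<forall>f\<in>Cinf A. \<forall>g\<in>Cinf A. GZ f g \<in> Cinf A \<and> GZ f g = GZ g f) \<and>
     (\<forall>f\<in>Cinf A. \<forall>g\<in>Cinf A. \<forall>h\<in>Cinf A. \<forall>a b x.
        GZ (\<lambda>y. a * f y + b * g y) h x = a * GZ f h x + b * GZ g h x) \<and>
     (\<forall>f\<in>Cinf A. \<forall>g\<in>Cinf A. \<forall>h\<in>Cinf A. \<forall>x.
        GZ (\<lambda>y. f y * g y) h x = f x * GZ g h x + g x * GZ f h x)"


section \<open>Local subellipticity\<close>

text \<open>The squared Sobolev norm, up to the dimensional constant of the Fourier transform.\<close>

definition sobolev_norm_sq :: "real \<Rightarrow> ('e::euclidean_space \<Rightarrow> real) \<Rightarrow> ennreal" where
  "sobolev_norm_sq \<epsilon> u =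
     (\<integral>\<^sup>+\<xi>. ennreal ((1 + (norm \<xi>)\<^sup>2) powr \<epsilon> *
        (cmod (LINT z|lborel. exp (- \<i> * complex_of_real (z \<bullet> \<xi>)) * complex_of_real (u z)))\<^sup>2)
      \<partial>lborel)"

definition chart_push :: "('m, 'e) chart \<Rightarrow> ('m \<Rightarrow> real) \<Rightarrow> 'e \<Rightarrow> real" where
  "chart_push = (\<lambda>(U, \<phi>) f z. if z \<in> \<phi> ` U then f (inv_into U \<phi> z) else 0)"

definition locally_subelliptic ::
  "('m::topological_space, 'e::euclidean_space) chart set \<Rightarrow> 'm measure \<Rightarrow>
   (('m \<Rightarrow> real) \<Rightarrow> 'm \<Rightarrow> real) \<Rightarrow> bool" where
  "locally_subelliptic A \<mu> L \<longleftrightarrow>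
     (\<forall>x. \<exists>(U, \<phi>)\<in>A. \<exists>W. open W \<and> x \<in> W \<and> W \<subseteq> U \<and>
        (\<exists>\<epsilon>>0. \<exists>C>0. \<forall>f\<in>Cinf0_on A W.
           sobolev_norm_sq \<epsilon> (chart_push (U, \<phi>) f)
             \<le> ennreal (C * (- (LINT y|\<mu>. f y * L f y) + (LINT y|\<mu>. (f y)\<^sup>2)))))"


section \<open>Subunit paths and the intrinsic distance\<close>

text \<open>The vector fields \<open>X i\<close>, \<open>i < n\<close>, are given on \<open>W \<subseteq> U\<close> by their components in the chart, as
  functions of the coordinates. The identity \<open>L = - (\<Sum>i<n. X\<^sub>i\<^sup>* X\<^sub>i)\<close> is tested against functions
  supported in \<open>W\<close>, the fields being only Lipschitz.\<close>

definition lipschitz_frame ::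
  "('m::topological_space, 'e::euclidean_space) chart set \<Rightarrow> 'm measure \<Rightarrow>
   (('m \<Rightarrow> real) \<Rightarrow> 'm \<Rightarrow> real) \<Rightarrow> ('m, 'e) chart \<Rightarrow> 'm set \<Rightarrow> nat \<Rightarrow> (nat \<Rightarrow> 'e \<Rightarrow> 'e) \<Rightarrow> bool" where
  "lipschitz_frame A \<mu> L = (\<lambda>(U, \<phi>) W n X.
     open W \<and> W \<subseteq> U \<and> (\<forall>i<n. \<exists>K. K-lipschitz_on (\<phi> ` W) (X i)) \<and>
     (\<forall>f\<in>Cinf0_on A W. \<forall>g\<in>Cinf0_on A W.
        (LINT y|\<mu>. g y * L f y) =
        - (\<Sum>i<n. LINT y:W|\<mu>. dir_deriv (X i (\<phi> y)) (f \<circ> inv_into U \<phi>) (\<phi> y) *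
                               dir_deriv (X i (\<phi> y)) (g \<circ> inv_into U \<phi>) (\<phi> y))))"

text \<open>A tangent vector at \<open>x\<close> is given by its components \<open>v\<close> in the chart. The set of subunit vectors
  does not depend on the choice of the frame.\<close>

definition subunit_vector ::
  "('m::topological_space, 'e::euclidean_space) chart set \<Rightarrow> 'm measure \<Rightarrow>
   (('m \<Rightarrow> real) \<Rightarrow> 'm \<Rightarrow> real) \<Rightarrow> ('m, 'e) chart \<Rightarrow> 'm \<Rightarrow> 'e \<Rightarrow> bool" where
  "subunit_vector A \<mu> L c x v \<longleftrightarrow>
     (\<exists>W n X. x \<in> W \<and> lipschitz_frame A \<mu> L c W n X \<and>
        (\<exists>a :: nat \<Rightarrow> real. (\<Sum>i<n. (a i)\<^sup>2) \<le> 1 \<and> v = (\<Sum>i<n. a i *\<^sub>R X i (snd c x))))"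

definition lipschitz_path ::
  "('m::topological_space, 'e::euclidean_space) chart set \<Rightarrow> real \<Rightarrow> (real \<Rightarrow> 'm) \<Rightarrow> bool" where
  "lipschitz_path A T \<gamma> \<longleftrightarrow> continuous_on {0..T} \<gamma> \<and>
     (\<forall>s\<in>{0..T}. \<forall>(U, \<phi>)\<in>A. \<gamma> s \<in> U \<longrightarrow>
        (\<exists>\<delta>>0. \<exists>K. (\<forall>t\<in>{0..T} \<inter> ball s \<delta>. \<gamma> t \<in> U) \<and>
           K-lipschitz_on ({0..T} \<inter> ball s \<delta>) (\<phi> \<circ> \<gamma>)))"

definition subunit_path ::
  "('m::topological_space, 'e::euclidean_space) chart set \<Rightarrow> 'm measure \<Rightarrow>
   (('m \<Rightarrow> real) \<Rightarrow> 'm \<Rightarrow> real) \<Rightarrow> real \<Rightarrow> (real \<Rightarrow> 'm) \<Rightarrow> bool" where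
  "subunit_path A \<mu> L T \<gamma> \<longleftrightarrow> lipschitz_path A T \<gamma> \<and>
     (AE t in lborel. t \<in> {0..T} \<longrightarrow>
        (\<exists>(U, \<phi>)\<in>A. \<gamma> t \<in> U \<and>
           (\<exists>v. ((\<phi> \<circ> \<gamma>) has_vector_derivative v) (at t within {0..T}) \<and>
                subunit_vector A \<mu> L (U, \<phi>) (\<gamma> t) v)))"

definition subunit_connected ::
  "('m::topological_space, 'e::euclidean_space) chart set \<Rightarrow> 'm measure \<Rightarrow>
   (('m \<Rightarrow> real) \<Rightarrow> 'm \<Rightarrow> real) \<Rightarrow> bool" where
  "subunit_connected A \<mu> L \<longleftrightarrow>
     (\<forall>x y. \<exists>T\<ge>0. \<exists>\<gamma>. subunit_path A \<mu> L T \<gamma> \<and> \<gamma> 0 = x \<and> \<gamma> T = y)"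

text \<open>A real supremum: it is taken over a bounded set when subunit paths join all points.\<close>

definition intrinsic_dist ::
  "('m, 'e::euclidean_space) chart set \<Rightarrow> (('m \<Rightarrow> real) \<Rightarrow> 'm \<Rightarrow> real) \<Rightarrow> 'm \<Rightarrow> 'm \<Rightarrow> real" where
  "intrinsic_dist A L x y = (SUP f\<in>{f \<in> Cinf A. supnorm (Gam L f f) \<le> 1}. \<bar>f x - f y\<bar>)"


section \<open>Operators in \<open>L\<^sup>2(\<mu>)\<close>\<close>

text \<open>Elements of \<open>L\<^sup>2(\<mu>)\<close> are represented by functions, and a densely defined operator by its graph,
  a set of pairs of functions.\<close>

definition L2 :: "'m measure \<Rightarrow> ('m \<Rightarrow> real) set" where
  "L2 \<mu> = {f \<in> borel_measurable \<mu>. integrable \<mu> (\<lambda>x. (f x)\<^sup>2)}"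

definition L2dist_sq :: "'m measure \<Rightarrow> ('m \<Rightarrow> real) \<Rightarrow> ('m \<Rightarrow> real) \<Rightarrow> real" where
  "L2dist_sq \<mu> f g = (LINT x|\<mu>. (f x - g x)\<^sup>2)"

type_synonym 'm op_graph = "(('m \<Rightarrow> real) \<times> ('m \<Rightarrow> real)) set"

definition L2_closure :: "'m measure \<Rightarrow> 'm op_graph \<Rightarrow> 'm op_graph" where
  "L2_closure \<mu> G = {(f, g). f \<in> L2 \<mu> \<and> g \<in> L2 \<mu> \<and>
     (\<exists>u v. (\<forall>n::nat. (u n, v n) \<in> G) \<and>
        (\<lambda>n. L2dist_sq \<mu> (u n) f) \<longlonglongrightarrow> 0 \<and> (\<lambda>n. L2dist_sq \<mu> (v n) g) \<longlonglongrightarrow> 0)}"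

definition L2_adjoint :: "'m measure \<Rightarrow> 'm op_graph \<Rightarrow> 'm op_graph" where
  "L2_adjoint \<mu> G = {(f, g). f \<in> L2 \<mu> \<and> g \<in> L2 \<mu> \<and>
     (\<forall>(u, v)\<in>G. (LINT x|\<mu>. f x * v x) = (LINT x|\<mu>. g x * u x))}"

definition test_graph ::
  "('m::topological_space, 'e::euclidean_space) chart set \<Rightarrow>
   (('m \<Rightarrow> real) \<Rightarrow> 'm \<Rightarrow> real) \<Rightarrow> 'm op_graph" where
  "test_graph A L = {(f, L f) | f. f \<in> Cinf0 A}"

definition essentially_self_adjoint :: "'m measure \<Rightarrow> 'm op_graph \<Rightarrow> bool" where
  "essentially_self_adjoint \<mu> G \<longleftrightarrow> L2_adjoint \<mu> (L2_closure \<mu> G) = L2_closure \<mu> G"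

definition C0_semigroup :: "'m measure \<Rightarrow> (real \<Rightarrow> ('m \<Rightarrow> real) \<Rightarrow> 'm \<Rightarrow> real) \<Rightarrow> bool" where
  "C0_semigroup \<mu> P \<longleftrightarrow>
     (\<forall>t\<ge>0. (\<forall>f\<in>L2 \<mu>. P t f \<in> L2 \<mu>) \<and>
        (\<forall>f\<in>L2 \<mu>. \<forall>g\<in>L2 \<mu>. \<forall>a b.
           AE x in \<mu>. P t (\<lambda>y. a * f y + b * g y) x = a * P t f x + b * P t g x) \<and>
        (\<exists>C. \<forall>f\<in>L2 \<mu>. (LINT x|\<mu>. (P t f x)\<^sup>2) \<le> C * (LINT x|\<mu>. (f x)\<^sup>2))) \<and>
     (\<forall>f\<in>L2 \<mu>. AE x in \<mu>. P 0 f x = f x) \<and>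
     (\<forall>s\<ge>0. \<forall>t\<ge>0. \<forall>f\<in>L2 \<mu>. AE x in \<mu>. P (s + t) f x = P s (P t f) x) \<and>
     (\<forall>f\<in>L2 \<mu>. ((\<lambda>t. L2dist_sq \<mu> (P t f) f) \<longlongrightarrow> 0) (at_right 0))"

definition generator :: "'m measure \<Rightarrow> (real \<Rightarrow> ('m \<Rightarrow> real) \<Rightarrow> 'm \<Rightarrow> real) \<Rightarrow> 'm op_graph" where
  "generator \<mu> P = {(f, g). f \<in> L2 \<mu> \<and> g \<in> L2 \<mu> \<and>
     ((\<lambda>t. L2dist_sq \<mu> (\<lambda>x. (P t f x - f x) / t) g) \<longlongrightarrow> 0) (at_right 0)}"

text \<open>\<open>P\<^sub>t = e\<^sup>t\<^sup>L\<close>, where \<open>L\<close> stands for the closure of its restriction to test functions.\<close>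

definition heat_semigroup ::
  "('m::topological_space, 'e::euclidean_space) chart set \<Rightarrow> 'm measure \<Rightarrow>
   (('m \<Rightarrow> real) \<Rightarrow> 'm \<Rightarrow> real) \<Rightarrow> (real \<Rightarrow> ('m \<Rightarrow> real) \<Rightarrow> 'm \<Rightarrow> real) \<Rightarrow> bool" where
  "heat_semigroup A \<mu> L P \<longleftrightarrow>
     C0_semigroup \<mu> P \<and> generator \<mu> P = L2_closure \<mu> (test_graph A L)"

text \<open>The kernel fixes the pointwise values of \<open>P t f\<close> and extends \<open>P t\<close> beyond \<open>L\<^sup>2(\<mu>)\<close>,
  in particular to constants. Where the integral diverges, its conventional value is 0.\<close>

definition heat_kernel ::
  "('m::topological_space, 'e::euclidean_space) chart set \<Rightarrow> 'm measure \<Rightarrow>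
   (real \<Rightarrow> ('m \<Rightarrow> real) \<Rightarrow> 'm \<Rightarrow> real) \<Rightarrow> ('m \<Rightarrow> 'm \<Rightarrow> real \<Rightarrow> real) \<Rightarrow> bool" where
  "heat_kernel A \<mu> P p \<longleftrightarrow>
     (\<forall>(U, \<phi>)\<in>A. \<forall>(V, \<psi>)\<in>A. smooth_on (\<phi> ` U \<times> \<psi> ` V \<times> {0<..})
        (\<lambda>(a, b, t). p (inv_into U \<phi> a) (inv_into V \<psi> b) t)) \<and>
     (\<forall>x y. \<forall>t>0. 0 < p x y t \<and> p x y t = p y x t) \<and>
     (\<forall>t>0. \<forall>f\<in>L2 \<mu>. \<forall>x. integrable \<mu> (\<lambda>y. p x y t * f y)) \<and>
     (\<forall>f. P 0 f = f) \<and>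
     (\<forall>t>0. \<forall>f x. P t f x = (LINT y|\<mu>. p x y t * f y))"


section \<open>The setting\<close>

locale subelliptic_diffusion =
  fixes A :: "('m::{t2_space, second_countable_topology}, 'e::euclidean_space) chart set"
    and \<mu> :: "'m measure"
    and L :: "('m \<Rightarrow> real) \<Rightarrow> 'm \<Rightarrow> real"
    and GZ :: "('m \<Rightarrow> real) \<Rightarrow> ('m \<Rightarrow> real) \<Rightarrow> 'm \<Rightarrow> real"
    and P :: "real \<Rightarrow> ('m \<Rightarrow> real) \<Rightarrow> 'm \<Rightarrow> real"
    and p :: "'m \<Rightarrow> 'm \<Rightarrow> real \<Rightarrow> real"
  assumes atlas: "smooth_atlas A"
    and connected: "connected (UNIV :: 'm set)"
    and smooth_measure: "smooth_measure A \<mu>"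
    and diffusion: "second_order_diffusion A L"
    and L_one: "L (\<lambda>_. 1) = (\<lambda>_. 0)"
    and L_sym: "\<And>f g. f \<in> Cinf0 A \<Longrightarrow> g \<in> Cinf0 A \<Longrightarrow>
                  (LINT x|\<mu>. f x * L g x) = (LINT x|\<mu>. g x * L f x)"
    and L_nonpos: "\<And>f. f \<in> Cinf0 A \<Longrightarrow> (LINT x|\<mu>. f x * L f x) \<le> 0"
    and subelliptic: "locally_subelliptic A \<mu> L"
    and subunit: "subunit_connected A \<mu> L"
    and metric: "Metric_space UNIV (intrinsic_dist A L)"
    and complete: "Metric_space.mcomplete UNIV (intrinsic_dist A L)"
    and GZ_form: "first_order_form A GZ"
    and GZ_nonneg: "\<And>f x. f \<in> Cinf A \<Longrightarrow> 0 \<le> GZ f f x"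
    and ess_sa: "essentially_self_adjoint \<mu> (test_graph A L)"
    and heat: "heat_semigroup A \<mu> L P"
    and kernel: "heat_kernel A \<mu> P p"

end

theory Submission
  imports Defs
begin

text \<open>
  Let \<open>F = P\<^sub>s f + \<epsilon>\<close> and \<open>g = ln F\<close>. As \<open>F\<close> solves the heat equation, the Bochner formula reads
  \<open>(L - \<partial>\<^sub>s) (F \<Gamma>(g)) = 2 F \<Gamma>\<^sub>2(g)\<close>, and the commutation hypothesis gives the same for \<open>\<Gamma>\<^sup>Z\<close>. For suitable
  polynomials \<open>a, b, \<alpha>, \<beta>\<close> vanishing at \<open>0\<close>, the curvature-dimension inequality with \<open>\<nu> = b / a\<close>, together with
  \<open>(L g)\<^sup>2 \<ge> 2 \<gamma> L g - \<gamma>\<^sup>2\<close>, shows that \<open>u = a F \<Gamma>(g) + b F \<Gamma>\<^sup>Z(g) + \<alpha> L F + \<beta> F\<close> is a bounded subsolution of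
  the heat equation with \<open>u = O(s)\<close> at \<open>0\<close>. Hence \<open>u \<le> 0\<close> by a comparison principle, and letting \<open>\<epsilon> \<rightarrow> 0\<close> yields
  the claim.

  The comparison principle rests on conservativeness and on the cutoffs: \<open>(u - C (1 - P\<^sub>s h\<^sub>k))\<^sub>+\<close> is dominated by the
  integrable function \<open>C |P\<^sub>s h\<^sub>k|\<close>, so that an energy estimate with weight \<open>h\<^sub>j\<^sup>2\<close>, \<open>j \<rightarrow> \<infinity>\<close>, shows that it vanishes,
  whereas \<open>P\<^sub>s h\<^sub>k \<rightarrow> 1\<close> as \<open>k \<rightarrow> \<infinity>\<close>.

  The forms \<open>\<Gamma>\<close> and \<open>\<Gamma>\<^sup>Z\<close> are only known to be bilinear derivations. Hadamard's lemma and bump functions give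
  them coordinate expressions, from which the chain rule and the product rule in time follow.
\<close>

section \<open>Calculus of smooth functions\<close>

text \<open>The shift by \<epsilon> is needed because \<open>P s f\<close> need not be bounded away
  from 0: only for F do the gradient bounds make \<Gamma>(F) / F bounded, by a multiple of
  1/\<epsilon>. Origin of the powers of s: cancelling the \<Gamma>^Z terms forces b' =
  \<open>2 \<rho>\<^sub>2 a\<close>. If b = s^m, then a'/a and a/b are multiples of 1/s, so the
  \<gamma> that cancels the \<Gamma>(g) terms grows like 1/s, and \<beta>', a multiple of a
  \<gamma>^2, behaves like s^(m-3). For m = 2 this is not integrable at 0; m = 3 lets \<beta> start
  from 0. The positive part in the energy estimate must be smooth, as L is only controlled on smooth
  functions. It is replaced by exp(-1/r), with arguments scaled to r \<le> 1/4, where this function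
  is convex enough. The semigroup is given by a generator in L^2 and by a kernel. The kernel yields
  smoothness, the generator yields identities almost everywhere, and since nonempty open sets have
  positive measure, continuity turns these into pointwise identities.\<close>

lemma Ck_on_SucD: "Ck_on (Suc k) S f \<Longrightarrow> Ck_on k S f"
proof (induction k arbitrary: f)
  case 0
  then show ?case by (auto intro: differentiable_imp_continuous_on)
next
  case (Suc k)
  then show ?case by auto
qed

lemma Ck_on_continuous: "Ck_on k S f \<Longrightarrow> continuous_on S f"
  by (cases k) (simp_all add: differentiable_imp_continuous_on)

lemma Ck_on_has_derivative:
  assumes "Ck_on (Suc k) S f" "open S" "z \<in> S"
  shows "(f has_derivative frechet_derivative f (at z)) (at z)"
proof -
  have "f differentiable (at z within S)"
    using assms(1,3) unfolding Ck_on.simps differentiable_on_def by blast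
  then have "f differentiable (at z)"
    using at_within_open[OF assms(3,2)] by simp
  then show ?thesis by (simp add: frechet_derivative_works)
qed

text \<open>The derivatives in \<open>Ck_on\<close> are taken at \<open>z\<close> in the whole
  space, so agreement on \<open>S\<close> passes to them because \<open>S\<close> is open.\<close>

lemma Ck_on_cong:
  assumes "open S" "\<And>z. z \<in> S \<Longrightarrow> f z = g z" "Ck_on k S f"
  shows "Ck_on k S g"
  using assms(2,3)
proof (induction k arbitrary: f g)
  case 0
  then show ?case using continuous_on_cong by (metis Ck_on.simps(1))
next
  case (Suc k)
  have d: "(g has_derivative frechet_derivative f (at z)) (at z)" if "z \<in> S" for z
    using has_derivative_transform_within_open[OF Ck_on_has_derivative[OF Suc.prems(2) assms(1) that] assms(1) that]
      Suc.prems(1) by auto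
  then have e: "frechet_derivative g (at z) = frechet_derivative f (at z)" if "z \<in> S" for z
    using frechet_derivative_at that by fastforce
  have "g differentiable_on S"
    using d by (meson differentiableI differentiable_at_imp_differentiable_on)
  moreover have "Ck_on k S (\<lambda>z. frechet_derivative g (at z) v)" for v
    using Suc.IH[of "\<lambda>z. frechet_derivative f (at z) v" "\<lambda>z. frechet_derivative g (at z) v"] Suc.prems e
    by auto
  ultimately show ?case by simp
qed

text \<open>Drives the inductions on \<open>k\<close> below: any formula \<open>f'\<close> for the
  derivative may be used in place of the chosen \<open>frechet_derivative\<close>.\<close>

lemma Ck_on_SucI:
  assumes S: "open S" and d: "\<And>z. z \<in> S \<Longrightarrow> (f has_derivative f' z) (at z)"
    and f': "\<And>v. Ck_on k S (\<lambda>z. f' z v)"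
  shows "Ck_on (Suc k) S f"
proof -
  have "f differentiable_on S"
    by (rule differentiable_at_imp_differentiable_on, rule differentiableI, rule d)
  moreover have "Ck_on k S (\<lambda>z. frechet_derivative f (at z) v)" for v
  proof (rule Ck_on_cong[OF S _ f'])
    fix z assume "z \<in> S"
    show "f' z v = frechet_derivative f (at z) v"
      using frechet_derivative_at[OF d[OF \<open>z \<in> S\<close>]] by simp
  qed
  ultimately show ?thesis by simp
qed

lemma Ck_on_subset: "Ck_on k S f \<Longrightarrow> T \<subseteq> S \<Longrightarrow> Ck_on k T f"
proof (induction k arbitrary: f)
  case 0
  then show ?case using continuous_on_subset by auto
next
  case (Suc k)
  then show ?case using differentiable_on_subset by auto
qed

lemma continuous_on_open_local:
  fixes f :: "'a::t2_space \<Rightarrow> 'b::topological_space"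
  assumes "\<And>u. u \<in> S \<Longrightarrow> \<exists>T. open T \<and> u \<in> T \<and> continuous_on T f"
  shows "continuous_on S f"
proof -
  have "continuous (at u within S) f" if u: "u \<in> S" for u
  proof -
    obtain T where T: "open T" "u \<in> T" "continuous_on T f" using assms[OF u] by auto
    then have "continuous (at u) f" by (simp add: continuous_on_eq_continuous_at)
    then show ?thesis by (rule continuous_at_imp_continuous_at_within)
  qed
  then show ?thesis by (simp add: continuous_on_eq_continuous_within)
qed

lemma Ck_on_local:
  assumes "\<And>z. z \<in> S \<Longrightarrow> \<exists>T. open T \<and> z \<in> T \<and> Ck_on k T f"
  shows "Ck_on k S f"
  using assms
proof (induction k arbitrary: f)
  case 0
  then show ?case using continuous_on_open_local[of S f] by simp
next
  case (Suc k)
  have "f differentiable at z" if "z \<in> S" for z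
    using Suc.prems[OF that] Ck_on_has_derivative unfolding differentiable_def by blast
  moreover have "Ck_on k S (\<lambda>z. frechet_derivative f (at z) v)" for v
    using Suc.IH[of "\<lambda>z. frechet_derivative f (at z) v"] Suc.prems by (metis Ck_on.simps(2))
  ultimately show ?case by (simp add: differentiable_at_imp_differentiable_on)
qed

lemma Ck_on_const: "Ck_on k S (\<lambda>z. c)"
  by (induction k arbitrary: c) (auto simp: frechet_derivative_const)

lemma Ck_on_add:
  assumes "open S"
  shows "Ck_on k S f \<Longrightarrow> Ck_on k S g \<Longrightarrow> Ck_on k S (\<lambda>z. f z + g z)"
proof (induction k arbitrary: f g)
  case 0
  then show ?case by (auto intro: continuous_on_add)
next
  case (Suc k)
  show ?case
    by (rule Ck_on_SucI[OF assms has_derivative_add[OF Ck_on_has_derivative[OF Suc.prems(1) assms]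
          Ck_on_has_derivative[OF Suc.prems(2) assms]]])
      (use Suc in auto)
qed

lemma Ck_on_linear:
  assumes "open S" "bounded_linear T"
  shows "Ck_on k S f \<Longrightarrow> Ck_on k S (\<lambda>z. T (f z))"
proof (induction k arbitrary: f)
  case 0
  then show ?case by (auto intro: bounded_linear.continuous_on[OF assms(2)])
next
  case (Suc k)
  show ?case
    by (rule Ck_on_SucI[OF assms(1) bounded_linear.has_derivative[OF assms(2)
          Ck_on_has_derivative[OF Suc.prems assms(1)]]])
      (use Suc in auto)
qed

lemma Ck_on_id:
  assumes "open S"
  shows "Ck_on k S (\<lambda>z. z)"
proof (cases k)
  case 0
  then show ?thesis by (simp add: continuous_on_id)
next
  case (Suc k')
  show ?thesis unfolding Suc using assms
    by (intro Ck_on_SucI[where f' = "\<lambda>z v. v"]) (auto intro: Ck_on_const)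
qed

lemma Ck_on_scaleR:
  assumes "open S"
  shows "Ck_on k S f \<Longrightarrow> Ck_on k S g \<Longrightarrow> Ck_on k S (\<lambda>z. f z *\<^sub>R g z)"
proof (induction k arbitrary: f g)
  case 0
  then show ?case by (auto intro: continuous_on_scaleR)
next
  case (Suc k)
  show ?case
    by (rule Ck_on_SucI[OF assms has_derivative_scaleR[OF Ck_on_has_derivative[OF Suc.prems(1) assms]
          Ck_on_has_derivative[OF Suc.prems(2) assms]]])
      (use Suc Ck_on_SucD[OF Suc.prems(1)] Ck_on_SucD[OF Suc.prems(2)] in
        \<open>auto intro!: Ck_on_add[OF assms]\<close>)
qed

lemma Ck_on_sum:
  assumes "open S"
  shows "(\<And>i. i \<in> I \<Longrightarrow> Ck_on k S (f i)) \<Longrightarrow> Ck_on k S (\<lambda>z. \<Sum>i\<in>I. f i z)"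
  by (induction I rule: infinite_finite_induct) (auto intro: Ck_on_const Ck_on_add[OF assms])

lemma linear_Basis_expand:
  fixes T :: "'a::euclidean_space \<Rightarrow> 'b::real_vector"
  assumes "linear T"
  shows "T v = (\<Sum>i\<in>Basis. (v \<bullet> i) *\<^sub>R T i)"
proof -
  have "T v = T (\<Sum>i\<in>Basis. (v \<bullet> i) *\<^sub>R i)" by (simp add: euclidean_representation)
  also have "\<dots> = (\<Sum>i\<in>Basis. (v \<bullet> i) *\<^sub>R T i)"
    using assms by (simp add: linear_sum linear_scale)
  finally show ?thesis .
qed

text \<open>In the chain rule the inner derivative supplies a direction that moves with
  \<open>z\<close>, whereas \<open>Ck_on\<close> controls derivatives in fixed directions. Expanding
  over \<open>Basis\<close> turns the derivative of the composite into a finite sum of products, to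
  which the induction hypothesis applies.\<close>

lemma Ck_on_compose:
  fixes f :: "'a::euclidean_space \<Rightarrow> 'b::euclidean_space" and g :: "'b \<Rightarrow> 'c::real_normed_vector"
  assumes S: "open S" and T: "open T" and fST: "f ` S \<subseteq> T"
  shows "Ck_on k T g \<Longrightarrow> Ck_on k S f \<Longrightarrow> Ck_on k S (\<lambda>z. g (f z))"
proof (induction k arbitrary: g)
  case 0
  then have "continuous_on T g" "continuous_on S f" by simp_all
  from continuous_on_compose2[OF this fST] show ?case by simp
next
  case (Suc k)
  have d: "((\<lambda>z. g (f z)) has_derivative
      (\<lambda>v. \<Sum>i\<in>Basis. (frechet_derivative f (at z) v \<bullet> i) *\<^sub>R frechet_derivative g (at (f z)) i)) (at z)"
    if "z \<in> S" for z
  proof -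
    have g: "(g has_derivative frechet_derivative g (at (f z))) (at (f z))"
      by (rule Ck_on_has_derivative[OF Suc.prems(1) T]) (use fST that in blast)
    from has_derivative_compose[OF Ck_on_has_derivative[OF Suc.prems(2) S that] g]
    show ?thesis
      by (rule has_derivative_eq_rhs) (rule ext, rule linear_Basis_expand[OF has_derivative_linear[OF g]])
  qed
  show ?case
  proof (rule Ck_on_SucI[OF S d])
    fix v
    have "Ck_on k S (\<lambda>z. frechet_derivative f (at z) v)"
      using Suc.prems(2) by simp
    moreover have "Ck_on k S (\<lambda>z. frechet_derivative g (at (f z)) i)" for i
      using Suc.prems(1) by (intro Suc.IH Ck_on_SucD[OF Suc.prems(2)]) simp
    ultimately show "Ck_on k S
        (\<lambda>z. \<Sum>i\<in>Basis. (frechet_derivative f (at z) v \<bullet> i) *\<^sub>R frechet_derivative g (at (f z)) i)"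
      by (intro Ck_on_sum[OF S] Ck_on_scaleR[OF S] Ck_on_linear[OF S bounded_linear_inner_left])
  qed
qed

lemma Ck_on_real_SucI:
  fixes f :: "real \<Rightarrow> real"
  assumes "open S" "\<And>x. x \<in> S \<Longrightarrow> (f has_real_derivative f' x) (at x)" "Ck_on k S f'"
  shows "Ck_on (Suc k) S f"
proof (rule Ck_on_SucI[OF assms(1) assms(2)[unfolded has_field_derivative_def]])
  show "Ck_on k S (\<lambda>z. f' z * v)" for v
    by (rule Ck_on_linear[OF assms(1) bounded_linear_mult_left assms(3)])
qed

section \<open>Closure properties of smooth functions\<close>

lemma smooth_onD: "smooth_on S f \<Longrightarrow> Ck_on k S f"
  by (simp add: smooth_on_def)

lemma smooth_onI: "(\<And>k. Ck_on k S f) \<Longrightarrow> smooth_on S f"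
  by (simp add: smooth_on_def)

lemma smooth_on_continuous: "smooth_on S f \<Longrightarrow> continuous_on S f"
  using smooth_onD[of S f 0] by simp

lemma smooth_on_has_derivative:
  "smooth_on S f \<Longrightarrow> open S \<Longrightarrow> z \<in> S \<Longrightarrow> (f has_derivative frechet_derivative f (at z)) (at z)"
  by (rule Ck_on_has_derivative[OF smooth_onD])

lemma smooth_on_frechet: "smooth_on S f \<Longrightarrow> smooth_on S (\<lambda>z. frechet_derivative f (at z) v)"
  by (rule smooth_onI, drule_tac k = "Suc k" in smooth_onD) simp

lemma smooth_on_dir_deriv: "smooth_on S f \<Longrightarrow> smooth_on S (dir_deriv v f)"
  using smooth_on_frechet[of S f v] by (simp add: dir_deriv_def[abs_def])

lemma smooth_on_cong:
  "open S \<Longrightarrow> (\<And>z. z \<in> S \<Longrightarrow> f z = g z) \<Longrightarrow> smooth_on S f \<Longrightarrow> smooth_on S g"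
  unfolding smooth_on_def by (metis Ck_on_cong)

lemma smooth_on_subset: "smooth_on S f \<Longrightarrow> T \<subseteq> S \<Longrightarrow> smooth_on T f"
  unfolding smooth_on_def by (metis Ck_on_subset)

lemma smooth_on_local:
  "(\<And>z. z \<in> S \<Longrightarrow> \<exists>T. open T \<and> z \<in> T \<and> smooth_on T f) \<Longrightarrow> smooth_on S f"
  unfolding smooth_on_def by (meson Ck_on_local)

lemma smooth_on_const: "smooth_on S (\<lambda>z. c)"
  by (simp add: smooth_onI Ck_on_const)

lemma smooth_on_id: "open S \<Longrightarrow> smooth_on S (\<lambda>z. z)"
  by (simp add: smooth_onI Ck_on_id)

lemma smooth_on_linear: "open S \<Longrightarrow> bounded_linear T \<Longrightarrow> smooth_on S f \<Longrightarrow> smooth_on S (\<lambda>z. T (f z))"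
  unfolding smooth_on_def by (metis Ck_on_linear)

lemma smooth_on_add: "open S \<Longrightarrow> smooth_on S f \<Longrightarrow> smooth_on S g \<Longrightarrow> smooth_on S (\<lambda>z. f z + g z)"
  unfolding smooth_on_def by (metis Ck_on_add)

lemma smooth_on_scaleR:
  "open S \<Longrightarrow> smooth_on S f \<Longrightarrow> smooth_on S g \<Longrightarrow> smooth_on S (\<lambda>z. f z *\<^sub>R g z)"
  unfolding smooth_on_def by (metis Ck_on_scaleR)

lemma smooth_on_mult:
  fixes f g :: "'e::euclidean_space \<Rightarrow> real"
  shows "open S \<Longrightarrow> smooth_on S f \<Longrightarrow> smooth_on S g \<Longrightarrow> smooth_on S (\<lambda>z. f z * g z)"
  using smooth_on_scaleR[of S f g] by simp

lemma smooth_on_diff: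
  fixes f g :: "'e::euclidean_space \<Rightarrow> 'b::real_normed_vector"
  shows "open S \<Longrightarrow> smooth_on S f \<Longrightarrow> smooth_on S g \<Longrightarrow> smooth_on S (\<lambda>z. f z - g z)"
  using smooth_on_add[of S f "\<lambda>z. - g z"] smooth_on_linear[of S uminus g]
  by (simp add: bounded_linear_minus bounded_linear_ident)

lemma smooth_on_sum:
  "open S \<Longrightarrow> (\<And>i. i \<in> I \<Longrightarrow> smooth_on S (f i)) \<Longrightarrow> smooth_on S (\<lambda>z. \<Sum>i\<in>I. f i z)"
  unfolding smooth_on_def by (metis Ck_on_sum)

lemma smooth_on_compose:
  fixes f :: "'a::euclidean_space \<Rightarrow> 'b::euclidean_space" and g :: "'b \<Rightarrow> 'c::real_normed_vector"
  shows "open S \<Longrightarrow> open T \<Longrightarrow> f ` S \<subseteq> T \<Longrightarrow> smooth_on T g \<Longrightarrow> smooth_on S f \<Longrightarrow> smooth_on S (\<lambda>z. g (f z))"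
  unfolding smooth_on_def by (metis Ck_on_compose)

lemma smooth_on_inverse: "smooth_on {0<..} (inverse :: real \<Rightarrow> real)"
proof (rule smooth_onI)
  fix k show "Ck_on k {0<..} (inverse :: real \<Rightarrow> real)"
  proof (induction k)
    case 0
    then show ?case by (auto intro!: continuous_intros)
  next
    case (Suc k)
    have "Ck_on k {0<..} (\<lambda>x::real. (-1) *\<^sub>R (inverse x *\<^sub>R inverse x))"
      by (intro Ck_on_scaleR Ck_on_const Suc) auto
    then show ?case
      by (intro Ck_on_real_SucI[where f' = "\<lambda>x. (-1) *\<^sub>R (inverse x *\<^sub>R inverse x)"])
        (auto intro!: derivative_eq_intros simp: power2_eq_square)
  qed
qed

lemma smooth_on_ln: "smooth_on {0<..} (ln :: real \<Rightarrow> real)"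
proof (rule smooth_onI)
  fix k show "Ck_on k {0<..} (ln :: real \<Rightarrow> real)"
  proof (cases k)
    case 0
    then show ?thesis by (auto intro!: continuous_intros)
  next
    case (Suc k')
    show ?thesis unfolding Suc
      by (intro Ck_on_real_SucI[where f' = inverse] smooth_onD smooth_on_inverse)
        (auto intro!: derivative_eq_intros simp: inverse_eq_divide)
  qed
qed

section \<open>Integrals depending on a parameter\<close>

text \<open>Differentiability is required in \<open>z\<close> only. The integration variable enters
  through joint continuity of every derivative, which over a compact set gives the uniformity needed
  for differentiating under the integral; \<open>Y\<close> carries no smooth structure.\<close>

primrec Ck_param ::
  "nat \<Rightarrow> 'e::euclidean_space set \<Rightarrow> 'y::t2_space set \<Rightarrow> ('e \<Rightarrow> 'y \<Rightarrow> real) \<Rightarrow> bool" where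
  "Ck_param 0 S Y G \<longleftrightarrow> continuous_on (S \<times> Y) (\<lambda>(z, y). G z y)"
| "Ck_param (Suc k) S Y G \<longleftrightarrow> continuous_on (S \<times> Y) (\<lambda>(z, y). G z y) \<and>
     (\<forall>y\<in>Y. (\<lambda>z. G z y) differentiable_on S) \<and>
     (\<forall>v. Ck_param k S Y (\<lambda>z y. frechet_derivative (\<lambda>z. G z y) (at z) v))"

lemma Ck_param_continuous: "Ck_param k S Y G \<Longrightarrow> continuous_on (S \<times> Y) (\<lambda>(z, y). G z y)"
  by (cases k) simp_all

lemma Ck_param_has_derivative:
  assumes "Ck_param (Suc k) S Y G" "open S" "z \<in> S" "y \<in> Y"
  shows "((\<lambda>z. G z y) has_derivative frechet_derivative (\<lambda>z. G z y) (at z)) (at z)"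
proof -
  have "(\<lambda>z. G z y) differentiable (at z within S)"
    using assms(1,3,4) unfolding Ck_param.simps differentiable_on_def by blast
  then have "(\<lambda>z. G z y) differentiable (at z)"
    using at_within_open[OF assms(3,2)] by simp
  then show ?thesis by (simp add: frechet_derivative_works)
qed

lemma Ck_param_cong:
  assumes S: "open S"
  shows "(\<And>z y. z \<in> S \<Longrightarrow> y \<in> Y \<Longrightarrow> F z y = G z y) \<Longrightarrow> Ck_param k S Y F \<Longrightarrow> Ck_param k S Y G"
proof (induction k arbitrary: F G)
  case 0
  have "continuous_on (S \<times> Y) (\<lambda>(z, y). F z y) \<longleftrightarrow> continuous_on (S \<times> Y) (\<lambda>(z, y). G z y)"
    by (rule continuous_on_cong) (use 0(1) in auto)
  then show ?case using 0(2) by simp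
next
  case (Suc k)
  have c: "continuous_on (S \<times> Y) (\<lambda>(z, y). F z y) \<longleftrightarrow> continuous_on (S \<times> Y) (\<lambda>(z, y). G z y)"
    by (rule continuous_on_cong) (use Suc.prems(1) in auto)
  have d: "((\<lambda>z. G z y) has_derivative frechet_derivative (\<lambda>z. F z y) (at z)) (at z)"
    if "z \<in> S" "y \<in> Y" for z y
    by (rule has_derivative_transform_within_open[OF Ck_param_has_derivative[OF Suc.prems(2) S that] S that(1)])
      (use Suc.prems(1) that in blast)
  have "Ck_param k S Y (\<lambda>z y. frechet_derivative (\<lambda>z. G z y) (at z) v)" for v
  proof (rule Suc.IH)
    show "Ck_param k S Y (\<lambda>z y. frechet_derivative (\<lambda>z. F z y) (at z) v)"
      using Suc.prems(2) by simp
    show "frechet_derivative (\<lambda>z. F z y) (at z) v = frechet_derivative (\<lambda>z. G z y) (at z) v"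
      if "z \<in> S" "y \<in> Y" for z y
      using frechet_derivative_at[OF d[OF that]] by simp
  qed
  moreover have "(\<lambda>z. G z y) differentiable_on S" if "y \<in> Y" for y
    by (rule differentiable_at_imp_differentiable_on, rule differentiableI, rule d[OF _ that])
  ultimately show ?case
    using c Ck_param_continuous[OF Suc.prems(2)] by simp
qed

lemma Ck_param_SucI:
  assumes S: "open S" and c: "continuous_on (S \<times> Y) (\<lambda>(z, y). G z y)"
    and d: "\<And>z y. z \<in> S \<Longrightarrow> y \<in> Y \<Longrightarrow> ((\<lambda>z. G z y) has_derivative G' z y) (at z)"
    and G': "\<And>v. Ck_param k S Y (\<lambda>z y. G' z y v)"
  shows "Ck_param (Suc k) S Y G"
proof -
  have "Ck_param k S Y (\<lambda>z y. frechet_derivative (\<lambda>z. G z y) (at z) v)" for v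
  proof (rule Ck_param_cong[OF S _ G'])
    show "G' z y v = frechet_derivative (\<lambda>z. G z y) (at z) v"
      if "z \<in> S" "y \<in> Y" for z y
      using frechet_derivative_at[OF d[OF that]] by simp
  qed
  moreover have "(\<lambda>z. G z y) differentiable_on S" if "y \<in> Y" for y
    by (rule differentiable_at_imp_differentiable_on, rule differentiableI, rule d[OF _ that])
  ultimately show ?thesis using c by simp
qed

lemma Ck_param_local:
  assumes S: "open S"
  shows "(\<And>y. y \<in> Y \<Longrightarrow> \<exists>V. open V \<and> y \<in> V \<and> Ck_param k S V G) \<Longrightarrow> Ck_param k S Y G"
proof (induction k arbitrary: G)
  have cont: "continuous_on (S \<times> Y) (\<lambda>(z, y). G z y)"
    if loc: "\<And>y. y \<in> Y \<Longrightarrow> \<exists>V. open V \<and> y \<in> V \<and> Ck_param k S V G" for G k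
  proof (rule continuous_on_open_local)
    fix u assume u: "u \<in> S \<times> Y"
    then obtain V where V: "open V" "snd u \<in> V" "Ck_param k S V G"
      using loc[of "snd u"] by auto
    then have "open (S \<times> V)" "u \<in> S \<times> V" "continuous_on (S \<times> V) (\<lambda>(z, y). G z y)"
      using S u Ck_param_continuous by (auto intro: open_Times)
    then show "\<exists>T. open T \<and> u \<in> T \<and> continuous_on T (\<lambda>(z, y). G z y)" by blast
  qed
  {
    case 0
    then show ?case using cont[of 0 G] by simp
  next
    case (Suc k)
    have "Ck_param k S Y (\<lambda>z y. frechet_derivative (\<lambda>z. G z y) (at z) v)" for v
    proof (rule Suc.IH)
      fix y assume "y \<in> Y"
      from Suc.prems[OF this]
      show "\<exists>V. open V \<and> y \<in> V \<and> Ck_param k S V (\<lambda>z y. frechet_derivative (\<lambda>z. G z y) (at z) v)"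
        by auto
    qed
    moreover have "(\<lambda>z. G z y) differentiable_on S" if "y \<in> Y" for y
      using Suc.prems[OF that] by auto
    ultimately show ?case
      using cont[of "Suc k" G, OF Suc.prems] by simp
  }
qed

text \<open>Feeds functions that are smooth in all coordinates into \<open>Ck_param\<close>: the
  second argument is read through a continuous map \<psi>, which is later a chart of the manifold or
  the identity on a time interval.\<close>

lemma Ck_param_product:
  fixes q :: "'a::euclidean_space \<times> 'b::euclidean_space \<Rightarrow> real"
  assumes S: "open S" and T: "open T" and psi: "continuous_on Y \<psi>" "\<psi> ` Y \<subseteq> T"
  shows "Ck_on k (S \<times> T) q \<Longrightarrow> Ck_param k S Y (\<lambda>z y. q (z, \<psi> y))"
proof (induction k arbitrary: q)
  have c0: "continuous_on (S \<times> Y) (\<lambda>u. (fst u, \<psi> (snd u)))"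
    by (intro continuous_intros continuous_on_compose2[OF psi(1)]) auto
  have im: "(\<lambda>u. (fst u, \<psi> (snd u))) ` (S \<times> Y) \<subseteq> S \<times> T"
    using psi(2) by auto
  {
  case 0
  then have "continuous_on (S \<times> T) q" by simp
  from continuous_on_compose2[OF this c0 im]
  show ?case by (simp add: case_prod_beta')
next
  case (Suc k)
  have ST: "open (S \<times> T)" using S T by (rule open_Times)
  have "continuous_on (S \<times> T) q"
    by (rule Ck_on_continuous[OF Suc.prems])
  then have c: "continuous_on (S \<times> Y) (\<lambda>(z, y). q (z, \<psi> y))"
    using continuous_on_compose2[OF _ c0 im] by (simp add: case_prod_beta')
  show ?case
  proof (rule Ck_param_SucI[OF S c, where G' = "\<lambda>z y v. frechet_derivative q (at (z, \<psi> y)) (v, 0)"])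
    fix z y assume zy: "z \<in> S" "y \<in> Y"
    then have "(z, \<psi> y) \<in> S \<times> T" using psi(2) by auto
    note q = Ck_on_has_derivative[OF Suc.prems ST this]
    have "((\<lambda>z. (z, \<psi> y)) has_derivative (\<lambda>v. (v, 0))) (at z)"
      by (rule has_derivative_Pair[OF has_derivative_ident has_derivative_const])
    from has_derivative_compose[OF this q]
    show "((\<lambda>z. q (z, \<psi> y)) has_derivative (\<lambda>v. frechet_derivative q (at (z, \<psi> y)) (v, 0))) (at z)" .
  next
    fix v
    show "Ck_param k S Y (\<lambda>z y. frechet_derivative q (at (z, \<psi> y)) (v, 0))"
      by (rule Suc.IH) (use Suc.prems in simp)
  qed
  }
qed

lemma set_integrable_compact:
  fixes g :: "'y::t2_space \<Rightarrow> real"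
  assumes "sets N = sets borel" "compact K" "emeasure N K < \<infinity>" "continuous_on K g"
  shows "set_integrable N K g"
proof -
  have K: "K \<in> sets borel" using assms(2) by (simp add: borel_closed compact_imp_closed)
  have m: "(\<lambda>y. indicator K y *\<^sub>R g y) \<in> borel_measurable N"
    using borel_measurable_continuous_on_indicator[OF K assms(4)]
    by (simp add: measurable_cong_sets[OF assms(1) refl])
  have "bounded (g ` K)" using assms(2,4) by (simp add: compact_continuous_image compact_imp_bounded)
  then obtain B where B: "\<And>y. y \<in> K \<Longrightarrow> \<bar>g y\<bar> \<le> B" by (auto simp: bounded_iff)
  show ?thesis unfolding set_integrable_def
    by (rule integrableI_bounded_set[of K, OF _ m _ _ , of B])
      (use B K assms in \<open>auto simp: indicator_def\<close>)
qed

lemma set_lebesgue_integral_abs_le: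
  fixes f g :: "'y \<Rightarrow> real"
  assumes "set_integrable N K g" "\<And>y. y \<in> K \<Longrightarrow> \<bar>f y\<bar> \<le> g y" "set_integrable N K f"
  shows "\<bar>LINT y:K|N. f y\<bar> \<le> (LINT y:K|N. g y)"
proof -
  have "\<bar>LINT y:K|N. f y\<bar> \<le> (LINT y:K|N. \<bar>f y\<bar>)"
    using set_integral_norm_bound[OF assms(3)] by simp
  also have "\<dots> \<le> (LINT y:K|N. g y)"
    by (rule set_integral_mono) (use assms set_integrable_norm[OF assms(3)] in auto)
  finally show ?thesis .
qed

lemma convex_segment_point:
  fixes z0 z :: "'e::real_vector"
  assumes "convex S" "z0 \<in> S" "z \<in> S" "t \<in> {0..1}"
  shows "z0 + t *\<^sub>R (z - z0) \<in> S"
proof -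
  have "(1 - t) *\<^sub>R z0 + t *\<^sub>R z \<in> S" using assms by (intro convexD) auto
  then show ?thesis by (simp add: algebra_simps)
qed

text \<open>The weight \<open>w\<close> will be a test function on its support, or 1 on a compact
  interval. It does not depend on the parameter, so differentiability is asked of the other factor
  alone.\<close>

locale finite_on_compact =
  fixes N :: "'y::t2_space measure" and K :: "'y set" and w :: "'y \<Rightarrow> real"
  assumes sets_N: "sets N = sets borel" and K: "compact K" and finK: "emeasure N K < \<infinity>"
    and w: "continuous_on K w"
begin

lemma K_in_sets: "K \<in> sets N"
  using K by (simp add: sets_N borel_closed compact_imp_closed)

lemma set_integrable_times:
  "continuous_on K g \<Longrightarrow> set_integrable N K (\<lambda>y. w y * g y)"
  by (intro set_integrable_compact[OF sets_N K finK] continuous_intros w)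

lemma integral_w_nonneg: "0 \<le> (LINT y:K|N. \<bar>w y\<bar>)"
  unfolding set_lebesgue_integral_def by (rule integral_nonneg_AE) auto

lemma abs_integral_le:
  assumes "continuous_on K g" "\<And>y. y \<in> K \<Longrightarrow> \<bar>g y\<bar> \<le> e"
  shows "\<bar>LINT y:K|N. w y * g y\<bar> \<le> (LINT y:K|N. \<bar>w y\<bar>) * e"
proof -
  have "\<bar>LINT y:K|N. w y * g y\<bar> \<le> (LINT y:K|N. \<bar>w y\<bar> * e)"
  proof (rule set_lebesgue_integral_abs_le)
    show "set_integrable N K (\<lambda>y. \<bar>w y\<bar> * e)"
      by (intro set_integrable_compact[OF sets_N K finK] continuous_intros w)
    show "set_integrable N K (\<lambda>y. w y * g y)" by (rule set_integrable_times[OF assms(1)])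
    show "\<bar>w y * g y\<bar> \<le> \<bar>w y\<bar> * e" if "y \<in> K" for y
      using assms(2)[OF that] by (simp add: abs_mult mult_left_mono)
  qed
  then show ?thesis by simp
qed

lemma slice_continuous:
  assumes "continuous_on (S \<times> K) (\<lambda>(z, y). G z y)" "z \<in> S"
  shows "continuous_on K (G z)"
proof -
  have "continuous_on K (\<lambda>y. (\<lambda>(z, y). G z y) (z, y))"
    by (rule continuous_on_compose2[OF assms(1)]) (use assms(2) in \<open>auto intro!: continuous_intros\<close>)
  then show ?thesis by simp
qed

lemma continuous_on_param_integral:
  fixes G :: "'e::euclidean_space \<Rightarrow> 'y \<Rightarrow> real"
  assumes G: "continuous_on (S \<times> K) (\<lambda>(z, y). G z y)"
  shows "continuous_on S (\<lambda>z. LINT y:K|N. w y * G z y)"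
  unfolding continuous_on_iff
proof (intro ballI allI impI)
  fix z and e :: real assume z: "z \<in> S" and e: "0 < e"
  define M where "M = (LINT y:K|N. \<bar>w y\<bar>)"
  have M: "0 \<le> M" unfolding M_def by (rule integral_w_nonneg)
  \<comment> \<open>The added 1 covers a vanishing weight and keeps the final estimate strict, as M
    e / (M + 1) < e.\<close>
  have "0 < e / (M + 1)" using M e by auto
  from continuous_on_prod_compactE[OF G K z this]
  obtain X where X: "z \<in> X" "open X"
    and X': "\<forall>x\<in>X \<inter> S. \<forall>t\<in>K. dist (G x t) (G z t) \<le> e / (M + 1)"
    unfolding prod.case by metis
  obtain r where r: "0 < r" "ball z r \<subseteq> X" using X openE by blast
  show "\<exists>r>0. \<forall>x\<in>S. dist x z < r \<longrightarrow> dist (LINT y:K|N. w y * G x y) (LINT y:K|N. w y * G z y) < e"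
  proof (intro exI[of _ r] conjI ballI impI)
    fix x assume x: "x \<in> S" "dist x z < r"
    then have xX: "x \<in> X \<inter> S" using r by (auto simp: dist_commute)
    have "(LINT y:K|N. w y * G x y) - (LINT y:K|N. w y * G z y) = (LINT y:K|N. w y * (G x y - G z y))"
      unfolding right_diff_distrib
      by (rule set_integral_diff(2)[symmetric]) (intro set_integrable_times slice_continuous[OF G] x z)+
    moreover have "\<bar>LINT y:K|N. w y * (G x y - G z y)\<bar> \<le> (LINT y:K|N. \<bar>w y\<bar>) * (e / (M + 1))"
    proof (rule abs_integral_le)
      show "continuous_on K (\<lambda>y. G x y - G z y)"
        by (intro continuous_on_diff slice_continuous[OF G] x z)
    qed (use X' xX in \<open>auto simp: dist_real_def\<close>)
    then have "\<bar>LINT y:K|N. w y * (G x y - G z y)\<bar> \<le> M * (e / (M + 1))" by (simp add: M_def)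
    moreover have "M * (e / (M + 1)) < e" using M e by (simp add: field_simps)
    ultimately show "dist (LINT y:K|N. w y * G x y) (LINT y:K|N. w y * G z y) < e"
      by (simp add: dist_real_def)
  qed (rule r(1))
qed

text \<open>The mean value inequality is applied for each \<open>y\<close> on one ball around
  \<open>z\<close>. Compactness of \<open>K\<close> makes the radius independent of
  \<open>y\<close>, so the linearization error can be integrated.\<close>

lemma has_derivative_param_integral:
  fixes G :: "'e::euclidean_space \<Rightarrow> 'y \<Rightarrow> real"
  assumes S: "open S" and G: "continuous_on (S \<times> K) (\<lambda>(z, y). G z y)"
    and d: "\<And>z y. z \<in> S \<Longrightarrow> y \<in> K \<Longrightarrow> ((\<lambda>z. G z y) has_derivative G' z y) (at z)"
    and G': "\<And>v. continuous_on (S \<times> K) (\<lambda>(z, y). G' z y v)"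
    and z: "z \<in> S"
  shows "((\<lambda>z. LINT y:K|N. w y * G z y) has_derivative (\<lambda>v. LINT y:K|N. w y * G' z y v)) (at z)"
  unfolding has_derivative_at_alt
proof (intro conjI allI impI)
  have lin: "linear (G' x y)" if "x \<in> S" "y \<in> K" for x y
    using d[OF that] by (rule has_derivative_linear)
  have int: "set_integrable N K (\<lambda>y. w y * G' z y v)" for v
    by (intro set_integrable_times slice_continuous[OF G'] z)
  have "linear (\<lambda>v. LINT y:K|N. w y * G' z y v)"
  proof (rule linearI)
    fix u v
    have "(LINT y:K|N. w y * G' z y (u + v)) = (LINT y:K|N. w y * G' z y u + w y * G' z y v)"
      by (rule set_lebesgue_integral_cong)
        (use lin[OF z] K_in_sets in \<open>auto simp: linear_add algebra_simps\<close>)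
    also have "\<dots> = (LINT y:K|N. w y * G' z y u) + (LINT y:K|N. w y * G' z y v)"
      by (rule set_integral_add(2)[OF int int])
    finally show "(LINT y:K|N. w y * G' z y (u + v)) = (LINT y:K|N. w y * G' z y u) + (LINT y:K|N. w y * G' z y v)" .
  next
    fix r :: real and v
    have "(LINT y:K|N. w y * G' z y (r *\<^sub>R v)) = (LINT y:K|N. r * (w y * G' z y v))"
      by (rule set_lebesgue_integral_cong)
        (use lin[OF z] K_in_sets in \<open>auto simp: linear_scale algebra_simps\<close>)
    then show "(LINT y:K|N. w y * G' z y (r *\<^sub>R v)) = r *\<^sub>R (LINT y:K|N. w y * G' z y v)" by simp
  qed
  then show "bounded_linear (\<lambda>v. LINT y:K|N. w y * G' z y v)"
    by (simp add: linear_conv_bounded_linear)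
next
  fix e :: real assume e: "0 < e"
  have lin: "linear (G' x y)" if "x \<in> S" "y \<in> K" for x y
    using d[OF that] by (rule has_derivative_linear)
  define M where "M = (LINT y:K|N. \<bar>w y\<bar>)"
  have M: "0 \<le> M" unfolding M_def by (rule integral_w_nonneg)
  \<comment> \<open>Continuity of \<open>G'\<close> is known for each fixed direction only. The
    factor \<open>DIM('e)\<close> is the price of bounding an operator norm by the values on basis
    vectors.\<close>
  define e' where "e' = e / ((M + 1) * real DIM('e))"
  have e': "0 < e'" using M e by (auto simp: e'_def)
  have "\<exists>X. z \<in> X \<and> open X \<and> (\<forall>x\<in>X \<inter> S. \<forall>t\<in>K. dist (G' x t i) (G' z t i) \<le> e')" for i
    using continuous_on_prod_compactE[OF G'[of i] K z e'] unfolding prod.case by metis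
  then obtain X where X: "\<And>i. z \<in> X i" "\<And>i. open (X i)"
    "\<And>i x t. x \<in> X i \<inter> S \<Longrightarrow> t \<in> K \<Longrightarrow> \<bar>G' x t i - G' z t i\<bar> \<le> e'" unfolding dist_real_def by metis
  have "open (S \<inter> (\<Inter>i\<in>Basis. X i))"
    by (intro open_Int open_INT S ballI X(2)) simp
  moreover have "z \<in> S \<inter> (\<Inter>i\<in>Basis. X i)"
    using X(1) z by simp
  ultimately obtain r where r: "0 < r" "ball z r \<subseteq> S \<inter> (\<Inter>i\<in>Basis. X i)" by (meson openE)
  show "\<exists>r>0. \<forall>x. norm (x - z) < r \<longrightarrow>
      norm ((LINT y:K|N. w y * G x y) - (LINT y:K|N. w y * G z y) - (LINT y:K|N. w y * G' z y (x - z)))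
      \<le> e * norm (x - z)"
  proof (intro exI[of _ r] conjI allI impI r(1))
    fix x assume "norm (x - z) < r"
    then have xb: "x \<in> ball z r" by (simp add: dist_norm norm_minus_commute)
    then have x: "x \<in> S" using r by auto
    have bd: "\<bar>G x y - G z y - G' z y (x - z)\<bar> \<le> norm (x - z) * (real DIM('e) * e')" if y: "y \<in> K" for y
    proof -
      have "norm (G x y - G z y - G' z y (x - z)) \<le> norm (x - z) * (real DIM('e) * e')"
      proof (rule differentiable_bound_linearization[where S = "ball z r" and f = "\<lambda>z. G z y" and f' = "\<lambda>u. G' u y"])
        show "z + t *\<^sub>R (x - z) \<in> ball z r" if "t \<in> {0..1}" for t
          using xb r(1) that by (intro convex_segment_point) auto
        show "((\<lambda>z. G z y) has_derivative G' u y) (at u within ball z r)" if "u \<in> ball z r" for u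
          by (rule has_derivative_at_withinI[OF d]) (use r(2) that y in blast)+
        show "z \<in> ball z r" using r by simp
        show "onorm (G' u y - G' z y) \<le> real DIM('e) * e'" if "u \<in> ball z r" for u
        proof (rule onorm_le)
          fix v
          have u: "u \<in> S" "\<And>i. i \<in> Basis \<Longrightarrow> u \<in> X i \<inter> S" using that r by auto
          have "linear (\<lambda>v. G' u y v - G' z y v)"
            using lin[OF u(1) y] lin[OF z y] by (rule linear_compose_sub)
          have "norm (G' u y v - G' z y v) = norm (\<Sum>i\<in>Basis. (v \<bullet> i) *\<^sub>R (G' u y i - G' z y i))"
            by (rule arg_cong[OF linear_Basis_expand[OF \<open>linear _\<close>]])
          also have "\<dots> \<le> (\<Sum>i\<in>Basis. norm ((v \<bullet> i) *\<^sub>R (G' u y i - G' z y i)))"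
            by (rule norm_sum)
          also have "\<dots> \<le> (\<Sum>i\<in>(Basis::'e set). norm v * e')"
          proof (rule sum_mono)
            fix i :: 'e assume i: "i \<in> Basis"
            show "norm ((v \<bullet> i) *\<^sub>R (G' u y i - G' z y i)) \<le> norm v * e'"
              using X(3)[OF u(2)[OF i] y] Basis_le_norm[OF i, of v]
              by (auto simp: abs_mult intro!: mult_mono)
          qed
          finally show "norm ((G' u y - G' z y) v) \<le> real DIM('e) * e' * norm v"
            by (simp add: algebra_simps)
        qed
      qed
      then show ?thesis by simp
    qed
    have cx: "continuous_on K (\<lambda>y. G x y)" "continuous_on K (\<lambda>y. G z y)" "continuous_on K (\<lambda>y. G' z y (x - z))"
      using slice_continuous[OF G x] slice_continuous[OF G z] slice_continuous[OF G' z] by auto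
    have "(LINT y:K|N. w y * G x y) - (LINT y:K|N. w y * G z y) - (LINT y:K|N. w y * G' z y (x - z))
        = (LINT y:K|N. w y * G x y - w y * G z y - w y * G' z y (x - z))"
      using set_integrable_times[OF cx(1)] set_integrable_times[OF cx(2)] set_integrable_times[OF cx(3)]
      by simp
    also have "\<dots> = (LINT y:K|N. w y * (G x y - G z y - G' z y (x - z)))"
      by (simp add: algebra_simps)
    finally have "norm ((LINT y:K|N. w y * G x y) - (LINT y:K|N. w y * G z y) - (LINT y:K|N. w y * G' z y (x - z)))
        \<le> M * (norm (x - z) * (real DIM('e) * e'))"
      using abs_integral_le[OF continuous_on_diff[OF continuous_on_diff[OF cx(1,2)] cx(3)] bd]
      by (simp add: M_def)
    also have "\<dots> = (M / (M + 1)) * e * norm (x - z)"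
      by (simp add: e'_def)
    also have "\<dots> \<le> 1 * e * norm (x - z)"
      using M e by (intro mult_right_mono) (auto simp: field_simps)
    finally show "norm ((LINT y:K|N. w y * G x y) - (LINT y:K|N. w y * G z y) - (LINT y:K|N. w y * G' z y (x - z)))
        \<le> e * norm (x - z)" by simp
  qed
qed

lemma Ck_on_param_integral:
  fixes G :: "'e::euclidean_space \<Rightarrow> 'y \<Rightarrow> real"
  assumes S: "open S"
  shows "Ck_param k S K G \<Longrightarrow> Ck_on k S (\<lambda>z. LINT y:K|N. w y * G z y)"
proof (induction k arbitrary: G)
  case 0
  then show ?case using continuous_on_param_integral by simp
next
  case (Suc k)
  have D: "Ck_param k S K (\<lambda>z y. frechet_derivative (\<lambda>z. G z y) (at z) v)" for v
    using Suc.prems by simp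
  show ?case
    by (rule Ck_on_SucI[OF S has_derivative_param_integral[OF S Ck_param_continuous[OF Suc.prems]
          Ck_param_has_derivative[OF Suc.prems S] Ck_param_continuous[OF D]] Suc.IH[OF D]])
qed

end

text \<open>Each derivative in \<open>z\<close> brings out one more factor \<open>t\<close>, so the
  induction has to run over all powers \<open>m\<close> at once.\<close>

lemma Ck_param_segment:
  fixes g :: "'e::euclidean_space \<Rightarrow> real"
  assumes S: "open S" "convex S" "z0 \<in> S"
  shows "Ck_on k S g \<Longrightarrow> Ck_param k S {0..1} (\<lambda>z t. t ^ m * g (z0 + t *\<^sub>R (z - z0)))"
proof (induction k arbitrary: g m)
  note seg = convex_segment_point[OF S(2,3)]
  have c: "continuous_on (S \<times> {0..1}) (\<lambda>(z, t). t ^ m * g (z0 + t *\<^sub>R (z - z0)))"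
    if "continuous_on S g" for m g
    unfolding case_prod_beta'
    by (intro continuous_intros continuous_on_compose2[OF that]) (use seg in auto)
  {
    case 0
    then show ?case using c by simp
  next
    case (Suc k)
    have cg: "continuous_on S g"
      by (rule Ck_on_continuous[OF Suc.prems])
    show ?case
    proof (rule Ck_param_SucI[OF S(1) c[OF cg], where
          G' = "\<lambda>z t v. t ^ Suc m * frechet_derivative g (at (z0 + t *\<^sub>R (z - z0))) v"])
      fix z t assume zt: "z \<in> S" "t \<in> {0..1::real}"
      let ?y = "z0 + t *\<^sub>R (z - z0)"
      have g: "(g has_derivative frechet_derivative g (at ?y)) (at ?y)"
        by (rule Ck_on_has_derivative[OF Suc.prems S(1) seg[OF zt]])
      have "((\<lambda>z. g (z0 + t *\<^sub>R (z - z0))) has_derivative (\<lambda>v. frechet_derivative g (at ?y) (t *\<^sub>R v))) (at z)"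
        by (rule has_derivative_compose[where f = "\<lambda>z. z0 + t *\<^sub>R (z - z0)", OF _ g])
          (auto intro!: derivative_eq_intros)
      from has_derivative_mult_right[OF this, of "t ^ m"]
      show "((\<lambda>z. t ^ m * g (z0 + t *\<^sub>R (z - z0))) has_derivative
          (\<lambda>v. t ^ Suc m * frechet_derivative g (at ?y) v)) (at z)"
        by (rule has_derivative_eq_rhs) (simp add: linear_scale[OF has_derivative_linear[OF g]] mult_ac)
    next
      fix v
      show "Ck_param k S {0..1} (\<lambda>z t. t ^ Suc m * frechet_derivative g (at (z0 + t *\<^sub>R (z - z0))) v)"
        by (rule Suc.IH) (use Suc.prems in simp)
    qed
  }
qed

text \<open>The function \<open>r i\<close> is the mean of the i-th partial derivative along the
  segment from \<open>z0\<close> to \<open>z\<close>. The fundamental theorem of calculus gives the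
  expansion, and differentiation under the integral gives smoothness.\<close>

lemma hadamard:
  fixes f :: "'e::euclidean_space \<Rightarrow> real"
  assumes f: "smooth_on S f" and S: "open S" "convex S" "z0 \<in> S"
  obtains r where "\<And>i. smooth_on S (r i)"
    "\<And>z. z \<in> S \<Longrightarrow> f z = f z0 + (\<Sum>i\<in>Basis. ((z - z0) \<bullet> i) * r i z)"
    "\<And>i. r i z0 = dir_deriv i f z0"
proof
  define r where "r i z = (LINT t:{0..1}|lborel. 1 * dir_deriv i f (z0 + t *\<^sub>R (z - z0)))" for i z
  interpret finite_on_compact lborel "{0..1::real}" "\<lambda>_. 1"
    by unfold_locales auto
  note seg = convex_segment_point[OF S(2,3)]
  show "smooth_on S (r i)" for i
    unfolding r_def
  proof (rule smooth_onI, rule Ck_on_param_integral[OF S(1)])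
    fix k
    show "Ck_param k S {0..1} (\<lambda>z t. dir_deriv i f (z0 + t *\<^sub>R (z - z0)))"
      using Ck_param_segment[OF S, of k "dir_deriv i f" 0] smooth_on_dir_deriv[OF f] by (simp add: smooth_onD)
  qed
  show "r i z0 = dir_deriv i f z0" for i
    by (simp add: r_def set_lebesgue_integral_def)
  fix z assume z: "z \<in> S"
  let ?y = "\<lambda>t. z0 + t *\<^sub>R (z - z0)"
  have c: "continuous_on {0..1} (\<lambda>t. dir_deriv i f (?y t))" for i
    by (rule continuous_on_compose2[OF smooth_on_continuous[OF smooth_on_dir_deriv[OF f]]])
      (use seg[OF z] in \<open>auto intro!: continuous_intros\<close>)
  have "(LINT t|lborel. indicator {0..1} t *\<^sub>R (\<Sum>i\<in>Basis. ((z - z0) \<bullet> i) * dir_deriv i f (?y t)))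
      = f (?y 1) - f (?y 0)"
  proof (rule integral_FTC_atLeastAtMost)
    fix t :: real assume t: "0 \<le> t" "t \<le> 1"
    have g: "(f has_derivative frechet_derivative f (at (?y t))) (at (?y t))"
      using smooth_on_has_derivative[OF f S(1)] seg[OF z] t by auto
    have y: "(?y has_vector_derivative (z - z0)) (at t within {0..1})"
      by (auto intro!: derivative_eq_intros)
    have "((\<lambda>t. f (?y t)) has_vector_derivative frechet_derivative f (at (?y t)) (z - z0)) (at t within {0..1})"
      using vector_derivative_diff_chain_within[OF y has_derivative_at_withinI[OF g]] by (simp add: o_def)
    moreover have "frechet_derivative f (at (?y t)) (z - z0) = (\<Sum>i\<in>Basis. ((z - z0) \<bullet> i) * dir_deriv i f (?y t))"
      using linear_Basis_expand[OF has_derivative_linear[OF g], of "z - z0"] by (simp add: dir_deriv_def)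
    ultimately show "((\<lambda>t. f (?y t)) has_vector_derivative
        (\<Sum>i\<in>Basis. ((z - z0) \<bullet> i) * dir_deriv i f (?y t))) (at t within {0..1})" by simp
  qed (auto intro!: continuous_intros c)
  moreover have "(LINT t|lborel. indicator {0..1} t *\<^sub>R (\<Sum>i\<in>Basis. ((z - z0) \<bullet> i) * dir_deriv i f (?y t)))
      = (\<Sum>i\<in>Basis. ((z - z0) \<bullet> i) * r i z)"
  proof -
    have "set_integrable lborel {0..1} (\<lambda>t. dir_deriv i f (?y t))" for i
      using set_integrable_times[OF c] by simp
    then have i: "integrable lborel (\<lambda>t. indicator {0..1} t * dir_deriv i f (?y t))" for i
      by (simp add: set_integrable_def)
    have "(LINT t|lborel. indicator {0..1} t *\<^sub>R (\<Sum>i\<in>Basis. ((z - z0) \<bullet> i) * dir_deriv i f (?y t)))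
      = (LINT t|lborel. (\<Sum>i\<in>Basis. ((z - z0) \<bullet> i) * (indicator {0..1} t * dir_deriv i f (?y t))))"
      by (simp add: sum_distrib_left mult_ac)
    also have "\<dots> = (\<Sum>i\<in>Basis. ((z - z0) \<bullet> i) * r i z)"
      using i by (simp add: r_def set_lebesgue_integral_def)
    finally show ?thesis .
  qed
  ultimately show "f z = f z0 + (\<Sum>i\<in>Basis. ((z - z0) \<bullet> i) * r i z)" by simp
qed

section \<open>Flat functions and cutoffs\<close>

text \<open>The classical exp(-1/r), extended by 0, times a power of 1/r. With these powers the span
  of the family is closed under differentiation, so smoothness follows for all of them by one
  induction.\<close>

definition flat_pow :: "nat \<Rightarrow> real \<Rightarrow> real" where
  "flat_pow n r = (if 0 < r then exp (- inverse r) * inverse r ^ n else 0)"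

abbreviation flat :: "real \<Rightarrow> real" where
  "flat \<equiv> flat_pow 0"

lemma flat_pow_nonneg: "0 \<le> flat_pow n r"
  by (simp add: flat_pow_def)

lemma flat_pow_pos: "0 < r \<Longrightarrow> 0 < flat_pow n r"
  by (simp add: flat_pow_def)

lemma flat_pow_nonpos: "r \<le> 0 \<Longrightarrow> flat_pow n r = 0"
  by (simp add: flat_pow_def)

text \<open>A single term of the exponential series at 1/r already dominates. The term of order n +
  2 leaves the factor r^2, enough for the difference quotient at 0 to vanish.\<close>

lemma flat_pow_le:
  assumes "0 < r"
  shows "flat_pow n r \<le> fact (n + 2) * r\<^sup>2"
proof -
  let ?y = "inverse r"
  have y: "0 < ?y" using assms by simp
  define c :: real where "c = fact (n + 2)"
  have c: "0 < c" unfolding c_def by (rule fact_gt_zero)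
  have "?y ^ (n + 2) /\<^sub>R c = (\<Sum>k\<in>{n + 2}. ?y ^ k /\<^sub>R fact k)" by (simp add: c_def)
  also have "\<dots> \<le> (\<Sum>k. ?y ^ k /\<^sub>R fact k)"
    by (rule sum_le_suminf[OF summable_exp_generic]) (use y in auto)
  finally have "?y ^ (n + 2) /\<^sub>R c \<le> exp ?y" by (simp add: exp_def)
  then have "c * (inverse c * ?y ^ (n + 2)) \<le> c * exp ?y"
    using c by (intro mult_left_mono) (simp_all only: real_scaleR_def less_imp_le)
  moreover have "c * (inverse c * ?y ^ (n + 2)) = ?y ^ (n + 2)" using c by simp
  ultimately have "?y ^ (n + 2) \<le> c * exp ?y" by (simp only:)
  then have "?y ^ (n + 2) * exp (- ?y) \<le> c * exp ?y * exp (- ?y)"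
    by (rule mult_right_mono) simp
  then have "?y ^ (n + 2) * exp (- ?y) \<le> c"
    by (simp add: mult.assoc flip: exp_add)
  then have "?y ^ (n + 2) * exp (- ?y) * r\<^sup>2 \<le> c * r\<^sup>2"
    by (rule mult_right_mono) simp
  then have "?y ^ n * exp (- ?y) * (?y\<^sup>2 * r\<^sup>2) \<le> c * r\<^sup>2"
    by (simp only: power_add mult_ac)
  moreover have "?y\<^sup>2 * r\<^sup>2 = 1" using assms by (simp add: power_mult_distrib[symmetric])
  ultimately have "exp (- ?y) * ?y ^ n \<le> c * r\<^sup>2" by (simp only: mult.commute mult_1_right)
  then show ?thesis using assms by (simp only: flat_pow_def c_def if_True)
qed

lemma flat_pow_has_derivative:
  "(flat_pow n has_real_derivative flat_pow (n + 2) r - real n * flat_pow (n + 1) r) (at r)"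
proof (cases r "0::real" rule: linorder_cases)
  case less
  have "((\<lambda>r. 0) has_real_derivative 0) (at r)" by simp
  then have "(flat_pow n has_real_derivative 0) (at r)"
    by (rule has_field_derivative_transform_within_open[of _ _ _ "{..<0}"])
      (use less in \<open>auto simp: flat_pow_nonpos\<close>)
  then show ?thesis using less by (simp add: flat_pow_nonpos)
next
  case equal
  have "((\<lambda>h. flat_pow n h / h) \<longlongrightarrow> 0) (at 0)"
  proof (rule Lim_null_comparison[where g = "\<lambda>h. fact (n + 2) * \<bar>h\<bar>"])
    show "\<forall>\<^sub>F h in at 0. norm (flat_pow n h / h) \<le> fact (n + 2) * \<bar>h\<bar>"
    proof (rule always_eventually, rule allI)
      fix h :: real
      show "norm (flat_pow n h / h) \<le> fact (n + 2) * \<bar>h\<bar>"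
      proof (cases "0 < h")
        case True
        then show ?thesis
          using flat_pow_le[OF True, of n] flat_pow_nonneg[of n h]
          by (simp add: pos_divide_le_eq power2_eq_square mult_ac del: fact_Suc add_2_eq_Suc')
      next
        case False
        then have "norm (flat_pow n h / h) = 0" by (simp add: flat_pow_nonpos)
        also have "0 \<le> fact (n + 2) * \<bar>h\<bar>" by (intro mult_nonneg_nonneg) auto
        finally show ?thesis .
      qed
    qed
    show "((\<lambda>h. fact (n + 2) * \<bar>h\<bar>) \<longlongrightarrow> 0) (at (0::real))"
      by (auto intro!: tendsto_eq_intros)
  qed
  then show ?thesis using equal by (simp add: has_field_derivative_iff flat_pow_nonpos)
next
  case greater
  have "((\<lambda>r. exp (- inverse r) * inverse r ^ n) has_real_derivative
      flat_pow (n + 2) r - real n * flat_pow (n + 1) r) (at r)"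
    using greater
    by (cases n) (auto intro!: derivative_eq_intros simp: flat_pow_def power2_eq_square algebra_simps, case_tac nat, auto)
  then show ?thesis
    by (rule has_field_derivative_transform_within_open[of _ _ _ "{0<..}"])
      (use greater in \<open>auto simp: flat_pow_def\<close>)
qed

lemma smooth_on_flat_pow: "smooth_on UNIV (flat_pow n)"
proof (rule smooth_onI)
  fix k show "Ck_on k UNIV (flat_pow n)"
  proof (induction k arbitrary: n)
    case 0
    have "continuous_on UNIV (flat_pow n)"
      using flat_pow_has_derivative DERIV_isCont by (intro continuous_at_imp_continuous_on) blast
    then show ?case by simp
  next
    case (Suc k)
    have "Ck_on k UNIV (\<lambda>r. flat_pow (n + 2) r + (- real n) *\<^sub>R flat_pow (n + 1) r)"
      by (intro Ck_on_add Ck_on_scaleR Ck_on_const Suc.IH) auto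
    then show ?case
      by (intro Ck_on_real_SucI[where f' = "\<lambda>r. flat_pow (n + 2) r - real n * flat_pow (n + 1) r"]
          flat_pow_has_derivative) auto
  qed
qed

definition smooth_step :: "real \<Rightarrow> real" where
  "smooth_step r = flat (r - 1 / 4) * inverse (flat (r - 1 / 4) + flat (1 / 2 - r))"

lemma smooth_step_denominator: "0 < flat (r - 1 / 4) + flat (1 / 2 - r)"
proof (cases "1 / 4 < r")
  case True
  then show ?thesis using flat_pow_pos[of "r - 1/4" 0] flat_pow_nonneg[of 0 "1 / 2 - r"] by simp
next
  case False
  then show ?thesis using flat_pow_pos[of "1/2 - r" 0] flat_pow_nonneg[of 0 "r - 1 / 4"] by simp
qed

lemma smooth_on_smooth_step: "smooth_on UNIV smooth_step"
proof -
  have 1: "smooth_on UNIV (\<lambda>r. flat (r - 1 / 4))" "smooth_on UNIV (\<lambda>r. flat (1 / 2 - r))"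
    by (intro smooth_on_compose[OF open_UNIV open_UNIV _ smooth_on_flat_pow] smooth_on_diff
        smooth_on_id smooth_on_const; simp)+
  have "smooth_on UNIV (\<lambda>r. inverse (flat (r - 1 / 4) + flat (1 / 2 - r)))"
    by (rule smooth_on_compose[OF open_UNIV _ _ smooth_on_inverse])
      (use smooth_step_denominator 1 in \<open>auto intro: smooth_on_add\<close>)
  then have "smooth_on UNIV (\<lambda>r. flat (r - 1 / 4) * inverse (flat (r - 1 / 4) + flat (1 / 2 - r)))"
    by (rule smooth_on_mult[OF open_UNIV 1(1)])
  then show ?thesis by (simp add: smooth_step_def[abs_def])
qed

lemma smooth_step_0: "r \<le> 1 / 4 \<Longrightarrow> smooth_step r = 0"
  by (simp add: smooth_step_def flat_pow_nonpos)

lemma smooth_step_1: "1 / 2 \<le> r \<Longrightarrow> smooth_step r = 1"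
  using smooth_step_denominator[of r] by (simp add: smooth_step_def flat_pow_nonpos)

lemma smooth_step_nonneg: "0 \<le> smooth_step r"
  using smooth_step_denominator[of r] by (simp add: smooth_step_def flat_pow_nonneg)

text \<open>The step is applied to the squared distance, a polynomial, so that nothing special
  happens at the centre.\<close>

definition ball_bump :: "'e::euclidean_space \<Rightarrow> real \<Rightarrow> 'e \<Rightarrow> real" where
  "ball_bump z0 R z = smooth_step (1 - ((z - z0) \<bullet> (z - z0)) / R\<^sup>2)"

lemma smooth_on_ball_bump: "smooth_on UNIV (ball_bump (z0::'e::euclidean_space) R)"
proof -
  have "smooth_on UNIV (\<lambda>z. \<Sum>i\<in>Basis. ((z - z0) \<bullet> i) * ((z - z0) \<bullet> i))"
    by (intro smooth_on_sum smooth_on_mult smooth_on_linear[where T = "\<lambda>z. z \<bullet> _"] bounded_linear_inner_left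
        smooth_on_diff smooth_on_id smooth_on_const open_UNIV)
  then have "smooth_on UNIV (\<lambda>z. 1 - inverse (R\<^sup>2) * ((z - z0) \<bullet> (z - z0)))"
    by (intro smooth_on_diff smooth_on_mult smooth_on_const open_UNIV)
      (simp flip: euclidean_inner)
  from smooth_on_compose[OF open_UNIV open_UNIV _ smooth_on_smooth_step this]
  show ?thesis by (simp add: ball_bump_def[abs_def] divide_inverse mult.commute)
qed

lemma ball_bump_0: "0 < R \<Longrightarrow> z \<notin> ball z0 R \<Longrightarrow> ball_bump z0 R z = 0"
proof -
  assume R: "0 < R" and "z \<notin> ball z0 R"
  then have "R\<^sup>2 \<le> (norm (z - z0))\<^sup>2" by (simp add: dist_norm norm_minus_commute power_mono)
  then have "R\<^sup>2 \<le> (z - z0) \<bullet> (z - z0)" by (simp add: power2_norm_eq_inner)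
  then have "1 \<le> ((z - z0) \<bullet> (z - z0)) / R\<^sup>2" using R by (simp add: field_simps)
  then show ?thesis unfolding ball_bump_def by (intro smooth_step_0) linarith
qed

lemma ball_bump_1: "0 < R \<Longrightarrow> z \<in> ball z0 (R / 2) \<Longrightarrow> ball_bump z0 R z = 1"
proof -
  assume R: "0 < R" and "z \<in> ball z0 (R / 2)"
  then have "(norm (z - z0))\<^sup>2 \<le> (R / 2)\<^sup>2" by (intro power_mono) (auto simp: dist_norm norm_minus_commute)
  then have "(z - z0) \<bullet> (z - z0) \<le> R\<^sup>2 / 4" by (simp add: power2_norm_eq_inner power_divide)
  then have "((z - z0) \<bullet> (z - z0)) / R\<^sup>2 \<le> 1 / 4" using R by (simp add: field_simps)
  then show ?thesis unfolding ball_bump_def by (intro smooth_step_1) linarith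
qed

lemma ball_bump_nonneg: "0 \<le> ball_bump z0 R z"
  by (simp add: ball_bump_def smooth_step_nonneg)

section \<open>Directional derivatives\<close>

lemma dir_deriv_eqI: "(f has_derivative f') (at z) \<Longrightarrow> dir_deriv v f z = f' v"
  unfolding dir_deriv_def by (metis frechet_derivative_at)

text \<open>Differentiability is not assumed: functions that agree near \<open>z\<close> have the
  same set of derivatives at \<open>z\<close>, hence the same value of the choice in
  \<open>frechet_derivative\<close>.\<close>

lemma dir_deriv_cong:
  assumes "open S" "z \<in> S" "\<And>y. y \<in> S \<Longrightarrow> f y = g y"
  shows "dir_deriv v f z = dir_deriv v g z"
proof -
  have "frechet_derivative f (at z) = frechet_derivative g (at z)"
    unfolding frechet_derivative_def
    using has_derivative_transform_within_open[OF _ assms(1,2), of f _ UNIV g]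
      has_derivative_transform_within_open[OF _ assms(1,2), of g _ UNIV f] assms(3)
    by (metis (no_types, lifting))
  then show ?thesis by (simp add: dir_deriv_def)
qed

lemma dir_deriv_const [simp]: "dir_deriv v (\<lambda>z. c) z = 0"
  by (simp add: dir_deriv_def frechet_derivative_const)

lemma dir_deriv_linear_comb:
  assumes "smooth_on S f" "smooth_on S g" "open S" "z \<in> S"
  shows "dir_deriv v (\<lambda>y. a * f y + b * g y) z = a * dir_deriv v f z + b * dir_deriv v g z"
  by (subst dir_deriv_eqI[OF has_derivative_add[OF has_derivative_mult_right[OF smooth_on_has_derivative[OF assms(1,3,4)]]
        has_derivative_mult_right[OF smooth_on_has_derivative[OF assms(2,3,4)]]]]) (simp add: dir_deriv_def)

lemma dir_deriv_mult:
  assumes "smooth_on S f" "smooth_on S g" "open S" "z \<in> S"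
  shows "dir_deriv v (\<lambda>y. f y * g y) z = f z * dir_deriv v g z + g z * dir_deriv v f z"
  by (subst dir_deriv_eqI[OF has_derivative_mult[OF smooth_on_has_derivative[OF assms(1,3,4)]
        smooth_on_has_derivative[OF assms(2,3,4)]]]) (simp add: dir_deriv_def)

lemma dir_deriv_compose:
  assumes "smooth_on S f" "open S" "z \<in> S" "(\<psi> has_real_derivative \<psi>') (at (f z))"
  shows "dir_deriv v (\<lambda>y. \<psi> (f y)) z = \<psi>' * dir_deriv v f z"
  by (subst dir_deriv_eqI[OF has_derivative_compose[OF smooth_on_has_derivative[OF assms(1-3)]
        assms(4)[unfolded has_field_derivative_def]]]) (simp add: dir_deriv_def)

lemma dir_deriv_inner_Basis:
  assumes "i \<in> Basis" "j \<in> Basis"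
  shows "dir_deriv j (\<lambda>z. z \<bullet> i) z = (if i = j then 1 else 0)"
  by (subst dir_deriv_eqI[OF bounded_linear.has_derivative[OF bounded_linear_inner_left has_derivative_ident]])
    (use assms in \<open>simp add: inner_Basis\<close>)

section \<open>Smooth functions on a manifold\<close>

text \<open>The open sets \<open>S\<close> and \<open>- cball z0 R\<close> cover the space; on the
  second one the function is identically 0.\<close>

lemma smooth_on_ball_bump_times:
  fixes r :: "'e::euclidean_space \<Rightarrow> real"
  assumes "smooth_on S r" "open S" "cball z0 R \<subseteq> S" "0 < R"
  shows "smooth_on UNIV (\<lambda>z. if z \<in> S then ball_bump z0 R z * r z else 0)"
proof (rule smooth_on_local)
  fix z :: 'e
  show "\<exists>T. open T \<and> z \<in> T \<and> smooth_on T (\<lambda>z. if z \<in> S then ball_bump z0 R z * r z else 0)"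
  proof (cases "z \<in> S")
    case True
    have h: "smooth_on S (\<lambda>z. ball_bump z0 R z * r z)"
      by (intro smooth_on_mult assms smooth_on_subset[OF smooth_on_ball_bump]) auto
    have "smooth_on S (\<lambda>z. if z \<in> S then ball_bump z0 R z * r z else 0)"
      by (rule smooth_on_cong[OF assms(2) _ h]) simp
    then show ?thesis using True assms(2) by blast
  next
    case False
    have "smooth_on (- cball z0 R) (\<lambda>z. if z \<in> S then ball_bump z0 R z * r z else 0)"
      by (rule smooth_on_cong[OF _ _ smooth_on_const[of _ 0]])
        (use assms(4) in \<open>auto simp: open_Compl intro!: ball_bump_0\<close>)
    then show ?thesis using False assms(3) by (intro exI[of _ "- cball z0 R"]) auto
  qed
qed

locale smooth_manifold =
  fixes A :: "('m::{t2_space, second_countable_topology}, 'e::euclidean_space) chart set"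
  assumes smooth_atlas: "smooth_atlas A"
begin

lemma chart_at: obtains U \<phi> where "(U, \<phi>) \<in> A" "x \<in> U"
  using smooth_atlas unfolding smooth_atlas_def by blast

lemma
  assumes "(U, \<phi>) \<in> A"
  shows chart_open: "open U" and chart_open_image: "open (\<phi> ` U)"
    and chart_inj: "inj_on \<phi> U"
    and chart_continuous: "continuous_on U \<phi>"
    and chart_inv_continuous: "continuous_on (\<phi> ` U) (inv_into U \<phi>)"
proof -
  have "is_chart (U, \<phi>)" using smooth_atlas assms unfolding smooth_atlas_def by blast
  then show "open U" "open (\<phi> ` U)" "inj_on \<phi> U" "continuous_on U \<phi>" "continuous_on (\<phi> ` U) (inv_into U \<phi>)"
    by (auto simp: is_chart_def homeomorphism_def)
qed

lemma chart_inv: "(U, \<phi>) \<in> A \<Longrightarrow> x \<in> U \<Longrightarrow> inv_into U \<phi> (\<phi> x) = x"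
  using chart_inj inv_into_f_f by fastforce

lemma chart_transition:
  "(U, \<phi>) \<in> A \<Longrightarrow> (V, \<psi>) \<in> A \<Longrightarrow> smooth_on (\<phi> ` (U \<inter> V)) (\<psi> \<circ> inv_into U \<phi>)"
  using smooth_atlas unfolding smooth_atlas_def by blast

lemma chart_open_subimage:
  assumes "(U, \<phi>) \<in> A" "open W" "W \<subseteq> U"
  shows "open (\<phi> ` W)"
proof -
  have "\<phi> ` W = inv_into U \<phi> -` W \<inter> \<phi> ` U"
    using assms(3) chart_inv[OF assms(1)] by (force simp: image_iff)
  then show ?thesis
    using chart_inv_continuous[OF assms(1)] chart_open_image[OF assms(1)] assms(2)
    by (simp add: continuous_on_open_vimage Int_commute)
qed

lemma chart_open_preimage:
  assumes "(U, \<phi>) \<in> A" "open T" "T \<subseteq> \<phi> ` U"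
  shows "open (inv_into U \<phi> ` T)"
proof -
  have "inv_into U \<phi> ` T = \<phi> -` T \<inter> U"
    using assms(3) chart_inv[OF assms(1)] by (force simp: image_iff)
  then show ?thesis
    using chart_continuous[OF assms(1)] chart_open[OF assms(1)] assms(2)
    by (simp add: continuous_on_open_vimage Int_commute)
qed

lemma chart_cball:
  assumes "(U, \<phi>) \<in> A" "open W" "W \<subseteq> U" "x \<in> W"
  obtains R where "0 < R" "cball (\<phi> x) R \<subseteq> \<phi> ` W"
  using chart_open_subimage[OF assms(1-3)] assms(4) open_contains_cball by blast

lemma Cinf_smooth: "f \<in> Cinf A \<Longrightarrow> (U, \<phi>) \<in> A \<Longrightarrow> smooth_on (\<phi> ` U) (f \<circ> inv_into U \<phi>)"
  unfolding Cinf_def by blast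

lemma CinfI: "(\<And>U \<phi>. (U, \<phi>) \<in> A \<Longrightarrow> smooth_on (\<phi> ` U) (\<lambda>z. f (inv_into U \<phi> z))) \<Longrightarrow> f \<in> Cinf A"
  unfolding Cinf_def comp_def by blast

lemma Cinf_smooth': "f \<in> Cinf A \<Longrightarrow> (U, \<phi>) \<in> A \<Longrightarrow> smooth_on (\<phi> ` U) (\<lambda>z. f (inv_into U \<phi> z))"
  using Cinf_smooth by (auto simp: comp_def)

lemma Cinf_const: "(\<lambda>_. c) \<in> Cinf A"
  by (rule CinfI) (rule smooth_on_const)

lemma Cinf_add: "f \<in> Cinf A \<Longrightarrow> g \<in> Cinf A \<Longrightarrow> (\<lambda>y. f y + g y) \<in> Cinf A"
  by (rule CinfI, rule smooth_on_add) (simp_all add: chart_open_image Cinf_smooth')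

lemma Cinf_diff: "f \<in> Cinf A \<Longrightarrow> g \<in> Cinf A \<Longrightarrow> (\<lambda>y. f y - g y) \<in> Cinf A"
  by (rule CinfI, rule smooth_on_diff) (simp_all add: chart_open_image Cinf_smooth')

lemma Cinf_mult: "f \<in> Cinf A \<Longrightarrow> g \<in> Cinf A \<Longrightarrow> (\<lambda>y. f y * g y) \<in> Cinf A"
  by (rule CinfI, rule smooth_on_mult) (simp_all add: chart_open_image Cinf_smooth')

lemma Cinf_cmult: "f \<in> Cinf A \<Longrightarrow> (\<lambda>y. c * f y) \<in> Cinf A"
  by (rule Cinf_mult[OF Cinf_const])

lemma Cinf_sum: "(\<And>i. i \<in> I \<Longrightarrow> f i \<in> Cinf A) \<Longrightarrow> (\<lambda>y. \<Sum>i\<in>I. f i y) \<in> Cinf A"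
  by (rule CinfI, rule smooth_on_sum) (simp_all add: chart_open_image Cinf_smooth')

lemma Cinf_compose:
  assumes "f \<in> Cinf A" "smooth_on T \<psi>" "open T" "\<And>x. f x \<in> T"
  shows "(\<lambda>y. \<psi> (f y)) \<in> Cinf A"
proof (rule CinfI)
  fix U \<phi> assume c: "(U, \<phi>) \<in> A"
  show "smooth_on (\<phi> ` U) (\<lambda>z. \<psi> (f (inv_into U \<phi> z)))"
    by (rule smooth_on_compose[OF chart_open_image[OF c] assms(3) _ assms(2) Cinf_smooth'[OF assms(1) c]])
      (use assms(4) in auto)
qed

lemma Cinf_continuous:
  assumes f: "f \<in> Cinf A"
  shows "continuous_on UNIV f"
proof -
  have "isCont f x" for x
  proof -
    obtain U \<phi> where c: "(U, \<phi>) \<in> A" "x \<in> U" by (rule chart_at)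
    have "continuous_on U (\<lambda>y. f (inv_into U \<phi> (\<phi> y)))"
      by (rule continuous_on_compose2[OF smooth_on_continuous[OF Cinf_smooth'[OF f c(1)]] chart_continuous[OF c(1)]]) auto
    moreover have "f (inv_into U \<phi> (\<phi> y)) = f y" if "y \<in> U" for y
      using chart_inv[OF c(1) that] by simp
    ultimately have "continuous_on U f" using continuous_on_cong[OF refl] by (metis (no_types, lifting))
    then show ?thesis using c chart_open[OF c(1)] continuous_on_eq_continuous_at by blast
  qed
  then show ?thesis by (simp add: continuous_at_imp_continuous_on)
qed

definition chart_extend :: "'m set \<Rightarrow> ('m \<Rightarrow> 'e) \<Rightarrow> ('e \<Rightarrow> real) \<Rightarrow> 'm \<Rightarrow> real" where
  "chart_extend U \<phi> r = (\<lambda>y. if y \<in> U then r (\<phi> y) else 0)"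

text \<open>Extension by zero is smooth because the image of \<open>K\<close> in the manifold is
  compact, hence closed in a Hausdorff space. Seen in another chart, a point of \<open>U\<close> is
  handled by the transition map, and any other point has a neighbourhood that avoids this closed
  set.\<close>

lemma
  assumes c: "(U, \<phi>) \<in> A" and K: "compact K" "K \<subseteq> \<phi> ` U"
    and r: "smooth_on (\<phi> ` U) r" "\<And>z. z \<in> \<phi> ` U - K \<Longrightarrow> r z = 0"
  shows chart_extend_Cinf: "chart_extend U \<phi> r \<in> Cinf A"
    and chart_extend_support: "compact (closure {x. chart_extend U \<phi> r x \<noteq> 0})"
      "closure {x. chart_extend U \<phi> r x \<noteq> 0} \<subseteq> inv_into U \<phi> ` K"
proof -
  let ?g = "chart_extend U \<phi> r"
  define K' where "K' = inv_into U \<phi> ` K"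
  have K': "compact K'" unfolding K'_def
    by (rule compact_continuous_image[OF continuous_on_subset[OF chart_inv_continuous[OF c] K(2)] K(1)])
  then have clK': "closed K'" by (rule compact_imp_closed)
  have "\<phi> y \<notin> K" if "y \<in> U" "y \<notin> K'" for y
    using that chart_inv[OF c that(1)] unfolding K'_def by force
  then have g0: "?g y = 0" if "y \<notin> K'" for y
    using that r(2) by (auto simp: chart_extend_def)
  then have sub: "closure {x. ?g x \<noteq> 0} \<subseteq> K'"
    by (intro closure_minimal clK') auto
  show "closure {x. ?g x \<noteq> 0} \<subseteq> inv_into U \<phi> ` K" using sub by (simp add: K'_def)
  show "compact (closure {x. ?g x \<noteq> 0})"
    using compact_Int_closed[OF K' closed_closure] sub by (metis inf.absorb2 )
  show "?g \<in> Cinf A"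
  proof (rule CinfI, rule smooth_on_local)
    fix V \<psi> z assume c': "(V, \<psi>) \<in> A" and z: "z \<in> \<psi> ` V"
    show "\<exists>T. open T \<and> z \<in> T \<and> smooth_on T (\<lambda>z. ?g (inv_into V \<psi> z))"
    proof (cases "inv_into V \<psi> z \<in> U")
      case True
      let ?T = "\<psi> ` (V \<inter> U)"
      have T: "open ?T"
        by (rule chart_open_subimage[OF c']) (auto intro: open_Int chart_open[OF c] chart_open[OF c'])
      have inv: "inv_into V \<psi> z \<in> V \<inter> U" if "z \<in> ?T" for z
        using that chart_inv[OF c'] by auto
      have h: "smooth_on ?T (\<lambda>z. r ((\<phi> \<circ> inv_into V \<psi>) z))"
      proof (rule smooth_on_compose[OF T chart_open_image[OF c]])
        show "smooth_on ?T (\<phi> \<circ> inv_into V \<psi>)" by (rule chart_transition[OF c' c])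
        show "smooth_on (\<phi> ` U) r" by (rule r(1))
        show "(\<phi> \<circ> inv_into V \<psi>) ` ?T \<subseteq> \<phi> ` U" using inv by auto
      qed
      have "smooth_on ?T (\<lambda>z. ?g (inv_into V \<psi> z))"
        by (rule smooth_on_cong[OF T _ h]) (use inv in \<open>auto simp: chart_extend_def\<close>)
      moreover have "z \<in> ?T"
        using f_inv_into_f[OF z] inv_into_into[OF z] True by (intro image_eqI[of _ _ "inv_into V \<psi> z"]) simp_all
      ultimately show ?thesis using T by blast
    next
      case False
      let ?T = "\<psi> ` (V - K')"
      have T: "open ?T"
        by (rule chart_open_subimage[OF c']) (auto intro: open_Diff chart_open[OF c'] clK')
      have inv: "inv_into V \<psi> z \<notin> K'" if "z \<in> ?T" for z
        using that chart_inv[OF c'] by auto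
      have "smooth_on ?T (\<lambda>z. ?g (inv_into V \<psi> z))"
        by (rule smooth_on_cong[OF T _ smooth_on_const[of _ 0]]) (use inv g0 in auto)
      moreover have "K' \<subseteq> U" unfolding K'_def using K(2) by (auto intro: inv_into_into)
      then have "z \<in> ?T"
        using f_inv_into_f[OF z] inv_into_into[OF z] False by (intro image_eqI[of _ _ "inv_into V \<psi> z"]) auto
      ultimately show ?thesis using T by blast
    qed
  qed
qed

lemma bump_exists:
  assumes W: "open W" and x: "x \<in> W"
  obtains \<eta> V where "\<eta> \<in> Cinf0_on A W" "open V" "x \<in> V" "V \<subseteq> W" "\<And>y. y \<in> V \<Longrightarrow> \<eta> y = 1"
    "\<And>y. 0 \<le> \<eta> y"
proof -
  obtain U \<phi> where c: "(U, \<phi>) \<in> A" "x \<in> U" by (rule chart_at)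
  have UW: "open (U \<inter> W)" "U \<inter> W \<subseteq> U" "x \<in> U \<inter> W" using W c x chart_open by auto
  from chart_cball[OF c(1) UW] obtain R where R: "0 < R" "cball (\<phi> x) R \<subseteq> \<phi> ` (U \<inter> W)" .
  let ?r = "ball_bump (\<phi> x) R"
  let ?V = "inv_into U \<phi> ` ball (\<phi> x) (R / 2)"
  have sub: "ball (\<phi> x) (R / 2) \<subseteq> \<phi> ` (U \<inter> W)" using R by (force simp: subset_iff)
  have r0: "?r z = 0" if "z \<in> \<phi> ` U - cball (\<phi> x) R" for z
    using that R(1) by (intro ball_bump_0) auto
  have K: "cball (\<phi> x) R \<subseteq> \<phi> ` U" using R by auto
  note ext = c(1) compact_cball K smooth_on_subset[OF smooth_on_ball_bump subset_UNIV] r0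
  have inv: "inv_into U \<phi> z \<in> U \<inter> W" if "z \<in> \<phi> ` (U \<inter> W)" for z
    using that chart_inv[OF c(1)] by auto
  show ?thesis
  proof
    have "inv_into U \<phi> ` cball (\<phi> x) R \<subseteq> W" using R(2) inv by blast
    then show "chart_extend U \<phi> ?r \<in> Cinf0_on A W"
      unfolding Cinf0_on_def using chart_extend_Cinf[OF ext] chart_extend_support[OF ext] by blast
    show "open ?V" by (rule chart_open_preimage[OF c(1)]) (use sub in auto)
    show "?V \<subseteq> W" using sub inv by blast
    show "x \<in> ?V" using chart_inv[OF c] R(1) by (intro image_eqI[of _ _ "\<phi> x"]) auto
    show "chart_extend U \<phi> ?r y = 1" if yV: "y \<in> ?V" for y
    proof -
      obtain z where z: "z \<in> ball (\<phi> x) (R / 2)" "y = inv_into U \<phi> z" using yV by blast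
      then have "z \<in> \<phi> ` U" "y \<in> U" using sub inv by blast+
      then have "\<phi> y = z" using z(2) by (simp add: f_inv_into_f)
      then show ?thesis using ball_bump_1[OF R(1) z(1)] \<open>y \<in> U\<close> by (simp add: chart_extend_def)
    qed
    show "0 \<le> chart_extend U \<phi> ?r y" for y by (simp add: chart_extend_def ball_bump_nonneg)
  qed
qed

section \<open>First-order forms in coordinates\<close>

abbreviation coord_deriv :: "'m set \<Rightarrow> ('m \<Rightarrow> 'e) \<Rightarrow> 'e \<Rightarrow> ('m \<Rightarrow> real) \<Rightarrow> 'm \<Rightarrow> real" where
  "coord_deriv U \<phi> i f x \<equiv> dir_deriv i (f \<circ> inv_into U \<phi>) (\<phi> x)"

abbreviation form_expr ::
  "'m set \<Rightarrow> ('m \<Rightarrow> 'e) \<Rightarrow> ('e \<Rightarrow> 'e \<Rightarrow> 'm \<Rightarrow> real) \<Rightarrow> ('m \<Rightarrow> real) \<Rightarrow> ('m \<Rightarrow> real) \<Rightarrow> 'm \<Rightarrow> real" where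
  "form_expr U \<phi> k f g x \<equiv> \<Sum>i\<in>Basis. \<Sum>j\<in>Basis. k i j x * coord_deriv U \<phi> i f x * coord_deriv U \<phi> j g x"

text \<open>The standard proof that derivations at a point are tangent vectors: Hadamard's lemma
  writes f - f(x) near \<open>x\<close> as a sum of products whose first factors, the centred
  coordinates, vanish at \<open>x\<close>. Cutoffs make all factors global smooth functions, and the
  Leibniz rule leaves the coefficients \<open>D (\<xi> i)\<close>.\<close>

lemma derivation_coordinates:
  assumes c: "(U, \<phi>) \<in> A" and x: "x \<in> U"
    and lin: "\<And>f g a b. f \<in> Cinf A \<Longrightarrow> g \<in> Cinf A \<Longrightarrow> D (\<lambda>y. a * f y + b * g y) = a * D f + b * D g"
    and leib: "\<And>f g. f \<in> Cinf A \<Longrightarrow> g \<in> Cinf A \<Longrightarrow> D (\<lambda>y. f y * g y) = f x * D g + g x * D f"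
  obtains k :: "'e \<Rightarrow> real" where
    "\<And>f. f \<in> Cinf A \<Longrightarrow> D f = (\<Sum>i\<in>Basis. k i * coord_deriv U \<phi> i f x)"
proof -
  define z0 where "z0 = \<phi> x"
  obtain R2 where R2: "0 < R2" "cball z0 R2 \<subseteq> \<phi> ` U"
    using chart_cball[OF c chart_open[OF c] order_refl x] unfolding z0_def .
  define S where "S = ball z0 R2"
  define R where "R = R2 / 2"
  have R: "0 < R" "cball z0 R \<subseteq> S" using R2 by (auto simp: R_def S_def)
  have S: "open S" "convex S" "z0 \<in> S" "S \<subseteq> \<phi> ` U" using R2 by (auto simp: S_def)
  have K: "cball z0 R \<subseteq> \<phi> ` U" using R S by auto
  define ext where "ext r = chart_extend U \<phi> (\<lambda>z. if z \<in> S then ball_bump z0 R z * r z else 0)" for r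
  have ext: "ext r \<in> Cinf A" if "smooth_on S r" for r
    unfolding ext_def
    by (rule chart_extend_Cinf[OF c compact_cball K])
      (use smooth_on_subset[OF smooth_on_ball_bump_times[OF that S(1) R(2,1)] subset_UNIV] R(1) in
        \<open>auto intro!: ball_bump_0\<close>)
  have bz0: "ball_bump z0 R z0 = 1" using R(1) by (intro ball_bump_1) auto
  have extx: "ext r x = r z0" for r
    using x S(3) bz0 by (simp add: ext_def chart_extend_def z0_def)
  define \<xi> where "\<xi> i = ext (\<lambda>z. (z - z0) \<bullet> i)" for i
  have \<xi>: "\<xi> i \<in> Cinf A" for i
    unfolding \<xi>_def
    by (intro ext smooth_on_linear[where T = "\<lambda>z. z \<bullet> _"] bounded_linear_inner_left smooth_on_diff
        smooth_on_id smooth_on_const S)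
  have \<xi>x: "\<xi> i x = 0" for i by (simp add: \<xi>_def extx)
  define \<eta> where "\<eta> = ext (\<lambda>_. 1)"
  have \<eta>: "\<eta> \<in> Cinf A" "\<eta> x = 1" by (simp_all add: \<eta>_def extx ext smooth_on_const)
  have sumC: "(\<lambda>y. \<Sum>i\<in>I. g i y) \<in> Cinf A \<and> D (\<lambda>y. \<Sum>i\<in>I. g i y) = (\<Sum>i\<in>I. D (g i))"
    if "finite I" "\<And>i. i \<in> I \<Longrightarrow> g i \<in> Cinf A" for I :: "'e set" and g
    using that
  proof (induction I rule: finite_induct)
    case empty
    show ?case using lin[OF Cinf_const Cinf_const, of 0 0 0 0] by (simp add: Cinf_const)
  next
    case (insert i I)
    then show ?case using lin[of "g i" "\<lambda>y. \<Sum>i\<in>I. g i y" 1 1] by (simp add: Cinf_add)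
  qed
  \<comment> \<open>The Leibniz rule for 1 = 1 * 1 gives D 1 = 2 D 1.\<close>
  have D1: "D (\<lambda>_. 1) = 0" using leib[OF Cinf_const Cinf_const, of 1 1] by simp
  have Dc: "D (\<lambda>_. a) = 0" for a
    using lin[OF Cinf_const Cinf_const, of a 1 0 0] by (simp add: D1)
  show ?thesis
  proof (rule that)
    fix f assume f: "f \<in> Cinf A"
    have "smooth_on S (f \<circ> inv_into U \<phi>)" by (rule smooth_on_subset[OF Cinf_smooth[OF f c] S(4)])
    from hadamard[OF this S(1-3)] obtain r where r: "\<And>i. smooth_on S (r i)"
      "\<And>z. z \<in> S \<Longrightarrow> (f \<circ> inv_into U \<phi>) z = (f \<circ> inv_into U \<phi>) z0 + (\<Sum>i\<in>Basis. ((z - z0) \<bullet> i) * r i z)"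
      "\<And>i. r i z0 = dir_deriv i (f \<circ> inv_into U \<phi>) z0" by blast
    have fx: "(f \<circ> inv_into U \<phi>) z0 = f x" using chart_inv[OF c x] by (simp add: z0_def)
    \<comment> \<open>Both factors on the right carry the cutoff, hence the square of \<eta> on the
      left; outside the ball both sides are 0.\<close>
    have eq: "(\<lambda>y. (\<eta> y * \<eta> y) * (1 * f y + (- f x) * 1)) = (\<lambda>y. \<Sum>i\<in>Basis. \<xi> i y * ext (r i) y)"
    proof
      fix y
      show "(\<eta> y * \<eta> y) * (1 * f y + (- f x) * 1) = (\<Sum>i\<in>Basis. \<xi> i y * ext (r i) y)"
      proof (cases "y \<in> U \<and> \<phi> y \<in> S")
        case True
        have "f y = f x + (\<Sum>i\<in>Basis. ((\<phi> y - z0) \<bullet> i) * r i (\<phi> y))"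
          using r(2)[of "\<phi> y"] True chart_inv[OF c, of y] fx by simp
        then show ?thesis using True
          by (simp add: \<eta>_def \<xi>_def ext_def chart_extend_def sum_distrib_left mult_ac)
      next
        case False
        then show ?thesis by (auto simp: \<eta>_def \<xi>_def ext_def chart_extend_def)
      qed
    qed
    have C1: "(\<lambda>y. 1 * f y + (- f x) * 1) \<in> Cinf A" by (intro Cinf_add Cinf_cmult f Cinf_const)
    have "D f = D (\<lambda>y. 1 * f y + (- f x) * 1)"
      using lin[OF f Cinf_const, of 1 "- f x" 1] by (simp add: D1)
    \<comment> \<open>The factor f - f(x) vanishes at \<open>x\<close> and \<eta> is 1 there, so
      multiplying by the square of \<eta> does not change the value of \<open>D\<close>.\<close>
    also have "\<dots> = D (\<lambda>y. (\<eta> y * \<eta> y) * (1 * f y + (- f x) * 1))"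
      using leib[OF Cinf_mult[OF \<eta>(1) \<eta>(1)] C1] \<eta>(2) by simp
    also have "\<dots> = (\<Sum>i\<in>Basis. D (\<lambda>y. \<xi> i y * ext (r i) y))"
      unfolding eq using sumC[of Basis "\<lambda>i y. \<xi> i y * ext (r i) y"] by (simp add: Cinf_mult \<xi> ext r(1))
    also have "\<dots> = (\<Sum>i\<in>Basis. D (\<xi> i) * dir_deriv i (f \<circ> inv_into U \<phi>) z0)"
      by (rule sum.cong[OF refl]) (simp add: leib[OF \<xi> ext[OF r(1)]] \<xi>x extx r(3) mult.commute)
    finally show "D f = (\<Sum>i\<in>Basis. D (\<xi> i) * coord_deriv U \<phi> i f x)"
      unfolding z0_def .
  qed
qed

text \<open>The expansion at a single point says nothing about how its coefficients depend on the
  point. Testing it on functions \<xi> that are equal to the coordinates throughout \<open>W\<close>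
  identifies the coefficients as \<open>Q (\<xi> j) (\<xi> i)\<close>, which are smooth because
  \<open>Q\<close> maps into smooth functions.\<close>

lemma form_coordinates:
  assumes Q: "first_order_form A Q" and c: "(U, \<phi>) \<in> A" and x0: "x0 \<in> U"
  obtains W k where "open W" "x0 \<in> W" "W \<subseteq> U" "\<And>i j. k i j \<in> Cinf A"
    "\<And>f g x. f \<in> Cinf A \<Longrightarrow> g \<in> Cinf A \<Longrightarrow> x \<in> W \<Longrightarrow>
      Q f g x = form_expr U \<phi> k f g x"
proof -
  have Qsym: "Q f g = Q g f" and QC: "Q f g \<in> Cinf A" if "f \<in> Cinf A" "g \<in> Cinf A" for f g
    using Q that unfolding first_order_form_def by blast+
  have Qlin: "Q (\<lambda>y. a * f y + b * g y) h x = a * Q f h x + b * Q g h x"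
    and Qleib: "Q (\<lambda>y. f y * g y) h x = f x * Q g h x + g x * Q f h x"
    if "f \<in> Cinf A" "g \<in> Cinf A" "h \<in> Cinf A" for f g h a b x
    using Q that unfolding first_order_form_def by blast+
  obtain R where R: "0 < R" "cball (\<phi> x0) R \<subseteq> \<phi> ` U"
    using chart_cball[OF c chart_open[OF c] order_refl x0] .
  define B where "B = ball (\<phi> x0) (R / 2)"
  have B: "open B" "\<phi> x0 \<in> B" "B \<subseteq> \<phi> ` U" using R by (auto simp: B_def subset_iff)
  define W where "W = inv_into U \<phi> ` B"
  define \<xi> where "\<xi> i = chart_extend U \<phi> (\<lambda>z. ball_bump (\<phi> x0) R z * (z \<bullet> i))" for i
  have \<xi>: "\<xi> i \<in> Cinf A" for i
    unfolding \<xi>_def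
  proof (rule chart_extend_Cinf[OF c compact_cball R(2)])
    show "smooth_on (\<phi> ` U) (\<lambda>z. ball_bump (\<phi> x0) R z * (z \<bullet> i))"
      by (intro smooth_on_mult smooth_on_linear[where T = "\<lambda>z. z \<bullet> _"] bounded_linear_inner_left
        smooth_on_id chart_open_image[OF c] smooth_on_subset[OF smooth_on_ball_bump subset_UNIV])
  qed (use R(1) in \<open>auto intro!: ball_bump_0\<close>)
  have W: "open W" "x0 \<in> W" "W \<subseteq> U"
  proof -
    show "open W" unfolding W_def by (rule chart_open_preimage[OF c B(1,3)])
    show "x0 \<in> W" unfolding W_def using chart_inv[OF c x0] B(2) by force
    show "W \<subseteq> U" unfolding W_def using B(3) by (auto intro: inv_into_into)
  qed
  have \<phi>W: "\<phi> x \<in> B" if "x \<in> W" for x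
  proof -
    obtain z where "z \<in> B" "x = inv_into U \<phi> z" using \<open>x \<in> W\<close> unfolding W_def by blast
    then show ?thesis using f_inv_into_f[of z \<phi> U] B(3) by auto
  qed
  have d\<xi>: "dir_deriv j (\<xi> i \<circ> inv_into U \<phi>) (\<phi> x) = (if i = j then 1 else 0)"
    if "i \<in> Basis" "j \<in> Basis" "x \<in> W" for i j x
  proof -
    have "dir_deriv j (\<xi> i \<circ> inv_into U \<phi>) (\<phi> x) = dir_deriv j (\<lambda>z. z \<bullet> i) (\<phi> x)"
    proof (rule dir_deriv_cong[OF B(1) \<phi>W[OF that(3)]])
      fix z assume z: "z \<in> B"
      then have "z \<in> \<phi> ` U" using B(3) by auto
      then show "(\<xi> i \<circ> inv_into U \<phi>) z = z \<bullet> i"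
        using ball_bump_1[OF R(1), of z "\<phi> x0"] z
        by (simp add: \<xi>_def chart_extend_def f_inv_into_f inv_into_into B_def)
    qed
    then show ?thesis using dir_deriv_inner_Basis[OF that(1,2)] by simp
  qed
  have rep: "Q f g x = (\<Sum>i\<in>Basis. Q (\<xi> i) g x * coord_deriv U \<phi> i f x)"
    if f: "f \<in> Cinf A" and g: "g \<in> Cinf A" and x: "x \<in> W" for f g x
  proof -
    obtain k where k: "\<And>f. f \<in> Cinf A \<Longrightarrow>
        Q f g x = (\<Sum>i\<in>Basis. k i * coord_deriv U \<phi> i f x)"
      by (rule derivation_coordinates[OF c subsetD[OF W(3) x], where D = "\<lambda>f. Q f g x"])
        (use Qlin Qleib g in \<open>blast+\<close>)
    have "Q (\<xi> i) g x = k i" if i: "i \<in> Basis" for i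
      unfolding k[OF \<xi>] using d\<xi>[OF i _ x] i by (simp add: if_distrib[of "(*) _"] cong: if_cong)
    then show ?thesis unfolding k[OF f] by simp
  qed
  show ?thesis
  proof (rule that[OF W, of "\<lambda>i j. Q (\<xi> j) (\<xi> i)"])
    show "Q (\<xi> j) (\<xi> i) \<in> Cinf A" for i j by (rule QC[OF \<xi> \<xi>])
    fix f g x assume f: "f \<in> Cinf A" and g: "g \<in> Cinf A" and x: "x \<in> W"
    have "Q (\<xi> i) g x = (\<Sum>j\<in>Basis. Q (\<xi> j) (\<xi> i) x * coord_deriv U \<phi> j g x)" for i
      using rep[OF g \<xi> x] Qsym[OF \<xi> g] by simp
    then show "Q f g x = (\<Sum>i\<in>Basis. \<Sum>j\<in>Basis. Q (\<xi> j) (\<xi> i) x *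
        coord_deriv U \<phi> i f x * coord_deriv U \<phi> j g x)"
      unfolding rep[OF f g x] by (simp add: sum_distrib_left mult_ac)
  qed
qed

end

section \<open>Test functions, chain rule and locality for first-order forms\<close>

context smooth_manifold
begin

lemma Cinf0I:
  assumes "f \<in> Cinf A" "compact K" "\<And>x. x \<notin> K \<Longrightarrow> f x = 0"
  shows "f \<in> Cinf0 A"
proof -
  have "closure {x. f x \<noteq> 0} \<subseteq> K"
    using assms(3) by (intro closure_minimal compact_imp_closed assms(2)) auto
  moreover from this have "compact (closure {x. f x \<noteq> 0})"
    using compact_Int_closed[OF assms(2) closed_closure, of "{x. f x \<noteq> 0}"] by (simp add: inf.absorb2)
  ultimately show ?thesis using assms(1) by (simp add: Cinf0_on_def)
qed

lemma Cinf0_Cinf: "f \<in> Cinf0 A \<Longrightarrow> f \<in> Cinf A"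
  by (simp add: Cinf0_on_def)

lemma Cinf0_compact: "f \<in> Cinf0 A \<Longrightarrow> compact (closure {x. f x \<noteq> 0})"
  by (simp add: Cinf0_on_def)

lemma not_in_closure_zero: "x \<notin> closure {x. f x \<noteq> (0::real)} \<Longrightarrow> f x = 0"
  using closure_subset[of "{x. f x \<noteq> 0}"] by auto

lemma Cinf0_mult_right: "f \<in> Cinf A \<Longrightarrow> g \<in> Cinf0 A \<Longrightarrow> (\<lambda>x. f x * g x) \<in> Cinf0 A"
  by (rule Cinf0I[OF _ Cinf0_compact[of g]]) (auto intro: Cinf_mult Cinf0_Cinf dest: not_in_closure_zero)

lemma Cinf0_mult_left: "f \<in> Cinf0 A \<Longrightarrow> g \<in> Cinf A \<Longrightarrow> (\<lambda>x. f x * g x) \<in> Cinf0 A"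
  using Cinf0_mult_right[of g f] by (simp add: mult.commute)

lemma Cinf0_bounded:
  assumes "f \<in> Cinf0 A"
  obtains B where "0 \<le> B" "\<And>x. \<bar>f x\<bar> \<le> B"
proof -
  have "compact (f ` closure {x. f x \<noteq> 0})"
    by (intro compact_continuous_image continuous_on_subset[OF Cinf_continuous] Cinf0_compact Cinf0_Cinf assms) simp
  then obtain B where B: "\<And>x. x \<in> closure {x. f x \<noteq> 0} \<Longrightarrow> \<bar>f x\<bar> \<le> B"
    using compact_imp_bounded bounded_iff by (metis imageI real_norm_def)
  have "\<bar>f x\<bar> \<le> \<bar>B\<bar>" for x
    using B[of x] not_in_closure_zero[of x f] by fastforce
  then show ?thesis using that abs_ge_zero by blast
qed

text \<open>Bilinearity and the Leibniz rule alone reach only polynomials of \<open>f\<close>; the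
  coordinate expression reaches every smooth composite and needs the derivative of \<psi> only at
  \<open>f x\<close>.\<close>

lemma form_compose:
  assumes Q: "first_order_form A Q" and f: "f \<in> Cinf A" and g: "g \<in> Cinf A"
    and \<psi>f: "(\<lambda>y. \<psi> (f y)) \<in> Cinf A" and d: "(\<psi> has_real_derivative \<psi>') (at (f x))"
  shows "Q (\<lambda>y. \<psi> (f y)) g x = \<psi>' * Q f g x"
proof -
  obtain U \<phi> where c: "(U, \<phi>) \<in> A" "x \<in> U" by (rule chart_at)
  obtain W k where W: "open W" "x \<in> W" "W \<subseteq> U" "\<And>f g x. f \<in> Cinf A \<Longrightarrow> g \<in> Cinf A \<Longrightarrow> x \<in> W \<Longrightarrow>
      Q f g x = form_expr U \<phi> k f g x"
    by (rule form_coordinates[OF Q c]) blast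
  have "dir_deriv i ((\<lambda>y. \<psi> (f y)) \<circ> inv_into U \<phi>) (\<phi> x) = \<psi>' * coord_deriv U \<phi> i f x" for i
    using dir_deriv_compose[OF Cinf_smooth[OF f c(1)] chart_open_image[OF c(1)], of "\<phi> x" \<psi> \<psi>' i] d c
    by (simp add: comp_def chart_inv)
  then show ?thesis
    unfolding W(4)[OF \<psi>f g W(2)] W(4)[OF f g W(2)] by (simp add: sum_distrib_left mult_ac)
qed

lemma form_local:
  assumes Q: "first_order_form A Q" and f: "f \<in> Cinf A" "f' \<in> Cinf A" and g: "g \<in> Cinf A"
    and V: "open V" "x \<in> V" "\<And>y. y \<in> V \<Longrightarrow> f y = f' y"
  shows "Q f g x = Q f' g x"
proof -
  obtain U \<phi> where c: "(U, \<phi>) \<in> A" "x \<in> U" by (rule chart_at)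
  obtain W k where W: "open W" "x \<in> W" "W \<subseteq> U" "\<And>f g x. f \<in> Cinf A \<Longrightarrow> g \<in> Cinf A \<Longrightarrow> x \<in> W \<Longrightarrow>
      Q f g x = form_expr U \<phi> k f g x"
    by (rule form_coordinates[OF Q c]) blast
  have op: "open (\<phi> ` (U \<inter> V))"
    by (rule chart_open_subimage[OF c(1)]) (auto intro: open_Int V chart_open[OF c(1)])
  have "coord_deriv U \<phi> i f x = coord_deriv U \<phi> i f' x" for i
    by (rule dir_deriv_cong[OF op]) (use c V in \<open>auto simp: chart_inv\<close>)
  then show ?thesis
    unfolding W(4)[OF f(1) g W(2)] W(4)[OF f(2) g W(2)] by simp
qed

end

section \<open>Diffusion operators in coordinates\<close>

locale diffusion_operator = smooth_manifold A
  for A :: "('m::{t2_space, second_countable_topology}, 'e::euclidean_space) chart set" +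
  fixes L :: "('m \<Rightarrow> real) \<Rightarrow> 'm \<Rightarrow> real"
  assumes second_order: "second_order_diffusion A L"
    and L_const_one: "L (\<lambda>_. 1) = (\<lambda>_. 0)"
begin

abbreviation second_order_expr ::
  "'m set \<Rightarrow> ('m \<Rightarrow> 'e) \<Rightarrow> ('e \<Rightarrow> 'e \<Rightarrow> 'e \<Rightarrow> real) \<Rightarrow> ('e \<Rightarrow> 'e \<Rightarrow> real) \<Rightarrow> ('m \<Rightarrow> real) \<Rightarrow> 'm \<Rightarrow> real" where
  "second_order_expr U \<phi> a b f x \<equiv>
     (\<Sum>i\<in>Basis. \<Sum>j\<in>Basis. a i j (\<phi> x) * dir_deriv i (dir_deriv j (f \<circ> inv_into U \<phi>)) (\<phi> x))
     + (\<Sum>i\<in>Basis. b i (\<phi> x) * coord_deriv U \<phi> i f x)"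

abbreviation gradient_expr ::
  "'m set \<Rightarrow> ('m \<Rightarrow> 'e) \<Rightarrow> ('e \<Rightarrow> 'e \<Rightarrow> 'e \<Rightarrow> real) \<Rightarrow> ('m \<Rightarrow> real) \<Rightarrow> ('m \<Rightarrow> real) \<Rightarrow> 'm \<Rightarrow> real" where
  "gradient_expr U \<phi> a f g x \<equiv>
     \<Sum>i\<in>Basis. \<Sum>j\<in>Basis. a i j (\<phi> x) * coord_deriv U \<phi> i f x * coord_deriv U \<phi> j g x"

text \<open>Applying \<open>L\<close> to the constant 1 eliminates the zeroth-order coefficient. In
  \<Gamma> the product rule cancels all second derivatives as well as the drift \<open>b\<close>,
  which leaves the principal coefficients \<open>a\<close>.\<close>

lemma L_coordinates:
  assumes c: "(U, \<phi>) \<in> A"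
  obtains a b where
    "\<And>i j. i \<in> Basis \<Longrightarrow> j \<in> Basis \<Longrightarrow> smooth_on (\<phi> ` U) (a i j)"
    "\<And>i. i \<in> Basis \<Longrightarrow> smooth_on (\<phi> ` U) (b i)"
    "\<And>i j x. i \<in> Basis \<Longrightarrow> j \<in> Basis \<Longrightarrow> x \<in> U \<Longrightarrow> a i j (\<phi> x) = a j i (\<phi> x)"
    "\<And>\<xi> x. x \<in> U \<Longrightarrow> 0 \<le> (\<Sum>i\<in>Basis. \<Sum>j\<in>Basis. a i j (\<phi> x) * (\<xi> \<bullet> i) * (\<xi> \<bullet> j))"
    "\<And>f x. f \<in> Cinf A \<Longrightarrow> x \<in> U \<Longrightarrow> L f x =
      second_order_expr U \<phi> a b f x"
    "\<And>f g x. f \<in> Cinf A \<Longrightarrow> g \<in> Cinf A \<Longrightarrow> x \<in> U \<Longrightarrow> Gam L f g x =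
      gradient_expr U \<phi> a f g x"
proof -
  note op = chart_open_image[OF c]
  obtain a b e where
    a: "\<forall>i\<in>Basis. \<forall>j\<in>Basis. smooth_on (\<phi> ` U) (a i j)" and b: "\<forall>i\<in>Basis. smooth_on (\<phi> ` U) (b i)"
    and sym: "\<forall>z\<in>\<phi> ` U. \<forall>i\<in>Basis. \<forall>j\<in>Basis. a i j z = a j i z"
    and psd: "\<forall>z\<in>\<phi> ` U. \<forall>\<xi>. 0 \<le> (\<Sum>i\<in>Basis. \<Sum>j\<in>Basis. a i j z * (\<xi> \<bullet> i) * (\<xi> \<bullet> j))"
    and L: "\<forall>f\<in>Cinf A. \<forall>z\<in>\<phi> ` U. L f (inv_into U \<phi> z) =
            (\<Sum>i\<in>Basis. \<Sum>j\<in>Basis. a i j z * dir_deriv i (dir_deriv j (f \<circ> inv_into U \<phi>)) z)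
            + (\<Sum>i\<in>Basis. b i z * dir_deriv i (f \<circ> inv_into U \<phi>) z)
            + e z * f (inv_into U \<phi> z)"
    by (rule exE[OF bspec[OF second_order[unfolded second_order_diffusion_def] c, unfolded prod.case]])
      (elim exE conjE, rule that)
  have e0: "e (\<phi> x) = 0" if x: "x \<in> U" for x
  proof -
    have z: "dir_deriv j (\<lambda>_. 1) = (\<lambda>_::'e. 0)" for j by (rule ext) simp
    have "L (\<lambda>_. 1) (inv_into U \<phi> (\<phi> x)) = e (\<phi> x)"
      using bspec[OF bspec[OF L Cinf_const, of 1]] x by (simp add: comp_def z)
    then show ?thesis by (simp add: L_const_one)
  qed
  have Lx: "L f x =
      second_order_expr U \<phi> a b f x"
    if f: "f \<in> Cinf A" and x: "x \<in> U" for f x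
    using bspec[OF bspec[OF L f], of "\<phi> x"] x e0[OF x] by (simp add: chart_inv[OF c])
  show ?thesis
  proof (rule that)
    show "L f x =
      second_order_expr U \<phi> a b f x"
      if "f \<in> Cinf A" "x \<in> U" for f x using that by (rule Lx)
  next
    fix f g x assume f: "f \<in> Cinf A" and g: "g \<in> Cinf A" and x: "x \<in> U"
    define F where "F = f \<circ> inv_into U \<phi>"
    define G where "G = g \<circ> inv_into U \<phi>"
    define z where "z = \<phi> x"
    have z: "z \<in> \<phi> ` U" using x by (simp add: z_def)
    have F: "smooth_on (\<phi> ` U) F" and G: "smooth_on (\<phi> ` U) G"
      unfolding F_def G_def by (rule Cinf_smooth[OF f c], rule Cinf_smooth[OF g c])
    have Fx: "F z = f x" "G z = g x" using x chart_inv[OF c] by (simp_all add: F_def G_def z_def)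
    have FG: "(\<lambda>y. f y * g y) \<circ> inv_into U \<phi> = (\<lambda>z. F z * G z)" by (auto simp: F_def G_def)
    have d1: "dir_deriv j (\<lambda>z. F z * G z) y = F y * dir_deriv j G y + G y * dir_deriv j F y"
      if "y \<in> \<phi> ` U" for j y by (rule dir_deriv_mult[OF F G op that])
    have d2: "dir_deriv i (dir_deriv j (\<lambda>z. F z * G z)) z =
        F z * dir_deriv i (dir_deriv j G) z + dir_deriv j G z * dir_deriv i F z
        + (G z * dir_deriv i (dir_deriv j F) z + dir_deriv j F z * dir_deriv i G z)" for i j
    proof -
      note F' = smooth_on_dir_deriv[OF F, of j] note G' = smooth_on_dir_deriv[OF G, of j]
      have "dir_deriv i (dir_deriv j (\<lambda>z. F z * G z)) z =
          dir_deriv i (\<lambda>y. 1 * (F y * dir_deriv j G y) + 1 * (G y * dir_deriv j F y)) z"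
        by (rule dir_deriv_cong[OF op z]) (simp add: d1)
      also have "\<dots> = 1 * dir_deriv i (\<lambda>y. F y * dir_deriv j G y) z + 1 * dir_deriv i (\<lambda>y. G y * dir_deriv j F y) z"
        by (rule dir_deriv_linear_comb[OF smooth_on_mult[OF op F G'] smooth_on_mult[OF op G F'] op z])
      finally show ?thesis
        unfolding dir_deriv_mult[OF F G' op z] dir_deriv_mult[OF G F' op z] by simp
    qed
    \<comment> \<open>Symmetry of \<open>a\<close> merges the two cross terms of the product rule;
      the resulting factor 2 cancels the 1/2 in the definition of \<Gamma>.\<close>
    have swap: "(\<Sum>i\<in>Basis. \<Sum>j\<in>Basis. a i j z * (dir_deriv j F z * dir_deriv i G z)) =
        (\<Sum>i\<in>Basis. \<Sum>j\<in>Basis. a i j z * (dir_deriv i F z * dir_deriv j G z))"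
      by (subst sum.swap) (use sym z in \<open>auto intro!: sum.cong\<close>)
    have "L (\<lambda>y. f y * g y) x =
        (\<Sum>i\<in>Basis. \<Sum>j\<in>Basis. F z * (a i j z * dir_deriv i (dir_deriv j G) z)
          + G z * (a i j z * dir_deriv i (dir_deriv j F) z)
          + a i j z * (dir_deriv i F z * dir_deriv j G z) + a i j z * (dir_deriv j F z * dir_deriv i G z))
        + (\<Sum>i\<in>Basis. F z * (b i z * dir_deriv i G z) + G z * (b i z * dir_deriv i F z))"
      unfolding Lx[OF Cinf_mult[OF f g] x] FG z_def[symmetric] d1[OF z] d2 by (simp add: algebra_simps)
    also have "\<dots> = F z * L g x + G z * L f x
        + 2 * (\<Sum>i\<in>Basis. \<Sum>j\<in>Basis. a i j z * (dir_deriv i F z * dir_deriv j G z))"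
      unfolding sum.distrib swap Lx[OF f x] Lx[OF g x] F_def[symmetric] G_def[symmetric] z_def[symmetric]
      by (simp add: algebra_simps sum_distrib_left)
    finally show "Gam L f g x = gradient_expr U \<phi> a f g x"
      unfolding Gam_def F_def[symmetric] G_def[symmetric] z_def[symmetric] by (simp add: Fx mult.assoc)
  qed (use a b sym psd in auto)
qed

lemma L_Cinf:
  assumes f: "f \<in> Cinf A"
  shows "L f \<in> Cinf A"
proof (rule CinfI)
  fix U \<phi> assume c: "(U, \<phi>) \<in> A"
  note op = chart_open_image[OF c]
  obtain a b where ab: "\<And>i j. i \<in> Basis \<Longrightarrow> j \<in> Basis \<Longrightarrow> smooth_on (\<phi> ` U) (a i j)"
    "\<And>i. i \<in> Basis \<Longrightarrow> smooth_on (\<phi> ` U) (b i)"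
    and L: "\<And>f x. f \<in> Cinf A \<Longrightarrow> x \<in> U \<Longrightarrow> L f x =
      second_order_expr U \<phi> a b f x"
    by (rule L_coordinates[OF c]) (rule that)
  have s: "smooth_on (\<phi> ` U) (\<lambda>z.
      (\<Sum>i\<in>Basis. \<Sum>j\<in>Basis. a i j z * dir_deriv i (dir_deriv j (f \<circ> inv_into U \<phi>)) z)
      + (\<Sum>i\<in>Basis. b i z * dir_deriv i (f \<circ> inv_into U \<phi>) z))"
    by (intro smooth_on_add[OF op] smooth_on_sum[OF op] smooth_on_mult[OF op] ab
        smooth_on_dir_deriv Cinf_smooth[OF f c]) auto
  show "smooth_on (\<phi> ` U) (\<lambda>z. L f (inv_into U \<phi> z))"
  proof (rule smooth_on_cong[OF op _ s])
    fix z assume "z \<in> \<phi> ` U"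
    then have "inv_into U \<phi> z \<in> U" "\<phi> (inv_into U \<phi> z) = z"
      by (simp_all add: inv_into_into f_inv_into_f)
    then show "(\<Sum>i\<in>Basis. \<Sum>j\<in>Basis. a i j z * dir_deriv i (dir_deriv j (f \<circ> inv_into U \<phi>)) z)
      + (\<Sum>i\<in>Basis. b i z * dir_deriv i (f \<circ> inv_into U \<phi>) z) = L f (inv_into U \<phi> z)"
      using L[OF f, of "inv_into U \<phi> z"] by simp
  qed
qed

lemma L_linear:
  assumes f: "f \<in> Cinf A" and g: "g \<in> Cinf A"
  shows "L (\<lambda>y. s * f y + t * g y) x = s * L f x + t * L g x"
proof -
  obtain U \<phi> where c: "(U, \<phi>) \<in> A" "x \<in> U" by (rule chart_at)
  note op = chart_open_image[OF c(1)]
  obtain a b where L: "\<And>f x. f \<in> Cinf A \<Longrightarrow> x \<in> U \<Longrightarrow> L f x =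
      second_order_expr U \<phi> a b f x"
    by (rule L_coordinates[OF c(1)]) (rule that)
  define F where "F = f \<circ> inv_into U \<phi>"
  define G where "G = g \<circ> inv_into U \<phi>"
  have F: "smooth_on (\<phi> ` U) F" and G: "smooth_on (\<phi> ` U) G"
    unfolding F_def G_def by (rule Cinf_smooth[OF f c(1)], rule Cinf_smooth[OF g c(1)])
  have z: "\<phi> x \<in> \<phi> ` U" using c by simp
  have FG: "(\<lambda>y. s * f y + t * g y) \<circ> inv_into U \<phi> = (\<lambda>z. s * F z + t * G z)" by (auto simp: F_def G_def)
  have d1: "dir_deriv j (\<lambda>z. s * F z + t * G z) y = s * dir_deriv j F y + t * dir_deriv j G y"
    if "y \<in> \<phi> ` U" for j y by (rule dir_deriv_linear_comb[OF F G op that])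
  have d2: "dir_deriv i (dir_deriv j (\<lambda>z. s * F z + t * G z)) (\<phi> x) =
      s * dir_deriv i (dir_deriv j F) (\<phi> x) + t * dir_deriv i (dir_deriv j G) (\<phi> x)" for i j
  proof -
    have "dir_deriv i (dir_deriv j (\<lambda>z. s * F z + t * G z)) (\<phi> x) =
        dir_deriv i (\<lambda>y. s * dir_deriv j F y + t * dir_deriv j G y) (\<phi> x)"
      by (rule dir_deriv_cong[OF op z d1])
    also have "\<dots> = s * dir_deriv i (dir_deriv j F) (\<phi> x) + t * dir_deriv i (dir_deriv j G) (\<phi> x)"
      by (rule dir_deriv_linear_comb[OF smooth_on_dir_deriv[OF F] smooth_on_dir_deriv[OF G] op z])
    finally show ?thesis .
  qed
  have C: "(\<lambda>y. s * f y + t * g y) \<in> Cinf A" by (rule Cinf_add[OF Cinf_cmult[OF f] Cinf_cmult[OF g]])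
  show ?thesis
    unfolding L[OF C c(2)] L[OF f c(2)] L[OF g c(2)] FG d1[OF z] d2 F_def[symmetric] G_def[symmetric]
    by (simp add: algebra_simps sum.distrib sum_distrib_left)
qed

lemma Gam_sym: "Gam L f g = Gam L g f"
  by (rule ext) (simp add: Gam_def mult.commute)

lemma L_mult: "L (\<lambda>y. f y * g y) x = f x * L g x + g x * L f x + 2 * Gam L f g x"
  by (simp add: Gam_def field_simps)

text \<open>From here on \<Gamma> and \<Gamma>^Z are two instances of the same notion, so that the
  chain rule, the flow derivative and the Bochner formula are each proved once.\<close>

lemma first_order_form_Gam: "first_order_form A (Gam L)"
  unfolding first_order_form_def
proof (intro conjI ballI allI)
  fix f g assume f: "f \<in> Cinf A" and g: "g \<in> Cinf A"
  have "(\<lambda>x. (1 / 2) * (L (\<lambda>y. f y * g y) x - f x * L g x - g x * L f x)) \<in> Cinf A"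
    by (intro Cinf_cmult Cinf_diff L_Cinf Cinf_mult f g)
  then show "Gam L f g \<in> Cinf A" by (simp add: Gam_def)
  show "Gam L f g = Gam L g f" by (rule Gam_sym)
next
  fix f g h x and s t :: real assume f: "f \<in> Cinf A" and g: "g \<in> Cinf A" and h: "h \<in> Cinf A"
  have e: "(\<lambda>y. (s * f y + t * g y) * h y) = (\<lambda>y. s * (f y * h y) + t * (g y * h y))"
    by (rule ext) (simp add: algebra_simps)
  show "Gam L (\<lambda>y. s * f y + t * g y) h x = s * Gam L f h x + t * Gam L g h x"
    unfolding Gam_def e L_linear[OF Cinf_mult[OF f h] Cinf_mult[OF g h]] L_linear[OF f g]
    by (simp add: field_simps)
next
  fix f g h x assume f: "f \<in> Cinf A" and g: "g \<in> Cinf A" and h: "h \<in> Cinf A"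
  obtain U \<phi> where c: "(U, \<phi>) \<in> A" "x \<in> U" by (rule chart_at)
  note op = chart_open_image[OF c(1)]
  obtain a where Gam: "\<And>f g x. f \<in> Cinf A \<Longrightarrow> g \<in> Cinf A \<Longrightarrow> x \<in> U \<Longrightarrow> Gam L f g x =
      gradient_expr U \<phi> a f g x"
    by (rule L_coordinates[OF c(1)]) (rule that)
  have z: "\<phi> x \<in> \<phi> ` U" using c by simp
  have d: "dir_deriv i ((\<lambda>y. f y * g y) \<circ> inv_into U \<phi>) (\<phi> x) =
      f x * coord_deriv U \<phi> i g x + g x * coord_deriv U \<phi> i f x" for i
    using dir_deriv_mult[OF Cinf_smooth[OF f c(1)] Cinf_smooth[OF g c(1)] op z, of i] chart_inv[OF c]
    by (simp add: comp_def)
  show "Gam L (\<lambda>y. f y * g y) h x = f x * Gam L g h x + g x * Gam L f h x"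
    unfolding Gam[OF Cinf_mult[OF f g] h c(2)] Gam[OF g h c(2)] Gam[OF f h c(2)] d
    by (simp add: algebra_simps sum.distrib sum_distrib_left)
qed

lemma Gam_Cinf: "f \<in> Cinf A \<Longrightarrow> g \<in> Cinf A \<Longrightarrow> Gam L f g \<in> Cinf A"
  using first_order_form_Gam unfolding first_order_form_def by blast

lemma Gam_linear:
  "f \<in> Cinf A \<Longrightarrow> g \<in> Cinf A \<Longrightarrow> h \<in> Cinf A \<Longrightarrow>
    Gam L (\<lambda>y. s * f y + t * g y) h x = s * Gam L f h x + t * Gam L g h x"
  by (rule first_order_form_Gam[unfolded first_order_form_def, THEN conjunct2, THEN conjunct1, rule_format])

lemma Gam_nonneg:
  assumes f: "f \<in> Cinf A"
  shows "0 \<le> Gam L f f x"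
proof -
  obtain U \<phi> where c: "(U, \<phi>) \<in> A" "x \<in> U" by (rule chart_at)
  obtain a where psd: "\<And>\<xi> x. x \<in> U \<Longrightarrow> 0 \<le> (\<Sum>i\<in>Basis. \<Sum>j\<in>Basis. a i j (\<phi> x) * (\<xi> \<bullet> i) * (\<xi> \<bullet> j))"
    and Gam: "\<And>f g x. f \<in> Cinf A \<Longrightarrow> g \<in> Cinf A \<Longrightarrow> x \<in> U \<Longrightarrow> Gam L f g x =
      gradient_expr U \<phi> a f g x"
    by (rule L_coordinates[OF c(1)]) (rule that)
  define \<xi> where "\<xi> = (\<Sum>i\<in>Basis. coord_deriv U \<phi> i f x *\<^sub>R i)"
  have "\<xi> \<bullet> i = coord_deriv U \<phi> i f x" if "i \<in> Basis" for i
    using that by (simp add: \<xi>_def)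
  then show ?thesis using psd[OF c(2), of \<xi>] unfolding Gam[OF f f c(2)] by simp
qed

lemma L_compose:
  assumes f: "f \<in> Cinf A" and T: "open T" "\<And>y. f y \<in> T"
    and s: "smooth_on T \<psi>"
    and d: "\<And>r. r \<in> T \<Longrightarrow> (\<psi> has_real_derivative \<psi>1 r) (at r)"
      "\<And>r. r \<in> T \<Longrightarrow> (\<psi>1 has_real_derivative \<psi>2 r) (at r)"
  shows "L (\<lambda>y. \<psi> (f y)) x = \<psi>1 (f x) * L f x + \<psi>2 (f x) * Gam L f f x"
proof -
  obtain U \<phi> where c: "(U, \<phi>) \<in> A" "x \<in> U" by (rule chart_at)
  note op = chart_open_image[OF c(1)]
  obtain a b where L: "\<And>f x. f \<in> Cinf A \<Longrightarrow> x \<in> U \<Longrightarrow> L f x =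
      second_order_expr U \<phi> a b f x"
    and Gam: "\<And>f g x. f \<in> Cinf A \<Longrightarrow> g \<in> Cinf A \<Longrightarrow> x \<in> U \<Longrightarrow> Gam L f g x =
      gradient_expr U \<phi> a f g x"
    by (rule L_coordinates[OF c(1)]) (rule that)
  define F where "F = f \<circ> inv_into U \<phi>"
  have F: "smooth_on (\<phi> ` U) F" unfolding F_def using f c(1) by (rule Cinf_smooth)
  have FT: "F z \<in> T" for z by (simp add: F_def T)
  have z: "\<phi> x \<in> \<phi> ` U" using c by simp
  have Fx: "F (\<phi> x) = f x" using chart_inv[OF c] by (simp add: F_def)
  have C: "(\<lambda>y. \<psi> (f y)) \<in> Cinf A" by (rule Cinf_compose[OF f s T])
  have e: "(\<lambda>y. \<psi> (f y)) \<circ> inv_into U \<phi> = (\<lambda>z. \<psi> (F z))" by (auto simp: F_def)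
  have d1: "dir_deriv j (\<lambda>z. \<psi> (F z)) y = \<psi>1 (F y) * dir_deriv j F y" if "y \<in> \<phi> ` U" for j y
    by (rule dir_deriv_compose[OF F op that d(1)[OF FT]])
  have s1: "smooth_on T \<psi>1"
  proof -
    have h: "smooth_on T (\<lambda>r. frechet_derivative \<psi> (at r) 1)" by (rule smooth_on_frechet[OF s])
    have "frechet_derivative \<psi> (at r) 1 = \<psi>1 r" if "r \<in> T" for r
      using frechet_derivative_at[OF d(1)[OF that, unfolded has_field_derivative_def]] by (metis mult.right_neutral)
    from smooth_on_cong[OF T(1) this h] show ?thesis .
  qed
  have s1F: "smooth_on (\<phi> ` U) (\<lambda>y. \<psi>1 (F y))"
    by (rule smooth_on_compose[OF op T(1) _ s1 F]) (use FT in auto)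
  have d2: "dir_deriv i (dir_deriv j (\<lambda>z. \<psi> (F z))) (\<phi> x) =
      \<psi>1 (f x) * dir_deriv i (dir_deriv j F) (\<phi> x) + dir_deriv j F (\<phi> x) * (\<psi>2 (f x) * dir_deriv i F (\<phi> x))" for i j
  proof -
    have "dir_deriv i (dir_deriv j (\<lambda>z. \<psi> (F z))) (\<phi> x) = dir_deriv i (\<lambda>y. \<psi>1 (F y) * dir_deriv j F y) (\<phi> x)"
      by (rule dir_deriv_cong[OF op z d1])
    also have "\<dots> = \<psi>1 (F (\<phi> x)) * dir_deriv i (dir_deriv j F) (\<phi> x)
        + dir_deriv j F (\<phi> x) * dir_deriv i (\<lambda>y. \<psi>1 (F y)) (\<phi> x)"
      by (rule dir_deriv_mult[OF s1F smooth_on_dir_deriv[OF F] op z])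
    also have "dir_deriv i (\<lambda>y. \<psi>1 (F y)) (\<phi> x) = \<psi>2 (F (\<phi> x)) * dir_deriv i F (\<phi> x)"
      by (rule dir_deriv_compose[OF F op z d(2)[OF FT]])
    finally show ?thesis by (simp add: Fx)
  qed
  show ?thesis
    unfolding L[OF C c(2)] L[OF f c(2)] Gam[OF f f c(2)] e d1[OF z] d2 F_def[symmetric] Fx
    by (simp add: algebra_simps sum.distrib sum_distrib_left)
qed

lemma L_local:
  assumes f: "f \<in> Cinf A" and g: "g \<in> Cinf A" and V: "open V" "x \<in> V" "\<And>y. y \<in> V \<Longrightarrow> f y = g y"
  shows "L f x = L g x"
proof -
  obtain U \<phi> where c: "(U, \<phi>) \<in> A" "x \<in> U" by (rule chart_at)
  obtain a b where L: "\<And>f x. f \<in> Cinf A \<Longrightarrow> x \<in> U \<Longrightarrow> L f x =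
      second_order_expr U \<phi> a b f x"
    by (rule L_coordinates[OF c(1)]) (rule that)
  have op: "open (\<phi> ` (U \<inter> V))"
    by (rule chart_open_subimage[OF c(1)]) (auto intro: open_Int V chart_open[OF c(1)])
  have x: "\<phi> x \<in> \<phi> ` (U \<inter> V)" using c V by auto
  have d1: "dir_deriv i (f \<circ> inv_into U \<phi>) z = dir_deriv i (g \<circ> inv_into U \<phi>) z" if "z \<in> \<phi> ` (U \<inter> V)" for i z
    by (rule dir_deriv_cong[OF op that]) (use c V in \<open>auto simp: chart_inv\<close>)
  have d2: "dir_deriv i (dir_deriv j (f \<circ> inv_into U \<phi>)) (\<phi> x) = dir_deriv i (dir_deriv j (g \<circ> inv_into U \<phi>)) (\<phi> x)" for i j
    by (rule dir_deriv_cong[OF op x d1])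
  show ?thesis unfolding L[OF f c(2)] L[OF g c(2)] d2 d1[OF x] ..
qed

lemma L_const: "L (\<lambda>_. a) x = 0"
  using L_linear[OF Cinf_const Cinf_const, of a 1 0 0] by (simp add: L_const_one)

lemma L_zero_outside:
  assumes f: "f \<in> Cinf A" and x: "x \<notin> closure {x. f x \<noteq> 0}"
  shows "L f x = 0"
proof -
  have "L f x = L (\<lambda>_. 0) x"
    by (rule L_local[OF f Cinf_const, of "- closure {x. f x \<noteq> 0}"])
      (use x in \<open>auto dest: not_in_closure_zero\<close>)
  then show ?thesis by (simp add: L_const)
qed

lemma Gam_zero_outside:
  assumes f: "f \<in> Cinf A" and g: "g \<in> Cinf A" and x: "x \<notin> closure {x. f x \<noteq> 0}"
  shows "Gam L f g x = 0"
proof -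
  have "Gam L f g x = Gam L (\<lambda>_. 0) g x"
    by (rule form_local[OF first_order_form_Gam f Cinf_const g, of "- closure {x. f x \<noteq> 0}"])
      (use x in \<open>auto dest: not_in_closure_zero\<close>)
  then show ?thesis by (simp add: Gam_def L_const)
qed

lemma L_Cinf0: "f \<in> Cinf0 A \<Longrightarrow> L f \<in> Cinf0 A"
  by (rule Cinf0I[OF _ Cinf0_compact[of f]]) (auto intro: L_Cinf L_zero_outside dest: Cinf0_Cinf)

end

context smooth_manifold
begin

text \<open>A finite sum of bumps is at least 1 near \<open>K\<close>; composing it with
  \<open>smooth_step\<close> levels it to the constant 1 there and keeps the value 0 off the
  supports.\<close>

lemma plateau_exists:
  assumes K: "compact K"
  obtains \<eta> V where "\<eta> \<in> Cinf0 A" "open V" "K \<subseteq> V" "\<And>x. x \<in> V \<Longrightarrow> \<eta> x = 1"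
proof -
  have "\<exists>c W. c \<in> Cinf0 A \<and> open W \<and> x \<in> W \<and> (\<forall>y\<in>W. c y = 1) \<and> (\<forall>y. 0 \<le> c y)" for x
    by (rule bump_exists[OF open_UNIV UNIV_I, of x]) blast
  then obtain c W where cW: "\<And>x. c x \<in> Cinf0 A" "\<And>x. open (W x)" "\<And>x. x \<in> W x"
    "\<And>x y. y \<in> W x \<Longrightarrow> c x y = 1" "\<And>x y. 0 \<le> c x y" by metis
  have "K \<subseteq> (\<Union>x\<in>K. W x)" using cW(3) by auto
  from compactE_image[OF K cW(2) this] obtain X where X: "finite X" "K \<subseteq> (\<Union>x\<in>X. W x)" by metis
  define g where "g y = (\<Sum>x\<in>X. c x y)" for y
  have gC: "g \<in> Cinf A" unfolding g_def by (intro Cinf_sum Cinf0_Cinf cW(1))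
  have g1: "1 \<le> g y" if y: "y \<in> (\<Union>x\<in>X. W x)" for y
  proof -
    obtain x where x: "x \<in> X" "y \<in> W x" using y by auto
    then show ?thesis unfolding g_def using member_le_sum[of x X "\<lambda>x. c x y"] cW(4,5) X(1) by auto
  qed
  show ?thesis
  proof (rule that[of "\<lambda>y. smooth_step (g y)" "\<Union>x\<in>X. W x"])
    show "(\<lambda>y. smooth_step (g y)) \<in> Cinf0 A"
    proof (rule Cinf0I)
      show "(\<lambda>y. smooth_step (g y)) \<in> Cinf A"
        by (rule Cinf_compose[OF gC smooth_on_smooth_step]) auto
      show "compact (\<Union>x\<in>X. closure {y. c x y \<noteq> 0})"
        by (intro compact_UN X(1) ballI Cinf0_compact cW(1))
      show "smooth_step (g y) = 0" if y: "y \<notin> (\<Union>x\<in>X. closure {y. c x y \<noteq> 0})" for y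
      proof -
        have "c x y = 0" if "x \<in> X" for x using y that not_in_closure_zero[of y "c x"] by auto
        then show ?thesis by (simp add: g_def smooth_step_0)
      qed
    qed
    show "smooth_step (g y) = 1" if "y \<in> (\<Union>x\<in>X. W x)" for y
      using g1[OF that] by (intro smooth_step_1) auto
  qed (use X(2) cW(2) in auto)
qed

end

section \<open>Smooth measures and integration by parts\<close>

locale measured_manifold = smooth_manifold A
  for A :: "('m::{t2_space, second_countable_topology}, 'e::euclidean_space) chart set" +
  fixes \<mu> :: "'m measure"
  assumes smooth_measure: "smooth_measure A \<mu>"
begin

lemma sets_mu [measurable_cong, simp]: "sets \<mu> = sets borel"
  using smooth_measure by (simp add: smooth_measure_def)

lemma space_mu [simp]: "space \<mu> = UNIV"
  using sets_eq_imp_space_eq[OF sets_mu] by simp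

lemma emeasure_chart:
  assumes "(U, \<phi>) \<in> A"
  obtains \<rho> where "continuous_on (\<phi> ` U) \<rho>" "\<And>z. z \<in> \<phi> ` U \<Longrightarrow> 0 < \<rho> z"
    "\<And>B. B \<in> sets borel \<Longrightarrow> B \<subseteq> U \<Longrightarrow>
       emeasure \<mu> B = (\<integral>\<^sup>+z. ennreal (\<rho> z) * indicator (\<phi> ` B) z \<partial>lborel)"
proof -
  have "\<forall>(U, \<phi>)\<in>A. \<exists>\<rho> :: 'e \<Rightarrow> real. smooth_on (\<phi> ` U) \<rho> \<and> (\<forall>z\<in>\<phi> ` U. 0 < \<rho> z) \<and>
        (\<forall>B\<in>sets borel. B \<subseteq> U \<longrightarrow>
           emeasure \<mu> B = (\<integral>\<^sup>+z. ennreal (\<rho> z) * indicator (\<phi> ` B) z \<partial>lborel))"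
    using smooth_measure unfolding smooth_measure_def by (rule conjunct2)
  from bspec[OF this assms, unfolded prod.case] obtain \<rho> where "smooth_on (\<phi> ` U) \<rho>"
    and pos: "\<forall>z\<in>\<phi> ` U. 0 < \<rho> z"
    and e: "\<forall>B\<in>sets borel. B \<subseteq> U \<longrightarrow>
       emeasure \<mu> B = (\<integral>\<^sup>+z. ennreal (\<rho> z) * indicator (\<phi> ` B) z \<partial>lborel)"
    by (elim exE conjE)
  from smooth_on_continuous[OF this(1)] bspec[OF pos] e[rule_format]
  show ?thesis by (rule that)
qed

text \<open>In a chart the measure has a positive density and a nonempty open set is not Lebesgue
  negligible.\<close>

lemma emeasure_open_pos:
  assumes W: "open W" "W \<noteq> {}"
  shows "0 < emeasure \<mu> W"
proof -
  obtain x where x: "x \<in> W" using W by auto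
  obtain U \<phi> where c: "(U, \<phi>) \<in> A" "x \<in> U" by (rule chart_at)
  define V where "V = \<phi> ` (U \<inter> W)"
  have UW: "open (U \<inter> W)" using W chart_open[OF c(1)] by auto
  have Oo: "open V" unfolding V_def by (rule chart_open_subimage[OF c(1) UW]) auto
  have Ox: "V \<noteq> {}" using x c by (auto simp: V_def)
  obtain \<rho> where \<rho>: "continuous_on (\<phi> ` U) \<rho>" "\<And>z. z \<in> \<phi> ` U \<Longrightarrow> 0 < \<rho> z"
    "\<And>B. B \<in> sets borel \<Longrightarrow> B \<subseteq> U \<Longrightarrow>
       emeasure \<mu> B = (\<integral>\<^sup>+z. ennreal (\<rho> z) * indicator (\<phi> ` B) z \<partial>lborel)"
    by (rule emeasure_chart[OF c(1)]) (rule that)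
  have OU: "V \<subseteq> \<phi> ` U" by (auto simp: V_def)
  have m: "(\<lambda>z. indicator V z *\<^sub>R \<rho> z) \<in> borel_measurable borel"
    by (rule borel_measurable_continuous_on_indicator) (use Oo continuous_on_subset[OF \<rho>(1) OU] in auto)
  have eq: "ennreal (\<rho> z) * indicator V z = ennreal (indicator V z *\<^sub>R \<rho> z)" for z
    by (simp add: indicator_def)
  have e: "emeasure \<mu> (U \<inter> W) = (\<integral>\<^sup>+z. ennreal (indicator V z *\<^sub>R \<rho> z) \<partial>lborel)"
    using \<rho>(3)[of "U \<inter> W"] UW unfolding eq[symmetric] V_def[symmetric] by auto
  have "emeasure \<mu> (U \<inter> W) \<noteq> 0"
  proof
    assume "emeasure \<mu> (U \<inter> W) = 0"
    then have "AE z in lborel. ennreal (indicator V z *\<^sub>R \<rho> z) = 0"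
      unfolding e by (subst (asm) nn_integral_0_iff_AE) (use m in auto)
    then have "AE z in lborel. z \<notin> V"
    proof (rule AE_mp, intro AE_I2 impI notI)
      fix z assume "ennreal (indicator V z *\<^sub>R \<rho> z) = 0" "z \<in> V"
      then have "\<rho> z \<le> 0" by (simp add: ennreal_eq_0_iff)
      moreover have "0 < \<rho> z" using \<rho>(2) OU \<open>z \<in> V\<close> by blast
      ultimately show False by simp
    qed
    then have "V \<in> null_sets lborel" using Oo by (subst (asm) AE_iff_null_sets[symmetric]) auto
    then have "negligible V" by (simp add: negligible_iff_null_sets null_sets_completionI)
    then show False using open_not_negligible[OF Oo Ox] by simp
  qed
  moreover have "emeasure \<mu> (U \<inter> W) \<le> emeasure \<mu> W" by (rule emeasure_mono) (use W in auto)
  ultimately show ?thesis by (auto simp: zero_less_iff_neq_zero)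
qed

lemma locally_finite: "\<exists>V. open V \<and> x \<in> V \<and> emeasure \<mu> V < \<infinity>"
proof -
  obtain U \<phi> where c: "(U, \<phi>) \<in> A" "x \<in> U" by (rule chart_at)
  obtain R where R: "0 < R" "cball (\<phi> x) R \<subseteq> \<phi> ` U"
    using chart_cball[OF c(1) chart_open[OF c(1)] order_refl c(2)] .
  obtain \<rho> where \<rho>: "continuous_on (\<phi> ` U) \<rho>"
    "\<And>B. B \<in> sets borel \<Longrightarrow> B \<subseteq> U \<Longrightarrow>
       emeasure \<mu> B = (\<integral>\<^sup>+z. ennreal (\<rho> z) * indicator (\<phi> ` B) z \<partial>lborel)"
    by (rule emeasure_chart[OF c(1)]) (rule that)
  have "compact (\<rho> ` cball (\<phi> x) R)"
    by (intro compact_continuous_image continuous_on_subset[OF \<rho>(1) R(2)] compact_cball)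
  then obtain M where M: "\<And>z. z \<in> cball (\<phi> x) R \<Longrightarrow> \<rho> z \<le> M"
    using compact_imp_bounded bounded_iff by (metis abs_le_D1 imageI real_norm_def)
  define V where "V = inv_into U \<phi> ` ball (\<phi> x) R"
  have bU: "ball (\<phi> x) R \<subseteq> \<phi> ` U" using R(2) by auto
  have V: "open V" unfolding V_def by (rule chart_open_preimage[OF c(1) open_ball bU])
  have VU: "V \<subseteq> U" unfolding V_def using bU by (auto intro: inv_into_into)
  have \<phi>V: "\<phi> ` V = ball (\<phi> x) R"
  proof -
    have "\<phi> (inv_into U \<phi> z) = z" if "z \<in> ball (\<phi> x) R" for z using that bU f_inv_into_f by (metis subsetD)
    then show ?thesis unfolding V_def image_image by simp
  qed
  have "emeasure \<mu> V = (\<integral>\<^sup>+z. ennreal (\<rho> z) * indicator (ball (\<phi> x) R) z \<partial>lborel)"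
    using \<rho>(2)[OF _ VU] V \<phi>V by simp
  also have "\<dots> \<le> (\<integral>\<^sup>+z. ennreal M * indicator (ball (\<phi> x) R) z \<partial>lborel)"
    by (rule nn_integral_mono) (use M in \<open>auto simp: indicator_def intro!: ennreal_leI\<close>)
  also have "\<dots> = ennreal M * emeasure lborel (ball (\<phi> x) R)"
    by (rule nn_integral_cmult_indicator) simp
  also have "\<dots> < \<infinity>" using emeasure_lborel_ball_finite[of "\<phi> x" R] by (simp add: ennreal_mult_less_top)
  finally have "emeasure \<mu> V < \<infinity>" .
  moreover have "x \<in> V" unfolding V_def using chart_inv[OF c] R(1) by (intro image_eqI[of _ _ "\<phi> x"]) auto
  ultimately show ?thesis using V by blast
qed

lemma emeasure_compact_finite:
  assumes K: "compact K"
  shows "emeasure \<mu> K < \<infinity>"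
proof -
  obtain V where V: "\<And>x. open (V x)" "\<And>x. x \<in> V x" "\<And>x. emeasure \<mu> (V x) < \<infinity>"
    using locally_finite by metis
  have "K \<subseteq> (\<Union>x\<in>K. V x)" using V(2) by auto
  from compactE_image[OF K V(1) this] obtain X where X: "finite X" "K \<subseteq> (\<Union>x\<in>X. V x)" by metis
  have "emeasure \<mu> K \<le> emeasure \<mu> (\<Union>x\<in>X. V x)"
    by (rule emeasure_mono[OF X(2)]) (auto intro!: borel_open open_UN V(1))
  also have "\<dots> \<le> (\<Sum>x\<in>X. emeasure \<mu> (V x))"
    by (rule emeasure_subadditive_finite[OF X(1)]) (use V(1) in auto)
  also have "\<dots> < \<infinity>" using X(1) V(3) by simp
  finally show ?thesis .
qed

text \<open>Countably many of the neighbourhoods of finite measure suffice by the Lindelof property.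
  This makes the Fubini arguments for the kernel available.\<close>

lemma sigma_finite_mu: "sigma_finite_measure \<mu>"
proof
  obtain V where V: "\<And>x. open (V x)" "\<And>x. x \<in> V x" "\<And>x. emeasure \<mu> (V x) < \<infinity>"
    using locally_finite by metis
  obtain F where F: "F \<subseteq> range V" "countable F" "\<Union>F = \<Union>(range V)"
    using Lindelof[of "range V"] V(1) by (metis rangeE)
  have "\<Union>F = space \<mu>" using F(3) V(2) by auto
  moreover have "F \<subseteq> sets \<mu>" using F(1) V(1) by auto
  moreover have "emeasure \<mu> a \<noteq> \<infinity>" if "a \<in> F" for a
  proof -
    obtain x where "a = V x" using F(1) \<open>a \<in> F\<close> by auto
    then show ?thesis using V(3)[of x] by simp
  qed
  ultimately show "\<exists>F. countable F \<and> F \<subseteq> sets \<mu> \<and> \<Union>F = space \<mu> \<and> (\<forall>a\<in>F. emeasure \<mu> a \<noteq> \<infinity>)"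
    using F(2) by (intro exI[of _ F] conjI ballI)
qed

lemma continuous_measurable: "continuous_on UNIV f \<Longrightarrow> f \<in> borel_measurable \<mu>"
  for f :: "'m \<Rightarrow> real"
  using borel_measurable_continuous_onI by (simp add: measurable_cong_sets[OF sets_mu refl])

lemma Cinf_measurable: "f \<in> Cinf A \<Longrightarrow> f \<in> borel_measurable \<mu>"
  by (rule continuous_measurable[OF Cinf_continuous])

lemma integrable_compact_support:
  fixes f :: "'m \<Rightarrow> real"
  assumes "continuous_on UNIV f" "compact K" "\<And>x. x \<notin> K \<Longrightarrow> f x = 0"
  shows "integrable \<mu> f" "(LINT x|\<mu>. f x) = (LINT x:K|\<mu>. f x)"
proof -
  have e: "(\<lambda>x. indicator K x *\<^sub>R f x) = f" using assms(3) by (auto simp: fun_eq_iff indicator_def)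
  have "set_integrable \<mu> K f"
    by (rule set_integrable_compact[OF sets_mu assms(2) emeasure_compact_finite[OF assms(2)]
          continuous_on_subset[OF assms(1)]]) simp
  then show "integrable \<mu> f" unfolding set_integrable_def e .
  show "(LINT x|\<mu>. f x) = (LINT x:K|\<mu>. f x)" unfolding set_lebesgue_integral_def e ..
qed

lemma integrable_Cinf0: "f \<in> Cinf0 A \<Longrightarrow> integrable \<mu> f"
  by (rule integrable_compact_support(1)[OF Cinf_continuous[OF Cinf0_Cinf] Cinf0_compact])
    (auto dest: not_in_closure_zero)

lemma finite_on_compact_Cinf0:
  assumes f: "f \<in> Cinf0 A"
  shows "finite_on_compact \<mu> (closure {x. f x \<noteq> 0}) f"
  by (unfold_locales, rule sets_mu, rule Cinf0_compact[OF f], rule emeasure_compact_finite[OF Cinf0_compact[OF f]],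
      rule continuous_on_subset[OF Cinf_continuous[OF Cinf0_Cinf[OF f]] subset_UNIV])

lemma integral_over_support:
  "(LINT x:closure {x. f x \<noteq> 0}|\<mu>. f x * u x) = (LINT x|\<mu>. f x * u x)" for f :: "'m \<Rightarrow> real"
  unfolding set_lebesgue_integral_def
proof (rule Bochner_Integration.integral_cong[OF refl])
  show "indicat_real (closure {x. f x \<noteq> 0}) x *\<^sub>R (f x * u x) = f x * u x" for x
    using not_in_closure_zero[of x f] by (cases "x \<in> closure {x. f x \<noteq> 0}") simp_all
qed

text \<open>The set where \<open>f\<close> and \<open>g\<close> differ is open and null, hence
  empty. This is the passage from statements in L^2 to pointwise ones.\<close>

lemma AE_eq_imp_eq:
  fixes f g :: "'m \<Rightarrow> real"
  assumes f: "continuous_on UNIV f" "continuous_on UNIV g" and ae: "AE x in \<mu>. f x = g x"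
  shows "f = g"
proof (rule ccontr)
  assume "f \<noteq> g"
  define W where "W = {x. f x \<noteq> g x}"
  have W: "open W" "W \<noteq> {}"
    unfolding W_def using \<open>f \<noteq> g\<close> by (auto intro!: open_Collect_neq f)
  have "AE x in \<mu>. x \<notin> W" using ae by (simp add: W_def)
  then have "emeasure \<mu> W = 0" using W(1) by (subst (asm) AE_iff_null_sets[symmetric]) auto
  then show False using emeasure_open_pos[OF W] by simp
qed

lemma integral_zero_imp_zero:
  fixes f :: "'m \<Rightarrow> real"
  assumes "continuous_on UNIV f" "integrable \<mu> f" "\<And>x. 0 \<le> f x" "(LINT x|\<mu>. f x) = 0"
  shows "f x = 0"
proof -
  have "AE x in \<mu>. f x = 0"
    using integral_nonneg_eq_0_iff_AE[OF assms(2)] assms(3,4) by simp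
  then have "f = (\<lambda>_. 0)" by (intro AE_eq_imp_eq assms(1)) auto
  then show ?thesis by simp
qed

text \<open>If v(x) were nonzero, a nonnegative bump supported where \<open>s * v\<close> is
  positive, with the sign \<open>s\<close> = 1 or -1 of v(x), would have a nonzero integral against
  \<open>v\<close>.\<close>

lemma test_functions_separate:
  fixes v :: "'m \<Rightarrow> real"
  assumes v: "continuous_on UNIV v" and 0: "\<And>g. g \<in> Cinf0 A \<Longrightarrow> (LINT x|\<mu>. v x * g x) = 0"
  shows "v x = 0"
proof -
  have "\<not> 0 < s * v x" if s: "s = 1 \<or> s = -1" for s
  proof
    assume "0 < s * v x"
    define W where "W = {y. 0 < s * v y}"
    have W: "open W" "x \<in> W"
      unfolding W_def using \<open>0 < s * v x\<close> by (auto intro!: open_Collect_less continuous_intros v)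
    from bump_exists[OF this] obtain \<eta> where \<eta>: "\<eta> \<in> Cinf0_on A W" "\<eta> x = 1" "\<And>y. 0 \<le> \<eta> y" by metis
    have \<eta>0: "\<eta> \<in> Cinf0 A" using \<eta>(1) by (simp add: Cinf0_on_def)
    have out: "\<eta> y = 0" if "y \<notin> W" for y
      using \<eta>(1) that not_in_closure_zero[of y \<eta>] unfolding Cinf0_on_def by blast
    let ?f = "\<lambda>y. s * v y * \<eta> y"
    have c: "continuous_on UNIV ?f"
      by (intro continuous_intros v Cinf_continuous Cinf0_Cinf \<eta>0)
    have i: "integrable \<mu> ?f"
      by (rule integrable_compact_support(1)[OF c Cinf0_compact[OF \<eta>0]]) (auto dest: not_in_closure_zero)
    have nn: "0 \<le> ?f y" for y
      using \<eta>(3)[of y] out[of y] by (cases "y \<in> W") (auto simp: W_def)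
    have "(LINT y|\<mu>. ?f y) = s * (LINT y|\<mu>. v y * \<eta> y)" by (simp add: mult.assoc)
    also have "\<dots> = 0" using 0[OF \<eta>0] by simp
    finally have "?f x = 0" using integral_zero_imp_zero[OF c i nn] by blast
    then show False using \<open>0 < s * v x\<close> \<eta>(2) by auto
  qed
  from this[of 1] this[of "-1"] show ?thesis by simp
qed

end

locale symmetric_diffusion = diffusion_operator A L + measured_manifold A \<mu>
  for A :: "('m::{t2_space, second_countable_topology}, 'e::euclidean_space) chart set"
    and L :: "('m \<Rightarrow> real) \<Rightarrow> 'm \<Rightarrow> real" and \<mu> :: "'m measure" +
  assumes L_symmetric: "\<And>f g. f \<in> Cinf0 A \<Longrightarrow> g \<in> Cinf0 A \<Longrightarrow>
      (LINT x|\<mu>. f x * L g x) = (LINT x|\<mu>. g x * L f x)"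
begin

text \<open>Multiplying \<open>u\<close> by a function that is 1 on a neighbourhood of the support
  of \<open>g\<close> makes it a test function. Since \<open>L\<close> is local, neither integral
  notices the change.\<close>

lemma L_symmetric_Cinf:
  assumes g: "g \<in> Cinf0 A" and u: "u \<in> Cinf A"
  shows "(LINT x|\<mu>. g x * L u x) = (LINT x|\<mu>. u x * L g x)"
proof -
  obtain \<eta> V where \<eta>: "\<eta> \<in> Cinf0 A" "open V" "closure {x. g x \<noteq> 0} \<subseteq> V" "\<And>x. x \<in> V \<Longrightarrow> \<eta> x = 1"
    using plateau_exists[OF Cinf0_compact[OF g]] by metis
  have \<eta>u: "(\<lambda>x. u x * \<eta> x) \<in> Cinf0 A" by (rule Cinf0_mult_right[OF u \<eta>(1)])
  have "g x * L u x = g x * L (\<lambda>x. u x * \<eta> x) x" for x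
  proof (cases "x \<in> V")
    case True
    have "L u x = L (\<lambda>x. u x * \<eta> x) x"
      by (rule L_local[OF u Cinf0_Cinf[OF \<eta>u] \<eta>(2) True]) (simp add: \<eta>(4))
    then show ?thesis by simp
  next
    case False
    then have "g x = 0" using \<eta>(3) not_in_closure_zero[of x g] by blast
    then show ?thesis by simp
  qed
  then have "(LINT x|\<mu>. g x * L u x) = (LINT x|\<mu>. g x * L (\<lambda>x. u x * \<eta> x) x)"
    by (rule Bochner_Integration.integral_cong[OF refl])
  also have "\<dots> = (LINT x|\<mu>. u x * \<eta> x * L g x)" by (rule L_symmetric[OF g \<eta>u])
  also have "\<dots> = (LINT x|\<mu>. u x * L g x)"
  proof (rule Bochner_Integration.integral_cong[OF refl])
    fix x
    show "u x * \<eta> x * L g x = u x * L g x"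
    proof (cases "x \<in> V")
      case False
      then have "L g x = 0" using \<eta>(3) L_zero_outside[OF Cinf0_Cinf[OF g], of x] by blast
      then show ?thesis by simp
    qed (simp add: \<eta>(4))
  qed
  finally show ?thesis .
qed

lemma integral_L:
  assumes "w \<in> Cinf0 A"
  shows "(LINT x|\<mu>. L w x) = 0"
  using L_symmetric_Cinf[OF assms Cinf_const, of 1] by (simp add: L_const)

text \<open>The integral of L(g u) is 0. Expanding it by the definition of \<Gamma> gives three
  integrals, and the first two are equal by symmetry.\<close>

lemma integration_by_parts:
  assumes g: "g \<in> Cinf0 A" and u: "u \<in> Cinf A"
  shows "(LINT x|\<mu>. g x * L u x) = - (LINT x|\<mu>. Gam L g u x)"
proof -
  note g' = Cinf0_Cinf[OF g]
  have i1: "integrable \<mu> (\<lambda>x. g x * L u x)"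
    by (intro integrable_Cinf0 Cinf0_mult_left g L_Cinf u)
  have i2: "integrable \<mu> (\<lambda>x. u x * L g x)"
    by (intro integrable_Cinf0 Cinf0_mult_right L_Cinf0 g u)
  have i3: "integrable \<mu> (Gam L g u)"
    by (rule integrable_compact_support(1)[OF Cinf_continuous[OF Gam_Cinf[OF g' u]] Cinf0_compact[OF g]])
      (rule Gam_zero_outside[OF g' u])
  have "0 = (LINT x|\<mu>. L (\<lambda>y. g y * u y) x)"
    by (rule integral_L[OF Cinf0_mult_left[OF g u], symmetric])
  also have "\<dots> = (LINT x|\<mu>. g x * L u x) + (LINT x|\<mu>. u x * L g x) + 2 * (LINT x|\<mu>. Gam L g u x)"
    unfolding L_mult using i1 i2 i3 by simp
  finally show ?thesis using L_symmetric_Cinf[OF g u] by simp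
qed

text \<open>The Cauchy-Schwarz inequality for \<Gamma> in the form that suits completing a square:
  \<open>s\<close> and \<open>t\<close> may later be the values of functions at the point
  \<open>x\<close>.\<close>

lemma Gam_quadratic_nonneg:
  assumes f: "f \<in> Cinf A" and g: "g \<in> Cinf A"
  shows "0 \<le> s\<^sup>2 * Gam L f f x + 2 * s * t * Gam L f g x + t\<^sup>2 * Gam L g g x"
proof -
  let ?h = "\<lambda>y. s * f y + t * g y"
  have h: "?h \<in> Cinf A" by (rule Cinf_add[OF Cinf_cmult[OF f] Cinf_cmult[OF g]])
  have "0 \<le> Gam L ?h ?h x" by (rule Gam_nonneg[OF h])
  also have "\<dots> = s * Gam L f ?h x + t * Gam L g ?h x" by (rule Gam_linear[OF f g h])
  also have "Gam L f ?h x = s * Gam L f f x + t * Gam L g f x"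
    unfolding Gam_sym[of f ?h] by (rule Gam_linear[OF f g f])
  also have "Gam L g ?h x = s * Gam L f g x + t * Gam L g g x"
    unfolding Gam_sym[of g ?h] by (rule Gam_linear[OF f g g])
  finally show ?thesis using Gam_sym[of g f] by (simp add: algebra_simps power2_eq_square)
qed

end

section \<open>Smooth time-dependent functions\<close>

lemma dir_deriv_slice:
  fixes F :: "'e::euclidean_space \<times> real \<Rightarrow> real"
  assumes F: "smooth_on (S \<times> T) F" and S: "open S" "open T" "z \<in> S" "s \<in> T"
  shows "((\<lambda>y. F (y, s)) has_derivative (\<lambda>v. frechet_derivative F (at (z, s)) (v, 0))) (at z)"
    and "dir_deriv v (\<lambda>y. F (y, s)) z = frechet_derivative F (at (z, s)) (v, 0)"
proof -
  have ST: "open (S \<times> T)" "(z, s) \<in> S \<times> T" using S by (auto intro: open_Times)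
  have "((\<lambda>z. (z, s)) has_derivative (\<lambda>v. (v, 0))) (at z)"
    by (rule has_derivative_Pair[OF has_derivative_ident has_derivative_const])
  from has_derivative_compose[OF this smooth_on_has_derivative[OF F ST]]
  show d: "((\<lambda>y. F (y, s)) has_derivative (\<lambda>v. frechet_derivative F (at (z, s)) (v, 0))) (at z)" .
  show "dir_deriv v (\<lambda>y. F (y, s)) z = frechet_derivative F (at (z, s)) (v, 0)"
    by (rule dir_deriv_eqI[OF d])
qed

lemma smooth_on_slice:
  fixes F :: "'e::euclidean_space \<times> real \<Rightarrow> real"
  assumes F: "smooth_on (S \<times> T) F" and S: "open S" "open T" "s \<in> T"
  shows "smooth_on S (\<lambda>y. F (y, s))"
proof (rule smooth_on_compose[OF S(1) open_Times[OF S(1,2)] _ F])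
  have "smooth_on S (\<lambda>z. (z, 0) + (0, s))"
    by (intro smooth_on_add S(1) smooth_on_const smooth_on_linear[where T = "\<lambda>z. (z, 0)"] smooth_on_id
        bounded_linear_Pair bounded_linear_ident bounded_linear_zero)
  then show "smooth_on S (\<lambda>z. (z, s))" by simp
qed (use S in auto)

text \<open>Mixed derivatives commute: differentiate \<open>F(\<cdot>,t) = F(\<cdot>,r) + \<integral>\<^sub>r\<^sup>t G(\<cdot>,\<sigma>) d\<sigma>\<close>
  under the integral.\<close>

lemma time_derivative_dir_deriv:
  fixes F G :: "'e::euclidean_space \<times> real \<Rightarrow> real"
  assumes S: "open S" and F: "smooth_on (S \<times> {0<..}) F" and G: "smooth_on (S \<times> {0<..}) G"
    and d: "\<And>z s. z \<in> S \<Longrightarrow> 0 < s \<Longrightarrow> ((\<lambda>s. F (z, s)) has_real_derivative G (z, s)) (at s)"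
    and z: "z \<in> S" and s: "0 < s"
  shows "((\<lambda>s. dir_deriv v (\<lambda>y. F (y, s)) z) has_real_derivative dir_deriv v (\<lambda>y. G (y, s)) z) (at s)"
proof -
  \<comment> \<open>The interval from \<open>r\<close> to \<open>b\<close> is a compact set of
    positive times with \<open>s\<close> in its interior.\<close>
  define r where "r = s / 2"
  define b where "b = 2 * s"
  define g where "g \<sigma> = dir_deriv v (\<lambda>y. G (y, \<sigma>)) z" for \<sigma>
  have rs: "0 < r" "r < s" "s < b" using s by (auto simp: r_def b_def)
  have SU: "open (S \<times> {0::real<..})" using S by (auto intro: open_Times)
  have T: "open {0::real<..}" by simp
  have cg: "continuous_on {0<..} g"
  proof -
    have "continuous_on {0<..} (\<lambda>\<sigma>. frechet_derivative G (at (z, \<sigma>)) (v, 0))"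
      by (rule continuous_on_compose2[OF smooth_on_continuous[OF smooth_on_frechet[OF G, of "(v, 0)"]]])
        (use z in \<open>auto intro!: continuous_intros\<close>)
    then show ?thesis
      by (rule iffD1[OF continuous_on_cong[OF refl], rotated])
        (simp add: g_def dir_deriv_slice(2)[OF G S T z])
  qed
  have cG: "continuous_on {0<..} (\<lambda>\<sigma>. G (y, \<sigma>))" if "y \<in> S" for y
    by (rule continuous_on_compose2[OF smooth_on_continuous[OF G]])
      (use that in \<open>auto intro!: continuous_intros\<close>)
  have eq: "dir_deriv v (\<lambda>y. F (y, t)) z = dir_deriv v (\<lambda>y. F (y, r)) z + integral {r..t} g"
    if t: "r < t" for t
  proof -
    interpret finite_on_compact lborel "{r..t}" "\<lambda>_. 1"
      by unfold_locales (use t in auto)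
    have sub: "{r..t} \<subseteq> {0<..}" using rs by auto
    have FTC: "F (y, t) = F (y, r) + (LINT \<sigma>:{r..t}|lborel. 1 * G (y, \<sigma>))" if y: "y \<in> S" for y
    proof -
      have "(LINT \<sigma>|lborel. indicator {r..t} \<sigma> *\<^sub>R G (y, \<sigma>)) = F (y, t) - F (y, r)"
      proof (rule integral_FTC_atLeastAtMost)
        show "r \<le> t" using t by simp
        show "continuous_on {r..t} (\<lambda>\<sigma>. G (y, \<sigma>))" by (rule continuous_on_subset[OF cG[OF y] sub])
        fix x assume "r \<le> x" "x \<le> t"
        then show "((\<lambda>a. F (y, a)) has_vector_derivative G (y, x)) (at x within {r..t})"
          using d[OF y, of x] rs
          by (auto simp: has_real_derivative_iff_has_vector_derivative[symmetric]
              intro: has_field_derivative_at_within)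
      qed
      then show ?thesis by (simp add: set_lebesgue_integral_def)
    qed
    have par: "Ck_param k S {r..t} (\<lambda>y \<sigma>. G (y, \<sigma>))" for k
      using Ck_param_product[OF S T, of "{r..t}" "\<lambda>\<sigma>. \<sigma>" k G] sub smooth_onD[OF G]
      by (simp add: continuous_on_id)
    have D: "((\<lambda>y. LINT \<sigma>:{r..t}|lborel. 1 * G (y, \<sigma>)) has_derivative
        (\<lambda>v. LINT \<sigma>:{r..t}|lborel. 1 * frechet_derivative (\<lambda>y. G (y, \<sigma>)) (at z) v)) (at z)"
    proof (rule has_derivative_param_integral[OF S Ck_param_continuous[OF par] _ _ z,
          where G' = "\<lambda>z \<sigma> v. frechet_derivative (\<lambda>y. G (y, \<sigma>)) (at z) v"])
      show "((\<lambda>y. G (y, \<sigma>)) has_derivative frechet_derivative (\<lambda>y. G (y, \<sigma>)) (at y)) (at y)"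
        if "y \<in> S" "\<sigma> \<in> {r..t}" for y \<sigma>
        by (rule Ck_param_has_derivative[OF par[of 1, unfolded One_nat_def] S that])
      show "continuous_on (S \<times> {r..t}) (\<lambda>(y, \<sigma>). frechet_derivative (\<lambda>y. G (y, \<sigma>)) (at y) v)" for v
        using par[of 1] by simp
    qed
    have "((\<lambda>y. F (y, r) + (LINT \<sigma>:{r..t}|lborel. 1 * G (y, \<sigma>))) has_derivative
        (\<lambda>v. frechet_derivative F (at (z, r)) (v, 0) +
          (LINT \<sigma>:{r..t}|lborel. 1 * frechet_derivative (\<lambda>y. G (y, \<sigma>)) (at z) v))) (at z)"
      by (rule has_derivative_add[OF dir_deriv_slice(1)[OF F S T z] D]) (use rs in simp)
    from has_derivative_transform_within_open[OF this S z]
    have "((\<lambda>y. F (y, t)) has_derivative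
        (\<lambda>v. frechet_derivative F (at (z, r)) (v, 0) +
          (LINT \<sigma>:{r..t}|lborel. 1 * frechet_derivative (\<lambda>y. G (y, \<sigma>)) (at z) v))) (at z)"
      using FTC by simp
    from dir_deriv_eqI[OF this, of v]
    have "dir_deriv v (\<lambda>y. F (y, t)) z = dir_deriv v (\<lambda>y. F (y, r)) z + (LINT \<sigma>:{r..t}|lborel. g \<sigma>)"
      using dir_deriv_slice(2)[OF F S T z, of r v] rs by (simp add: g_def dir_deriv_def)
    also have "(LINT \<sigma>:{r..t}|lborel. g \<sigma>) = integral {r..t} g"
      using set_integrable_times[OF continuous_on_subset[OF cg sub]]
      by (intro set_borel_integral_eq_integral(2)) simp
    finally show ?thesis .
  qed
  have "((\<lambda>t. integral {r..t} g) has_real_derivative g s) (at s within {r..b})"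
    by (rule integral_has_real_derivative) (use rs in \<open>auto intro: continuous_on_subset[OF cg]\<close>)
  then have "((\<lambda>t. integral {r..t} g) has_real_derivative g s) (at s within {r<..<b})"
    by (rule DERIV_subset) auto
  then have "((\<lambda>t. integral {r..t} g) has_real_derivative g s) (at s)"
    using rs by (simp add: at_within_open[of s "{r<..<b}"])
  then have "((\<lambda>t. dir_deriv v (\<lambda>y. F (y, r)) z + integral {r..t} g) has_real_derivative g s) (at s)"
    by (auto intro!: derivative_eq_intros)
  then have "((\<lambda>s. dir_deriv v (\<lambda>y. F (y, s)) z) has_real_derivative g s) (at s)"
    by (rule has_field_derivative_transform_within_open[of _ _ _ "{r<..<b}"]) (use rs eq in auto)
  then show ?thesis by (simp add: g_def)
qed

context smooth_manifold
begin

text \<open>Joint smoothness in space and time, for positive times only: the kernel says nothing at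
  time 0, where the behaviour is found separately from the convergence in L^2.\<close>

definition smooth_flow :: "(real \<Rightarrow> 'm \<Rightarrow> real) \<Rightarrow> bool" where
  "smooth_flow F \<longleftrightarrow> (\<forall>(U, \<phi>)\<in>A. smooth_on (\<phi> ` U \<times> {0<..}) (\<lambda>u. F (snd u) (inv_into U \<phi> (fst u))))"

lemma smooth_flowD:
  "smooth_flow F \<Longrightarrow> (U, \<phi>) \<in> A \<Longrightarrow> smooth_on (\<phi> ` U \<times> {0<..}) (\<lambda>u. F (snd u) (inv_into U \<phi> (fst u)))"
  unfolding smooth_flow_def by blast

lemma smooth_flowI:
  "(\<And>U \<phi>. (U, \<phi>) \<in> A \<Longrightarrow> smooth_on (\<phi> ` U \<times> {0<..}) (\<lambda>u. F (snd u) (inv_into U \<phi> (fst u)))) \<Longrightarrow> smooth_flow F"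
  unfolding smooth_flow_def by blast

lemma smooth_flow_Cinf:
  assumes F: "smooth_flow F" and s: "0 < s"
  shows "F s \<in> Cinf A"
proof (rule CinfI)
  fix U \<phi> assume c: "(U, \<phi>) \<in> A"
  show "smooth_on (\<phi> ` U) (\<lambda>z. F s (inv_into U \<phi> z))"
    using smooth_on_slice[OF smooth_flowD[OF F c] chart_open_image[OF c], of s] s by simp
qed

lemma smooth_flow_add_const:
  assumes F: "smooth_flow F"
  shows "smooth_flow (\<lambda>s x. F s x + a)"
proof (rule smooth_flowI)
  fix U \<phi> assume c: "(U, \<phi>) \<in> A"
  show "smooth_on (\<phi> ` U \<times> {0<..}) (\<lambda>u. F (snd u) (inv_into U \<phi> (fst u)) + a)"
    by (intro smooth_on_add smooth_flowD[OF F c] smooth_on_const open_Times chart_open_image[OF c]) simp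
qed

lemma smooth_flow_coordinates:
  assumes F: "smooth_flow F" and c: "(U, \<phi>) \<in> A"
  shows "continuous_on ({0<..} \<times> U) (\<lambda>(s, x). F s x)"
    and "continuous_on ({0<..} \<times> U) (\<lambda>(s, x). coord_deriv U \<phi> v (F s) x)"
proof -
  note sm = smooth_flowD[OF F c]
  have pr: "continuous_on ({0<..} \<times> U) (\<lambda>u. (\<phi> (snd u), fst u :: real))"
    by (intro continuous_intros continuous_on_compose2[OF chart_continuous[OF c]]) auto
  have im: "(\<lambda>u. (\<phi> (snd u), fst u :: real)) ` ({0<..} \<times> U) \<subseteq> \<phi> ` U \<times> {0<..}" by auto
  have "continuous_on ({0<..} \<times> U) (\<lambda>u. F (fst u) (inv_into U \<phi> (\<phi> (snd u))))"
    using continuous_on_compose2[OF smooth_on_continuous[OF sm] pr im] by simp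
  then show "continuous_on ({0<..} \<times> U) (\<lambda>(s, x). F s x)"
    by (rule iffD1[OF continuous_on_cong[OF refl], rotated]) (auto simp: chart_inv[OF c])
  have "continuous_on ({0<..} \<times> U) (\<lambda>u. frechet_derivative (\<lambda>u. F (snd u) (inv_into U \<phi> (fst u)))
      (at (\<phi> (snd u), fst u)) (v, 0))"
    by (rule continuous_on_compose2[OF smooth_on_continuous[OF smooth_on_frechet[OF sm, of "(v, 0)"]] pr im])
  then show "continuous_on ({0<..} \<times> U) (\<lambda>(s, x). coord_deriv U \<phi> v (F s) x)"
    by (rule iffD1[OF continuous_on_cong[OF refl], rotated])
      (use dir_deriv_slice(2)[OF sm chart_open_image[OF c]] in \<open>auto simp: comp_def\<close>)
qed

lemma smooth_flow_continuous:
  assumes F: "smooth_flow F"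
  shows "continuous_on ({0<..} \<times> UNIV) (\<lambda>(s, x). F s x)"
proof (rule continuous_on_open_local)
  fix u :: "real \<times> 'm" assume u: "u \<in> {0<..} \<times> UNIV"
  obtain U \<phi> where c: "(U, \<phi>) \<in> A" "snd u \<in> U" by (rule chart_at)
  show "\<exists>T. open T \<and> u \<in> T \<and> continuous_on T (\<lambda>(s, x). F s x)"
    by (intro exI[of _ "{0<..} \<times> U"] conjI open_Times chart_open[OF c(1)] smooth_flow_coordinates(1)[OF F c(1)])
      (use u c in auto)
qed

text \<open>In coordinates the coefficients of \<open>Q\<close> do not depend on time, so joint
  continuity is inherited from the spatial derivatives of the two flows.\<close>

lemma form_flow_continuous:
  assumes Q: "first_order_form A Q" and F: "smooth_flow F" and G: "smooth_flow G"
  shows "continuous_on ({0<..} \<times> UNIV) (\<lambda>(s, x). Q (F s) (G s) x)"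
proof (rule continuous_on_open_local)
  fix u :: "real \<times> 'm" assume u: "u \<in> {0<..} \<times> UNIV"
  obtain U \<phi> where c: "(U, \<phi>) \<in> A" "snd u \<in> U" by (rule chart_at)
  obtain W k where W: "open W" "snd u \<in> W" "W \<subseteq> U" "\<And>i j. k i j \<in> Cinf A"
    "\<And>f g x. f \<in> Cinf A \<Longrightarrow> g \<in> Cinf A \<Longrightarrow> x \<in> W \<Longrightarrow>
      Q f g x = form_expr U \<phi> k f g x"
    by (rule form_coordinates[OF Q c]) (rule that)
  have WU: "{0::real<..} \<times> W \<subseteq> {0<..} \<times> U" using W(3) by auto
  have k: "continuous_on ({0<..} \<times> W) (\<lambda>u. k i j (snd u))" for i j
    by (rule continuous_on_compose2[OF Cinf_continuous[OF W(4)]]) (auto intro!: continuous_intros)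
  have d: "continuous_on ({0<..} \<times> W) (\<lambda>u. dir_deriv v (H (fst u) \<circ> inv_into U \<phi>) (\<phi> (snd u)))"
    if "smooth_flow H" for H v
    using continuous_on_subset[OF smooth_flow_coordinates(2)[OF that c(1)] WU, of v]
    by (simp add: case_prod_beta')
  have "continuous_on ({0<..} \<times> W) (\<lambda>u. \<Sum>i\<in>Basis. \<Sum>j\<in>Basis. k i j (snd u) *
        dir_deriv i (F (fst u) \<circ> inv_into U \<phi>) (\<phi> (snd u)) * dir_deriv j (G (fst u) \<circ> inv_into U \<phi>) (\<phi> (snd u)))"
    by (intro continuous_on_sum continuous_on_mult k d[OF F] d[OF G])
  then have "continuous_on ({0<..} \<times> W) (\<lambda>(s, x). Q (F s) (G s) x)"
    by (rule iffD1[OF continuous_on_cong[OF refl], rotated])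
      (auto simp: W(5) smooth_flow_Cinf[OF F] smooth_flow_Cinf[OF G])
  then show "\<exists>T. open T \<and> u \<in> T \<and> continuous_on T (\<lambda>(s, x). Q (F s) (G s) x)"
    by (intro exI[of _ "{0<..} \<times> W"] conjI open_Times W(1)) (use u W(2) in auto)
qed

text \<open>Nothing abstract says that \<open>Q\<close> commutes with differentiation in time. The
  coordinate expression reduces the claim to the exchange of time and space derivatives.\<close>

lemma form_flow_derivative:
  assumes Q: "first_order_form A Q"
    and F: "smooth_flow F" "smooth_flow F'" and G: "smooth_flow G" "smooth_flow G'"
    and dF: "\<And>s x. 0 < s \<Longrightarrow> ((\<lambda>s. F s x) has_real_derivative F' s x) (at s)"
    and dG: "\<And>s x. 0 < s \<Longrightarrow> ((\<lambda>s. G s x) has_real_derivative G' s x) (at s)"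
    and s: "0 < s"
  shows "((\<lambda>s. Q (F s) (G s) x) has_real_derivative Q (F' s) (G s) x + Q (F s) (G' s) x) (at s)"
proof -
  obtain U \<phi> where c: "(U, \<phi>) \<in> A" "x \<in> U" by (rule chart_at)
  obtain W k where W: "open W" "x \<in> W" "W \<subseteq> U"
    "\<And>f g x. f \<in> Cinf A \<Longrightarrow> g \<in> Cinf A \<Longrightarrow> x \<in> W \<Longrightarrow>
      Q f g x = form_expr U \<phi> k f g x"
    by (rule form_coordinates[OF Q c]) (rule that)
  have d: "((\<lambda>s. coord_deriv U \<phi> v (H s) x) has_real_derivative
      coord_deriv U \<phi> v (H' s) x) (at s)"
    if H: "smooth_flow H" "smooth_flow H'"
      and dH: "\<And>s x. 0 < s \<Longrightarrow> ((\<lambda>s. H s x) has_real_derivative H' s x) (at s)" for H H' v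
    using time_derivative_dir_deriv[OF chart_open_image[OF c(1)] smooth_flowD[OF H(1) c(1)]
        smooth_flowD[OF H(2) c(1)] _ _ s, of "\<phi> x" v] dH c(2) by (simp add: comp_def)
  let ?d = "\<lambda>i H s. coord_deriv U \<phi> i (H s) x"
  have "((\<lambda>s. \<Sum>i\<in>Basis. \<Sum>j\<in>Basis. k i j x * ?d i F s * ?d j G s) has_real_derivative
      (\<Sum>i\<in>Basis. \<Sum>j\<in>Basis. k i j x * ?d i F' s * ?d j G s + k i j x * ?d i F s * ?d j G' s)) (at s)"
    by (rule DERIV_sum, rule DERIV_sum)
      (auto intro!: derivative_eq_intros d[OF F dF] d[OF G dG] simp: algebra_simps)
  then have "((\<lambda>s. Q (F s) (G s) x) has_real_derivative
      (\<Sum>i\<in>Basis. \<Sum>j\<in>Basis. k i j x * ?d i F' s * ?d j G s + k i j x * ?d i F s * ?d j G' s)) (at s)"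
    by (rule has_field_derivative_transform_within_open[of _ _ _ "{0<..}"])
      (use s W(2) W(4)[OF smooth_flow_Cinf[OF F(1)] smooth_flow_Cinf[OF G(1)]] in auto)
  then show ?thesis
    using W(4)[OF smooth_flow_Cinf[OF F(2)] smooth_flow_Cinf[OF G(1)] W(2)]
      W(4)[OF smooth_flow_Cinf[OF F(1)] smooth_flow_Cinf[OF G(2)] W(2)] s
    by (simp add: sum.distrib)
qed

end

section \<open>Time derivatives of smooth flows\<close>

lemma linear_zero_Pair:
  fixes D :: "'a::real_vector \<times> real \<Rightarrow> real"
  assumes "linear D"
  shows "D (0, h) = D (0, 1) * h"
  using linear_scale[OF assms, of h "(0, 1)"] by simp

context smooth_manifold
begin

lemma
  assumes F: "smooth_flow F" and s: "0 < s"
  shows smooth_flow_deriv: "((\<lambda>s. F s x) has_real_derivative deriv (\<lambda>s. F s x) s) (at s)"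
    and smooth_flow_deriv_continuous: "continuous_on UNIV (\<lambda>x. deriv (\<lambda>s. F s x) s)"
proof -
  have loc: "((\<lambda>s. F s x) has_real_derivative
      frechet_derivative (\<lambda>u. F (snd u) (inv_into U \<phi> (fst u))) (at (\<phi> x, s)) (0, 1)) (at s)"
    if c: "(U, \<phi>) \<in> A" "x \<in> U" for U \<phi> x
  proof -
    let ?G = "\<lambda>u. F (snd u) (inv_into U \<phi> (fst u))"
    have op: "open (\<phi> ` U \<times> {0::real<..})" by (rule open_Times[OF chart_open_image[OF c(1)] open_greaterThan])
    have x: "(\<phi> x, s) \<in> \<phi> ` U \<times> {0<..}" using s c(2) by auto
    note d = smooth_on_has_derivative[OF smooth_flowD[OF F c(1)] op x]
    have "((\<lambda>s. (\<phi> x, s)) has_derivative (\<lambda>h. (0, h))) (at s)"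
      by (rule has_derivative_Pair[OF has_derivative_const has_derivative_ident])
    from has_derivative_compose[OF this d]
    have "((\<lambda>s. F s x) has_derivative (\<lambda>h. frechet_derivative ?G (at (\<phi> x, s)) (0, h))) (at s)"
      by (simp add: chart_inv[OF c])
    then show ?thesis
      unfolding has_field_derivative_def
      by (rule has_derivative_eq_rhs) (rule ext, rule linear_zero_Pair[OF has_derivative_linear[OF d]])
  qed
  obtain U \<phi> where c: "(U, \<phi>) \<in> A" "x \<in> U" by (rule chart_at)
  show "((\<lambda>s. F s x) has_real_derivative deriv (\<lambda>s. F s x) s) (at s)"
    using loc[OF c] DERIV_imp_deriv by metis
  show "continuous_on UNIV (\<lambda>x. deriv (\<lambda>s. F s x) s)"
  proof (rule continuous_on_open_local)
    fix x
    obtain U \<phi> where c: "(U, \<phi>) \<in> A" "x \<in> U" by (rule chart_at)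
    have "continuous_on U (\<lambda>x. frechet_derivative (\<lambda>u. F (snd u) (inv_into U \<phi> (fst u))) (at (\<phi> x, s)) (0, 1))"
      by (rule continuous_on_compose2[OF smooth_on_continuous[OF smooth_on_frechet[OF smooth_flowD[OF F c(1)], of "(0, 1)"]]])
        (use s in \<open>auto intro!: continuous_intros chart_continuous[OF c(1)]\<close>)
    then have "continuous_on U (\<lambda>x. deriv (\<lambda>s. F s x) s)"
      by (rule iffD1[OF continuous_on_cong[OF refl], rotated]) (rule DERIV_imp_deriv[OF loc[OF c(1)], symmetric])
    then show "\<exists>T. open T \<and> x \<in> T \<and> continuous_on T (\<lambda>x. deriv (\<lambda>s. F s x) s)"
      using c chart_open by blast
  qed
qed

end

section \<open>Square-integrable functions\<close>

context measured_manifold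
begin

lemma L2_linear_comb:
  assumes f: "f \<in> L2 \<mu>" and g: "g \<in> L2 \<mu>"
  shows "(\<lambda>x. a * f x + b * g x) \<in> L2 \<mu>"
proof -
  have [measurable]: "f \<in> borel_measurable \<mu>" "g \<in> borel_measurable \<mu>"
    using f g by (auto simp: L2_def)
  have "integrable \<mu> (\<lambda>x. (a * f x + b * g x)\<^sup>2)"
  proof (rule Bochner_Integration.integrable_bound)
    show "integrable \<mu> (\<lambda>x. 2 * a\<^sup>2 * (f x)\<^sup>2 + 2 * b\<^sup>2 * (g x)\<^sup>2)"
      using f g by (auto simp: L2_def)
    have "(a * f x + b * g x)\<^sup>2 \<le> 2 * a\<^sup>2 * (f x)\<^sup>2 + 2 * b\<^sup>2 * (g x)\<^sup>2" for x
      using zero_le_power2[of "a * f x - b * g x"] by (simp add: power2_eq_square algebra_simps)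
    then show "AE x in \<mu>. norm ((a * f x + b * g x)\<^sup>2) \<le> norm (2 * a\<^sup>2 * (f x)\<^sup>2 + 2 * b\<^sup>2 * (g x)\<^sup>2)"
      by (auto intro!: AE_I2 order_trans[OF _ abs_ge_self])
  qed measurable
  then show ?thesis by (simp add: L2_def)
qed

lemma Cinf0_L2: "f \<in> Cinf0 A \<Longrightarrow> f \<in> L2 \<mu>"
  unfolding L2_def
  using integrable_Cinf0[OF Cinf0_mult_left[of f f]] Cinf_measurable Cinf0_Cinf
  by (simp add: power2_eq_square)

text \<open>Fatou's lemma for the squares: the integral of r^2 is at most the lower limit of
  integrals that tend to 0.\<close>

lemma L2_null_limit:
  fixes r :: "'m \<Rightarrow> real"
  assumes [measurable]: "\<And>n. q n \<in> borel_measurable \<mu>" "r \<in> borel_measurable \<mu>"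
    and int: "\<And>n. integrable \<mu> (\<lambda>x. (q n x)\<^sup>2)"
    and lim: "(\<lambda>n. LINT x|\<mu>. (q n x)\<^sup>2) \<longlonglongrightarrow> 0"
    and ptw: "AE x in \<mu>. (\<lambda>n. q n x) \<longlonglongrightarrow> r x"
  shows "AE x in \<mu>. r x = 0"
proof -
  have "(\<integral>\<^sup>+x. ennreal ((r x)\<^sup>2) \<partial>\<mu>) = (\<integral>\<^sup>+x. liminf (\<lambda>n. ennreal ((q n x)\<^sup>2)) \<partial>\<mu>)"
  proof (rule nn_integral_cong_AE, rule AE_mp[OF ptw], intro AE_I2 impI)
    fix x assume "(\<lambda>n. q n x) \<longlonglongrightarrow> r x"
    then have "(\<lambda>n. ennreal ((q n x)\<^sup>2)) \<longlonglongrightarrow> ennreal ((r x)\<^sup>2)" by (intro tendsto_intros)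
    then show "ennreal ((r x)\<^sup>2) = liminf (\<lambda>n. ennreal ((q n x)\<^sup>2))"
      using lim_imp_Liminf[OF sequentially_bot] by metis
  qed
  also have "\<dots> \<le> liminf (\<lambda>n. \<integral>\<^sup>+x. ennreal ((q n x)\<^sup>2) \<partial>\<mu>)" by (rule nn_integral_liminf) measurable
  also have "(\<lambda>n. \<integral>\<^sup>+x. ennreal ((q n x)\<^sup>2) \<partial>\<mu>) = (\<lambda>n. ennreal (LINT x|\<mu>. (q n x)\<^sup>2))"
    by (intro ext nn_integral_eq_integral int) auto
  also have "liminf \<dots> = 0"
    using lim_imp_Liminf[OF sequentially_bot tendsto_ennrealI[OF lim]] by simp
  finally have "(\<integral>\<^sup>+x. ennreal ((r x)\<^sup>2) \<partial>\<mu>) = 0" by simp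
  then show ?thesis by (subst (asm) nn_integral_0_iff_AE) auto
qed

end

section \<open>The heat semigroup\<close>

locale conservative_heat = symmetric_diffusion A L \<mu>
  for A :: "('m::{t2_space, second_countable_topology}, 'e::euclidean_space) chart set"
    and L :: "('m \<Rightarrow> real) \<Rightarrow> 'm \<Rightarrow> real" and \<mu> :: "'m measure" +
  fixes P :: "real \<Rightarrow> ('m \<Rightarrow> real) \<Rightarrow> 'm \<Rightarrow> real" and p :: "'m \<Rightarrow> 'm \<Rightarrow> real \<Rightarrow> real"
  assumes heat: "heat_semigroup A \<mu> L P"
    and kernel: "heat_kernel A \<mu> P p"
    and P_one: "\<And>t. 0 \<le> t \<Longrightarrow> P t (\<lambda>_. 1) = (\<lambda>_. 1)"
begin

lemma kernel_smooth:
  "(U, \<phi>) \<in> A \<Longrightarrow> (V, \<psi>) \<in> A \<Longrightarrow> smooth_on (\<phi> ` U \<times> \<psi> ` V \<times> {0<..})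
        (\<lambda>(a, b, t). p (inv_into U \<phi> a) (inv_into V \<psi> b) t)"
  using kernel unfolding heat_kernel_def by blast

lemma kernel_pos: "0 < t \<Longrightarrow> 0 < p x y t" and kernel_sym: "0 < t \<Longrightarrow> p x y t = p y x t"
  and kernel_L2: "0 < t \<Longrightarrow> f \<in> L2 \<mu> \<Longrightarrow> integrable \<mu> (\<lambda>y. p x y t * f y)"
  and P_eq: "0 < t \<Longrightarrow> P t f x = (LINT y|\<mu>. p x y t * f y)"
  using kernel unfolding heat_kernel_def by blast+

text \<open>The first point and the time are the parameters, and the second point runs over the
  whole manifold, which no single chart covers; hence the localization in \<open>y\<close>. Inside a
  chart the three variables only have to be regrouped.\<close>

lemma kernel_param:
  assumes c: "(U, \<phi>) \<in> A"
  shows "Ck_param k (\<phi> ` U \<times> {0<..}) UNIV (\<lambda>u y. p (inv_into U \<phi> (fst u)) y (snd u))"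
proof (rule Ck_param_local)
  show S: "open (\<phi> ` U \<times> {0::real<..})" by (intro open_Times chart_open_image[OF c] open_greaterThan)
  fix y :: 'm
  obtain V \<psi> where c': "(V, \<psi>) \<in> A" "y \<in> V" by (rule chart_at)
  define q where "q = (\<lambda>(a, b, t). p (inv_into U \<phi> a) (inv_into V \<psi> b) t)"
  have q: "smooth_on ((\<phi> ` U \<times> {0<..}) \<times> \<psi> ` V) (\<lambda>w. q (fst (fst w), snd w, snd (fst w)))"
  proof (rule smooth_on_compose[where g = q and f = "\<lambda>w. (fst (fst w), snd w, snd (fst w))"])
    show "open ((\<phi> ` U \<times> {0::real<..}) \<times> \<psi> ` V)" by (rule open_Times[OF S chart_open_image[OF c'(1)]])
    show "open (\<phi> ` U \<times> \<psi> ` V \<times> {0::real<..})"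
      by (intro open_Times chart_open_image c c'(1) open_greaterThan)
    show "smooth_on (\<phi> ` U \<times> \<psi> ` V \<times> {0<..}) q"
      unfolding q_def by (rule kernel_smooth[OF c c'(1)])
    show "smooth_on ((\<phi> ` U \<times> {0::real<..}) \<times> \<psi> ` V) (\<lambda>w. (fst (fst w), snd w, snd (fst w)))"
    proof (rule smooth_on_linear[where f = "\<lambda>w. w" and T = "\<lambda>w. (fst (fst w), snd w, snd (fst w))"])
      show "bounded_linear (\<lambda>w::('e \<times> real) \<times> 'e. (fst (fst w), snd w, snd (fst w)))"
        by (intro bounded_linear_Pair bounded_linear_snd bounded_linear_compose[OF bounded_linear_fst bounded_linear_fst]
            bounded_linear_compose[OF bounded_linear_snd bounded_linear_fst])
    qed (intro smooth_on_id open_Times[OF S chart_open_image[OF c'(1)]])+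
  qed auto
  have h: "Ck_param k (\<phi> ` U \<times> {0<..}) V (\<lambda>u y. q (fst u, \<psi> y, snd u))"
    using Ck_param_product[OF S chart_open_image[OF c'(1)] chart_continuous[OF c'(1)] order_refl smooth_onD[OF q]]
    by simp
  have "Ck_param k (\<phi> ` U \<times> {0<..}) V (\<lambda>u y. p (inv_into U \<phi> (fst u)) y (snd u))"
    by (rule Ck_param_cong[OF S _ h]) (simp add: q_def chart_inv[OF c'(1)])
  then show "\<exists>V. open V \<and> y \<in> V \<and> Ck_param k (\<phi> ` U \<times> {0<..}) V (\<lambda>u y. p (inv_into U \<phi> (fst u)) y (snd u))"
    using c' chart_open by blast
qed

lemma kernel_continuous:
  assumes t: "0 < t"
  shows "continuous_on UNIV (\<lambda>(x, y). p x y t)"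
proof (rule continuous_on_open_local)
  fix w :: "'m \<times> 'm"
  obtain U \<phi> where c: "(U, \<phi>) \<in> A" "fst w \<in> U" by (rule chart_at)
  have "continuous_on (U \<times> UNIV) (\<lambda>w. (\<lambda>(u, y). p (inv_into U \<phi> (fst u)) y (snd u)) ((\<phi> (fst w), t), snd w))"
    by (rule continuous_on_compose2[OF Ck_param_continuous[OF kernel_param[OF c(1), of 0]]])
      (use t in \<open>auto intro!: continuous_intros continuous_on_compose2[OF chart_continuous[OF c(1)]]\<close>)
  then have "continuous_on (U \<times> UNIV) (\<lambda>(x, y). p x y t)"
    by (rule iffD1[OF continuous_on_cong[OF refl], rotated]) (auto simp: chart_inv[OF c(1)])
  then show "\<exists>T. open T \<and> w \<in> T \<and> continuous_on T (\<lambda>(x, y). p x y t)"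
    by (intro exI[of _ "U \<times> UNIV"] conjI open_Times chart_open[OF c(1)]) (use c(2) in \<open>auto simp: mem_Times_iff\<close>)
qed

lemma kernel_measurable_pair:
  assumes t: "0 < t"
  shows "(\<lambda>(x, y). p x y t) \<in> borel_measurable (\<mu> \<Otimes>\<^sub>M \<mu>)"
proof -
  have "sets (\<mu> \<Otimes>\<^sub>M \<mu>) = sets (borel \<Otimes>\<^sub>M borel)" by (rule sets_pair_measure_cong) simp_all
  then have "sets (\<mu> \<Otimes>\<^sub>M \<mu>) = sets borel" by (simp only: borel_prod)
  then show ?thesis
    by (subst measurable_cong_sets[OF _ refl]) (assumption, rule borel_measurable_continuous_onI[OF kernel_continuous[OF t]])
qed

lemma kernel_measurable:
  assumes t: "0 < t"
  shows "(\<lambda>y. p x y t) \<in> borel_measurable \<mu>"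
proof (rule continuous_measurable)
  have "continuous_on UNIV (\<lambda>y. (\<lambda>(x, y). p x y t) (x, y))"
    by (rule continuous_on_compose2[OF kernel_continuous[OF t]]) (auto intro!: continuous_intros)
  then show "continuous_on UNIV (\<lambda>y. p x y t)" by simp
qed

lemma
  assumes t: "0 < t"
  shows kernel_integrable: "integrable \<mu> (\<lambda>y. p x y t)" and kernel_integral: "(LINT y|\<mu>. p x y t) = 1"
proof -
  show 1: "(LINT y|\<mu>. p x y t) = 1"
    using P_eq[OF t, of "\<lambda>_. 1" x] P_one[of t] t by simp
  \<comment> \<open>The integral of a non-integrable function is 0 by convention, so the value 1
    forces integrability.\<close>
  show "integrable \<mu> (\<lambda>y. p x y t)"
    by (rule ccontr) (use 1 not_integrable_integral_eq[of \<mu> "\<lambda>y. p x y t"] in simp)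
qed

lemma kernel_nn_integral: "0 < t \<Longrightarrow> (\<integral>\<^sup>+y. ennreal (p x y t) \<partial>\<mu>) = 1"
  by (subst nn_integral_eq_integral[OF kernel_integrable])
    (auto simp: kernel_integral intro: less_imp_le kernel_pos)

text \<open>The heat flow preserves total mass. After Tonelli the symmetry of the kernel puts the
  free variable first, and conservativeness evaluates the inner integral to 1.\<close>

lemma nn_integral_heat:
  assumes t: "0 < t" and u [measurable]: "u \<in> borel_measurable \<mu>"
  shows "(\<integral>\<^sup>+x. \<integral>\<^sup>+y. ennreal (p x y t) * u y \<partial>\<mu> \<partial>\<mu>) = (\<integral>\<^sup>+y. u y \<partial>\<mu>)"
proof -
  interpret sigma_finite_measure \<mu> by (rule sigma_finite_mu)
  interpret pair_sigma_finite \<mu> \<mu> ..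
  note [measurable] = kernel_measurable_pair[OF t]
  have "(\<integral>\<^sup>+x. \<integral>\<^sup>+y. ennreal (p x y t) * u y \<partial>\<mu> \<partial>\<mu>) = (\<integral>\<^sup>+y. \<integral>\<^sup>+x. ennreal (p x y t) * u y \<partial>\<mu> \<partial>\<mu>)"
    by (rule Fubini'[symmetric]) measurable
  also have "\<dots> = (\<integral>\<^sup>+y. u y \<partial>\<mu>)"
  proof (rule nn_integral_cong)
    fix y
    have "(\<integral>\<^sup>+x. ennreal (p x y t) * u y \<partial>\<mu>) = (\<integral>\<^sup>+x. ennreal (p y x t) \<partial>\<mu>) * u y"
      using kernel_measurable[OF t, of y] by (subst nn_integral_multc[symmetric]) (simp_all add: kernel_sym[OF t])
    then show "(\<integral>\<^sup>+x. ennreal (p x y t) * u y \<partial>\<mu>) = u y" by (simp add: kernel_nn_integral[OF t])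
  qed
  finally show ?thesis .
qed

text \<open>On the compact support of \<open>f\<close> the kernel can be differentiated under the
  integral any number of times.\<close>

lemma heat_smooth_flow:
  assumes f: "f \<in> Cinf0 A"
  shows "smooth_flow (\<lambda>s. P s f)"
proof (rule smooth_flowI)
  fix U \<phi> assume c: "(U, \<phi>) \<in> A"
  let ?K = "closure {x. f x \<noteq> 0}"
  interpret finite_on_compact \<mu> ?K f by (rule finite_on_compact_Cinf0[OF f])
  have S: "open (\<phi> ` U \<times> {0::real<..})" by (intro open_Times chart_open_image[OF c] open_greaterThan)
  have par: "Ck_param k (\<phi> ` U \<times> {0<..}) ?K (\<lambda>u y. p (inv_into U \<phi> (fst u)) y (snd u))" for k
  proof (rule Ck_param_local[OF S])
    show "\<exists>V. open V \<and> y \<in> V \<and> Ck_param k (\<phi> ` U \<times> {0<..}) V (\<lambda>u y. p (inv_into U \<phi> (fst u)) y (snd u))" for y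
      using kernel_param[OF c, of k] by (intro exI[of _ UNIV]) auto
  qed
  have "smooth_on (\<phi> ` U \<times> {0<..}) (\<lambda>u. LINT y:?K|\<mu>. f y * p (inv_into U \<phi> (fst u)) y (snd u))"
    by (intro smooth_onI Ck_on_param_integral[OF S] par)
  then show "smooth_on (\<phi> ` U \<times> {0<..}) (\<lambda>u. P (snd u) f (inv_into U \<phi> (fst u)))"
  proof (rule smooth_on_cong[OF S, rotated])
    fix u assume "u \<in> \<phi> ` U \<times> {0::real<..}"
    then have t: "0 < snd u" by auto
    show "(LINT y:?K|\<mu>. f y * p (inv_into U \<phi> (fst u)) y (snd u)) = P (snd u) f (inv_into U \<phi> (fst u))"
      unfolding integral_over_support P_eq[OF t] by (simp add: mult.commute)
  qed
qed

lemma heat_Cinf: "f \<in> Cinf0 A \<Longrightarrow> 0 < s \<Longrightarrow> P s f \<in> Cinf A"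
  by (rule smooth_flow_Cinf[OF heat_smooth_flow])

lemma heat_linear:
  assumes "0 < s" "f \<in> L2 \<mu>" "g \<in> L2 \<mu>"
  shows "P s (\<lambda>x. a * f x + b * g x) x = a * P s f x + b * P s g x"
proof -
  have "P s (\<lambda>x. a * f x + b * g x) x = (LINT y|\<mu>. a * (p x y s * f y) + b * (p x y s * g y))"
    unfolding P_eq[OF assms(1)] by (simp add: algebra_simps)
  also have "\<dots> = a * P s f x + b * P s g x"
    unfolding P_eq[OF assms(1)] using kernel_L2[OF assms(1,2)] kernel_L2[OF assms(1,3)] by simp
  finally show ?thesis .
qed

text \<open>The kernel is positive with total mass 1, so \<open>P s f\<close> is an average of
  \<open>f\<close>.\<close>

lemma heat_bounded:
  assumes s: "0 < s" and f: "f \<in> L2 \<mu>" "\<And>x. \<bar>f x\<bar> \<le> B"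
  shows "\<bar>P s f x\<bar> \<le> B"
proof -
  have "\<bar>P s f x\<bar> \<le> (LINT y|\<mu>. p x y s * B)"
    unfolding P_eq[OF s]
  proof (rule integral_abs_bound[THEN order_trans], rule integral_mono)
    show "integrable \<mu> (\<lambda>y. \<bar>p x y s * f y\<bar>)" by (intro integrable_abs kernel_L2 s f)
    show "integrable \<mu> (\<lambda>y. p x y s * B)" by (intro integrable_mult_left kernel_integrable s)
    show "\<bar>p x y s * f y\<bar> \<le> p x y s * B" for y
      using f(2)[of y] kernel_pos[OF s, of x y] by (simp add: abs_mult)
  qed
  also have "\<dots> = B" using kernel_integral[OF s] by simp
  finally show ?thesis .
qed

lemma heat_pos:
  assumes s: "0 < s" and f: "f \<in> Cinf0 A" "\<And>x. 0 \<le> f x" "f x0 \<noteq> 0"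
  shows "0 < P s f x"
proof -
  have c: "continuous_on UNIV (\<lambda>y. p x y s)"
    using continuous_on_compose2[OF kernel_continuous[OF s], of UNIV "\<lambda>y. (x, y)"] by (simp add: continuous_intros)
  have cf: "continuous_on UNIV (\<lambda>y. p x y s * f y)"
    by (intro continuous_on_mult c Cinf_continuous Cinf0_Cinf f)
  have nn: "0 \<le> p x y s * f y" for y using f(2)[of y] kernel_pos[OF s, of x y] by simp
  have "0 \<le> P s f x" unfolding P_eq[OF s] using nn by (intro integral_nonneg_AE) simp
  moreover have "P s f x \<noteq> 0"
    unfolding P_eq[OF s]
  proof
    assume "(LINT y|\<mu>. p x y s * f y) = 0"
    from integral_zero_imp_zero[OF cf kernel_L2[OF s Cinf0_L2[OF f(1)]] nn this]
    have "p x x0 s * f x0 = 0" .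
    then show False using f(3) kernel_pos[OF s, of x x0] by simp
  qed
  ultimately show ?thesis by simp
qed

text \<open>The bound on the integral is uniform in \<open>s\<close>; in the comparison principle it
  controls the error terms on the whole time interval.\<close>

lemma heat_L1:
  assumes s: "0 < s" and f: "f \<in> Cinf0 A"
  shows "integrable \<mu> (P s f)" "(LINT x|\<mu>. \<bar>P s f x\<bar>) \<le> (LINT x|\<mu>. \<bar>f x\<bar>)"
proof -
  have [measurable]: "P s f \<in> borel_measurable \<mu>" "f \<in> borel_measurable \<mu>"
    by (intro Cinf_measurable heat_Cinf f s Cinf0_Cinf)+
  have b: "ennreal \<bar>P s f x\<bar> \<le> (\<integral>\<^sup>+y. ennreal (p x y s) * ennreal \<bar>f y\<bar> \<partial>\<mu>)" for x
    unfolding P_eq[OF s]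
    using integral_norm_bound_ennreal[OF kernel_L2[OF s Cinf0_L2[OF f], of x]] kernel_pos[OF s, of x]
    by (simp add: abs_mult ennreal_mult less_imp_le)
  have "(\<integral>\<^sup>+x. ennreal \<bar>P s f x\<bar> \<partial>\<mu>) \<le> (\<integral>\<^sup>+x. \<integral>\<^sup>+y. ennreal (p x y s) * ennreal \<bar>f y\<bar> \<partial>\<mu> \<partial>\<mu>)"
    by (rule nn_integral_mono) (rule b)
  also have "\<dots> = (\<integral>\<^sup>+y. ennreal \<bar>f y\<bar> \<partial>\<mu>)" by (rule nn_integral_heat[OF s]) measurable
  also have "\<dots> = ennreal (LINT x|\<mu>. \<bar>f x\<bar>)"
    by (rule nn_integral_eq_integral) (use integrable_abs[OF integrable_Cinf0[OF f]] in auto)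
  finally have le: "(\<integral>\<^sup>+x. ennreal \<bar>P s f x\<bar> \<partial>\<mu>) \<le> ennreal (LINT x|\<mu>. \<bar>f x\<bar>)" .
  then show i: "integrable \<mu> (P s f)"
    by (intro integrableI_bounded) (auto intro: order_le_less_trans)
  have "ennreal (LINT x|\<mu>. \<bar>P s f x\<bar>) = (\<integral>\<^sup>+x. ennreal \<bar>P s f x\<bar> \<partial>\<mu>)"
    by (rule nn_integral_eq_integral[symmetric]) (use integrable_abs[OF i] in auto)
  with le have "ennreal (LINT x|\<mu>. \<bar>P s f x\<bar>) \<le> ennreal (LINT x|\<mu>. \<bar>f x\<bar>)" by simp
  then show "(LINT x|\<mu>. \<bar>P s f x\<bar>) \<le> (LINT x|\<mu>. \<bar>f x\<bar>)"
    by (subst (asm) ennreal_le_iff) auto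
qed

text \<open>Fubini together with the symmetry of the kernel. Absolute integrability on the product
  follows from the boundedness of \<open>g\<close> and the preservation of mass applied to the
  absolute value of \<open>f\<close>.\<close>

lemma heat_symmetric:
  assumes s: "0 < s" and f: "f \<in> Cinf0 A" and g: "g \<in> Cinf0 A"
  shows "(LINT x|\<mu>. g x * P s f x) = (LINT x|\<mu>. f x * P s g x)"
proof -
  interpret sigma_finite_measure \<mu> by (rule sigma_finite_mu)
  interpret pair_sigma_finite \<mu> \<mu> ..
  note [measurable] = kernel_measurable_pair[OF s]
  have [measurable]: "g \<in> borel_measurable \<mu>" "f \<in> borel_measurable \<mu>"
    by (intro Cinf_measurable f g Cinf0_Cinf)+
  obtain B where B: "0 \<le> B" "\<And>x. \<bar>g x\<bar> \<le> B" by (rule Cinf0_bounded[OF g]) (rule that)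
  have m: "(\<lambda>(x, y). g x * (p x y s * f y)) \<in> borel_measurable (\<mu> \<Otimes>\<^sub>M \<mu>)" by measurable
  have "(\<integral>\<^sup>+w. ennreal (norm (case w of (x, y) \<Rightarrow> g x * (p x y s * f y))) \<partial>(\<mu> \<Otimes>\<^sub>M \<mu>))
      = (\<integral>\<^sup>+x. \<integral>\<^sup>+y. ennreal \<bar>g x * (p x y s * f y)\<bar> \<partial>\<mu> \<partial>\<mu>)"
    using sigma_finite_measure.nn_integral_fst[OF sigma_finite_mu, where f = "\<lambda>w. ennreal (norm (case w of (x, y) \<Rightarrow> g x * (p x y s * f y)))" and ?M1.0 = \<mu>] m
    by simp
  also have "\<dots> \<le> (\<integral>\<^sup>+x. \<integral>\<^sup>+y. ennreal (p x y s) * ennreal (B * \<bar>f y\<bar>) \<partial>\<mu> \<partial>\<mu>)"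
  proof (intro nn_integral_mono)
    fix x y
    have "\<bar>g x * (p x y s * f y)\<bar> = p x y s * (\<bar>g x\<bar> * \<bar>f y\<bar>)"
      using kernel_pos[OF s, of x y] by (simp add: abs_mult)
    also have "\<dots> \<le> p x y s * (B * \<bar>f y\<bar>)"
      using kernel_pos[OF s, of x y] B by (intro mult_left_mono mult_right_mono) auto
    finally have "ennreal \<bar>g x * (p x y s * f y)\<bar> \<le> ennreal (p x y s * (B * \<bar>f y\<bar>))" by (rule ennreal_leI)
    then show "ennreal \<bar>g x * (p x y s * f y)\<bar> \<le> ennreal (p x y s) * ennreal (B * \<bar>f y\<bar>)"
      using kernel_pos[OF s, of x y] B by (simp add: ennreal_mult less_imp_le)
  qed
  also have "\<dots> = (\<integral>\<^sup>+y. ennreal (B * \<bar>f y\<bar>) \<partial>\<mu>)" by (rule nn_integral_heat[OF s]) measurable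
  also have "\<dots> < \<infinity>"
    using integrable_mult_right[OF integrable_abs[OF integrable_Cinf0[OF f]], of B] B
    by (subst nn_integral_eq_integral) auto
  finally have "integrable (\<mu> \<Otimes>\<^sub>M \<mu>) (\<lambda>(x, y). g x * (p x y s * f y))"
    by (rule integrableI_bounded[OF m])
  from Fubini_integral[OF this]
  have "(LINT x|\<mu>. LINT y|\<mu>. g x * (p x y s * f y)) = (LINT y|\<mu>. LINT x|\<mu>. g x * (p x y s * f y))" by simp
  also have "(\<lambda>x. LINT y|\<mu>. g x * (p x y s * f y)) = (\<lambda>x. g x * P s f x)"
    by (simp add: P_eq[OF s])
  also have "(\<lambda>y. LINT x|\<mu>. g x * (p x y s * f y)) = (\<lambda>y. f y * P s g y)"
  proof
    fix y
    have "(LINT x|\<mu>. g x * (p x y s * f y)) = (LINT x|\<mu>. f y * (p y x s * g x))"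
      by (simp add: kernel_sym[OF s, of _ y] mult_ac)
    then show "(LINT x|\<mu>. g x * (p x y s * f y)) = f y * P s g y" by (simp add: P_eq[OF s])
  qed
  finally show ?thesis .
qed

end

section \<open>From the semigroup in L^2 to the pointwise heat equation\<close>

lemma seq_at_right_0: "filterlim (\<lambda>n. inverse (real (Suc n))) (at_right 0) sequentially"
  unfolding filterlim_at using LIMSEQ_inverse_real_of_nat by auto

context measured_manifold
begin

lemma integral_flow_derivative:
  fixes F F' :: "real \<Rightarrow> 'm \<Rightarrow> real"
  assumes g: "g \<in> Cinf0 A"
    and c: "continuous_on ({0<..} \<times> UNIV) (\<lambda>(s, x). F s x)" "continuous_on ({0<..} \<times> UNIV) (\<lambda>(s, x). F' s x)"
    and d: "\<And>s x. 0 < s \<Longrightarrow> ((\<lambda>s. F s x) has_real_derivative F' s x) (at s)" and s: "0 < s"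
  shows "((\<lambda>s. LINT x|\<mu>. g x * F s x) has_real_derivative (LINT x|\<mu>. g x * F' s x)) (at s)"
proof -
  let ?K = "closure {x. g x \<noteq> 0}"
  interpret finite_on_compact \<mu> ?K g by (rule finite_on_compact_Cinf0[OF g])
  have sub: "{0<..} \<times> ?K \<subseteq> {0::real<..} \<times> UNIV" by auto
  have cv: "continuous_on ({0<..} \<times> ?K) (\<lambda>(s, y). v * F' s y)" for v
    using continuous_on_mult[OF continuous_on_const continuous_on_subset[OF c(2) sub]] by (simp add: case_prod_beta')
  have "((\<lambda>s. LINT x:?K|\<mu>. g x * F s x) has_derivative (\<lambda>v. LINT x:?K|\<mu>. g x * (v * F' s x))) (at s)"
  proof (rule has_derivative_param_integral[where S = "{0<..}"])
    show "((\<lambda>s. F s y) has_derivative (\<lambda>v. v * F' s y)) (at s)" if "s \<in> {0<..}" for s y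
      by (rule has_derivative_eq_rhs[OF d[of s y, unfolded has_field_derivative_def]])
        (use that in auto)
    show "continuous_on ({0<..} \<times> ?K) (\<lambda>(s, y). F s y)" by (rule continuous_on_subset[OF c(1) sub])
    show "continuous_on ({0<..} \<times> ?K) (\<lambda>(s, y). v * F' s y)" for v by (rule cv)
  qed (use s in simp_all)
  moreover have "(LINT x|\<mu>. g x * (v * F' s x)) = (LINT x|\<mu>. g x * F' s x) * v" for v
  proof -
    have "(LINT x|\<mu>. g x * (v * F' s x)) = (LINT x|\<mu>. (g x * F' s x) * v)"
      by (rule Bochner_Integration.integral_cong[OF refl]) simp
    then show ?thesis by simp
  qed
  ultimately show ?thesis
    unfolding has_field_derivative_def integral_over_support by simp
qed

end

context conservative_heat
begin

lemma semigroup: "C0_semigroup \<mu> P"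
  using heat by (simp add: heat_semigroup_def)

lemma heat_L2: "0 \<le> t \<Longrightarrow> f \<in> L2 \<mu> \<Longrightarrow> P t f \<in> L2 \<mu>"
  using semigroup unfolding C0_semigroup_def by blast

lemma heat_L2_bound:
  assumes "0 \<le> t"
  obtains C where "\<And>f. f \<in> L2 \<mu> \<Longrightarrow> (LINT x|\<mu>. (P t f x)\<^sup>2) \<le> C * (LINT x|\<mu>. (f x)\<^sup>2)"
proof -
  have "\<exists>C. \<forall>f\<in>L2 \<mu>. (LINT x|\<mu>. (P t f x)\<^sup>2) \<le> C * (LINT x|\<mu>. (f x)\<^sup>2)"
    using semigroup assms unfolding C0_semigroup_def by (elim conjE) (drule spec[of _ t], simp)
  then show ?thesis using that by auto
qed

lemma heat_semigroup_AE:
  "0 \<le> s \<Longrightarrow> 0 \<le> t \<Longrightarrow> f \<in> L2 \<mu> \<Longrightarrow> AE x in \<mu>. P (s + t) f x = P s (P t f) x"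
  using semigroup unfolding C0_semigroup_def by blast

lemma heat_initial: "f \<in> L2 \<mu> \<Longrightarrow> ((\<lambda>t. L2dist_sq \<mu> (P t f) f) \<longlongrightarrow> 0) (at_right 0)"
  using semigroup unfolding C0_semigroup_def by blast

text \<open>A test function with its image under \<open>L\<close> lies in the closure by constant
  sequences, and the closure is the graph of the generator.\<close>

lemma test_generator:
  assumes f: "f \<in> Cinf0 A"
  shows "((\<lambda>t. L2dist_sq \<mu> (\<lambda>x. (P t f x - f x) / t) (L f)) \<longlongrightarrow> 0) (at_right 0)"
proof -
  have "(f, L f) \<in> L2_closure \<mu> (test_graph A L)"
    unfolding L2_closure_def
  proof (simp only: mem_Collect_eq prod.case, intro conjI exI allI)
    show "f \<in> L2 \<mu>" "L f \<in> L2 \<mu>" by (intro Cinf0_L2 L_Cinf0 f)+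
    show "((\<lambda>_. f) n, (\<lambda>_. L f) n) \<in> test_graph A L" for n :: nat using f by (auto simp: test_graph_def)
    show "(\<lambda>n. L2dist_sq \<mu> ((\<lambda>_. f) n) f) \<longlonglongrightarrow> 0" "(\<lambda>n. L2dist_sq \<mu> ((\<lambda>_. L f) n) (L f)) \<longlonglongrightarrow> 0"
      by (simp_all add: L2dist_sq_def)
  qed
  then have "(f, L f) \<in> generator \<mu> P" using heat by (simp add: heat_semigroup_def)
  then show ?thesis by (simp add: generator_def)
qed

text \<open>A pointwise time derivative \<open>D\<close> exists by smoothness of the kernel; it
  remains to identify it. The difference quotients of \<open>P t f\<close> at time 0 tend to
  \<open>L f\<close> in L^2, and the bounded operator \<open>P s\<close> carries this over to time
  \<open>s\<close>. The limit in L^2 and the pointwise limit agree almost everywhere, and both are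
  continuous.\<close>

lemma heat_equation:
  assumes s: "0 < s" and f: "f \<in> Cinf0 A"
  shows "((\<lambda>s. P s f x) has_real_derivative P s (L f) x) (at s)"
proof -
  note fl = heat_smooth_flow[OF f]
  note fL2 = Cinf0_L2[OF f] note LfL2 = Cinf0_L2[OF L_Cinf0[OF f]]
  define D where "D x = deriv (\<lambda>s. P s f x) s" for x
  have D: "((\<lambda>s. P s f x) has_real_derivative D x) (at s)" for x
    unfolding D_def by (rule smooth_flow_deriv[OF fl s])
  have cD: "continuous_on UNIV D"
    using smooth_flow_deriv_continuous[OF fl s] by (simp add: D_def[abs_def])
  define t where "t n = inverse (real (Suc n))" for n
  have tpos: "0 < t n" for n by (simp add: t_def)
  have t0: "filterlim t (at_right 0) sequentially" unfolding t_def by (rule seq_at_right_0)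
  define g where "g n x = (P (t n) f x - f x) / t n - L f x" for n x
  have gL2: "g n \<in> L2 \<mu>" for n
  proof -
    have "(\<lambda>x. inverse (t n) * (1 * P (t n) f x + (- 1) * f x) + (- 1) * L f x) \<in> L2 \<mu>"
      by (intro L2_linear_comb heat_L2 fL2 LfL2 less_imp_le tpos)
    moreover have "(\<lambda>x. inverse (t n) * (1 * P (t n) f x + (- 1) * f x) + (- 1) * L f x) = g n"
      by (auto simp: g_def divide_inverse mult.commute)
    ultimately show ?thesis by simp
  qed
  have Pg: "P s (g n) x = (P s (P (t n) f) x - P s f x) / t n - P s (L f) x" for n x
  proof -
    have 1: "(\<lambda>x. 1 * P (t n) f x + (- 1) * f x) \<in> L2 \<mu>"
      by (intro L2_linear_comb heat_L2 fL2 less_imp_le tpos)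
    have "g n = (\<lambda>x. inverse (t n) * (1 * P (t n) f x + (- 1) * f x) + (- 1) * L f x)"
      by (auto simp: g_def divide_inverse mult.commute)
    then have "P s (g n) x = P s (\<lambda>x. inverse (t n) * (1 * P (t n) f x + (- 1) * f x) + (- 1) * L f x) x"
      by simp
    also have "\<dots> = inverse (t n) * (1 * P s (P (t n) f) x + (- 1) * P s f x) + (- 1) * P s (L f) x"
      unfolding heat_linear[OF s 1 LfL2] heat_linear[OF s heat_L2[OF less_imp_le[OF tpos] fL2] fL2] ..
    finally show ?thesis by (simp add: divide_inverse mult.commute)
  qed
  have meas: "u \<in> L2 \<mu> \<Longrightarrow> u \<in> borel_measurable \<mu>" and sq: "u \<in> L2 \<mu> \<Longrightarrow> integrable \<mu> (\<lambda>x. (u x)\<^sup>2)" for u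
    by (auto simp: L2_def)
  have "AE x in \<mu>. D x - P s (L f) x = 0"
  proof (rule L2_null_limit[of "\<lambda>n. P s (g n)"])
    show "P s (g n) \<in> borel_measurable \<mu>" "integrable \<mu> (\<lambda>x. (P s (g n) x)\<^sup>2)" for n
      using heat_L2[OF less_imp_le[OF s] gL2] meas sq by blast+
    show "(\<lambda>x. D x - P s (L f) x) \<in> borel_measurable \<mu>"
      by (intro borel_measurable_diff continuous_measurable[OF cD] Cinf_measurable heat_Cinf L_Cinf0 f s)
    show "(\<lambda>n. LINT x|\<mu>. (P s (g n) x)\<^sup>2) \<longlonglongrightarrow> 0"
    proof -
      obtain C where C: "\<And>f. f \<in> L2 \<mu> \<Longrightarrow> (LINT x|\<mu>. (P s f x)\<^sup>2) \<le> C * (LINT x|\<mu>. (f x)\<^sup>2)"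
        by (rule heat_L2_bound[OF less_imp_le[OF s]]) (rule that)
      have "(\<lambda>n. L2dist_sq \<mu> (\<lambda>x. (P (t n) f x - f x) / t n) (L f)) \<longlonglongrightarrow> 0"
        by (rule filterlim_compose[OF test_generator[OF f] t0])
      then have "(\<lambda>n. C * (LINT x|\<mu>. (g n x)\<^sup>2)) \<longlonglongrightarrow> 0"
        by (auto simp: L2dist_sq_def g_def intro!: tendsto_mult_right_zero)
      then show ?thesis
        by (rule tendsto_sandwich[OF always_eventually always_eventually tendsto_const, rotated 2])
          (use C gL2 in \<open>auto\<close>)
    qed
    \<comment> \<open>The semigroup law holds outside a null set that depends on the times. Working
      with a sequence of times leaves countably many such sets.\<close>
    have "AE x in \<mu>. \<forall>n. P (s + t n) f x = P s (P (t n) f) x"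
      unfolding AE_all_countable
      by (intro allI heat_semigroup_AE fL2 less_imp_le s tpos)
    then show "AE x in \<mu>. (\<lambda>n. P s (g n) x) \<longlonglongrightarrow> D x - P s (L f) x"
    proof (rule AE_mp, intro AE_I2 impI)
      fix x assume a: "\<forall>n. P (s + t n) f x = P s (P (t n) f) x"
      have "((\<lambda>h. (P (s + h) f x - P s f x) / h) \<longlongrightarrow> D x) (at 0)"
        using D[of x] by (simp add: DERIV_def)
      then have "(\<lambda>n. (P (s + t n) f x - P s f x) / t n) \<longlonglongrightarrow> D x"
        by (rule filterlim_compose) (use t0 in \<open>auto simp: filterlim_at elim: eventually_mono\<close>)
      then show "(\<lambda>n. P s (g n) x) \<longlonglongrightarrow> D x - P s (L f) x"
        unfolding Pg using a by (intro tendsto_diff tendsto_const) simp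
    qed
  qed
  then have "AE x in \<mu>. D x = P s (L f) x" by simp
  from AE_eq_imp_eq[OF cD Cinf_continuous[OF heat_Cinf[OF L_Cinf0[OF f] s]] this]
  show ?thesis using D[of x] by simp
qed

lemma integral_heat_derivative:
  assumes s: "0 < s" and f: "f \<in> Cinf0 A" and g: "g \<in> Cinf0 A"
  shows "((\<lambda>s. LINT x|\<mu>. g x * P s f x) has_real_derivative (LINT x|\<mu>. g x * P s (L f) x)) (at s)"
  by (rule integral_flow_derivative[OF g _ _ heat_equation[OF _ f] s])
    (rule smooth_flow_continuous[OF heat_smooth_flow], rule f L_Cinf0[OF f])+

text \<open>The integral of \<open>g\<close> against \<open>P s f\<close> is differentiated in time
  twice, once as it stands and once with \<open>f\<close> and \<open>g\<close> exchanged. Symmetry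
  of \<open>P s\<close> and of \<open>L\<close> then identifies \<open>P s (L f)\<close> with
  \<open>L (P s f)\<close> against every test function.\<close>

lemma heat_commute:
  assumes s: "0 < s" and f: "f \<in> Cinf0 A"
  shows "L (P s f) x = P s (L f) x"
proof -
  let ?v = "\<lambda>x. P s (L f) x - L (P s f) x"
  note C1 = heat_Cinf[OF L_Cinf0[OF f] s] note C2 = L_Cinf[OF heat_Cinf[OF f s]]
  have "?v x = 0"
  proof (rule test_functions_separate)
    show "continuous_on UNIV ?v" by (intro Cinf_continuous Cinf_diff C1 C2)
    fix g assume g: "g \<in> Cinf0 A"
    have "((\<lambda>s. LINT x|\<mu>. g x * P s f x) has_real_derivative (LINT x|\<mu>. f x * P s (L g) x)) (at s)"
      by (rule has_field_derivative_transform_within_open[OF integral_heat_derivative[OF s g f], of "{0<..}"])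
        (use s heat_symmetric[OF _ g f] in auto)
    then have "(LINT x|\<mu>. g x * P s (L f) x) = (LINT x|\<mu>. f x * P s (L g) x)"
      by (rule DERIV_unique[OF integral_heat_derivative[OF s f g]])
    also have "\<dots> = (LINT x|\<mu>. L g x * P s f x)" by (rule heat_symmetric[OF s L_Cinf0[OF g] f])
    also have "\<dots> = (LINT x|\<mu>. g x * L (P s f) x)"
      using L_symmetric_Cinf[OF g heat_Cinf[OF f s]] by (simp add: mult.commute)
    finally have "(LINT x|\<mu>. g x * P s (L f) x) - (LINT x|\<mu>. g x * L (P s f) x) = 0" by simp
    moreover have "(LINT x|\<mu>. ?v x * g x) = (LINT x|\<mu>. g x * P s (L f) x) - (LINT x|\<mu>. g x * L (P s f) x)"
      using integrable_Cinf0[OF Cinf0_mult_left[OF g C1]] integrable_Cinf0[OF Cinf0_mult_left[OF g C2]]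
      by (simp add: algebra_simps)
    ultimately show "(LINT x|\<mu>. ?v x * g x) = 0" by simp
  qed
  then show ?thesis by simp
qed

text \<open>The mean value theorem compares two positive times \<open>r\<close> < \<open>s\<close>.
  As \<open>r\<close> tends to 0 only convergence in L^2 is available, so the bound is passed to the
  limit inside an integral.\<close>

lemma heat_small_time:
  assumes f: "f \<in> Cinf0 A" and B: "\<And>x. \<bar>L f x\<bar> \<le> B" and s: "0 < s"
  shows "\<bar>P s f x - f x\<bar> \<le> B * s"
proof -
  have B0: "0 \<le> B" using B[of undefined] by linarith
  have inc: "\<bar>P s f x - P r f x\<bar> \<le> B * s" if r: "0 < r" "r < s" for r x
  proof -
    have "\<exists>z. r < z \<and> z < s \<and> P s f x - P r f x = (s - r) * P z (L f) x"
      by (rule MVT2[OF r(2)]) (use heat_equation[OF _ f] r in auto)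
    then obtain z where z: "r < z" "P s f x - P r f x = (s - r) * P z (L f) x" by auto
    have "\<bar>P z (L f) x\<bar> \<le> B" using heat_bounded[OF _ Cinf0_L2[OF L_Cinf0[OF f]] B] z r by simp
    then have "(s - r) * \<bar>P z (L f) x\<bar> \<le> s * B" using r B0 by (intro mult_mono) auto
    then show ?thesis using r z(2) by (simp add: abs_mult mult.commute)
  qed
  \<comment> \<open>The squared excess over the claimed bound. It is dominated by the square of P_r
    f - f for every small \<open>r\<close>, so its integral is 0, and by continuity it vanishes
    identically.\<close>
  define c where "c x = (max 0 (\<bar>P s f x - f x\<bar> - B * s))\<^sup>2" for x
  define t where "t n = inverse (real (Suc n))" for n
  have tpos: "0 < t n" for n by (simp add: t_def)
  have t0: "filterlim t (at_right 0) sequentially" unfolding t_def by (rule seq_at_right_0)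
  have ce: "c x \<le> (P (t n) f x - f x)\<^sup>2" if "t n < s" for n x
  proof -
    have "max 0 (\<bar>P s f x - f x\<bar> - B * s) \<le> \<bar>P (t n) f x - f x\<bar>"
      using inc[OF tpos that, of x] by auto
    from power_mono[OF this, of 2] show ?thesis by (simp add: c_def)
  qed
  have tlim: "t \<longlonglongrightarrow> 0" using t0 by (simp add: filterlim_at)
  have ev: "eventually (\<lambda>n. t n < s) sequentially" using order_tendstoD(2)[OF tlim s] .
  have L2t: "integrable \<mu> (\<lambda>x. (P (t n) f x - f x)\<^sup>2)" for n
    using L2_linear_comb[OF heat_L2[OF less_imp_le[OF tpos] Cinf0_L2[OF f]] Cinf0_L2[OF f], of 1 n "-1"]
    by (simp add: L2_def)
  have cc: "continuous_on UNIV c"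
    unfolding c_def by (intro continuous_intros Cinf_continuous heat_Cinf f s Cinf0_Cinf)
  obtain n0 where n0: "t n0 < s" using ev by (auto simp: eventually_sequentially)
  have ci: "integrable \<mu> c"
    by (rule Bochner_Integration.integrable_bound[OF L2t[of n0] continuous_measurable[OF cc]])
      (use ce[OF n0] in \<open>auto simp: c_def intro!: AE_I2\<close>)
  have "(\<lambda>n. LINT x|\<mu>. (P (t n) f x - f x)\<^sup>2) \<longlonglongrightarrow> 0"
    using filterlim_compose[OF heat_initial[OF Cinf0_L2[OF f]] t0] by (simp add: L2dist_sq_def)
  then have "(LINT x|\<mu>. c x) \<le> 0"
    by (rule tendsto_lowerbound) (use ev in \<open>auto elim!: eventually_mono intro!: integral_mono ci L2t ce\<close>)
  moreover have "0 \<le> (LINT x|\<mu>. c x)" by (rule integral_nonneg_AE) (simp add: c_def)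
  ultimately have "(LINT x|\<mu>. c x) = 0" by simp
  then have "c x = 0" by (intro integral_zero_imp_zero[OF cc ci]) (simp add: c_def)
  then show ?thesis by (simp add: c_def max_def split: if_splits)
qed

lemma heat_cutoff_limit:
  assumes h: "\<And>k. h k \<in> Cinf0 A" "\<And>k x. h k x \<le> h (Suc k) x" "\<And>x. (\<lambda>k. h k x) \<longlonglongrightarrow> 1" and s: "0 < s"
  shows "(\<lambda>k. P s (h k) x) \<longlonglongrightarrow> 1"
proof -
  have mono: "h i x \<le> h j x" if "i \<le> j" for i j x
    using lift_Suc_mono_le[of "\<lambda>k. h k x", OF h(2) that] .
  have le1: "h k x \<le> 1" for k x
    by (rule LIMSEQ_le_const[OF h(3)]) (use mono in blast)
  have "(\<lambda>k. LINT y|\<mu>. p x y s * h k y) \<longlonglongrightarrow> (LINT y|\<mu>. p x y s * 1)"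
  \<comment> \<open>No sign of the cutoffs is assumed: monotonicity bounds them below by
    \<open>h 0\<close> only, which explains the second summand of the majorant.\<close>
  proof (rule integral_dominated_convergence[where w = "\<lambda>y. p x y s * 1 + \<bar>p x y s * h 0 y\<bar>"])
    show "(\<lambda>y. p x y s * h k y) \<in> borel_measurable \<mu>" for k
      by (rule borel_measurable_integrable[OF kernel_L2[OF s Cinf0_L2[OF h(1)]]])
    show "(\<lambda>y. p x y s * 1) \<in> borel_measurable \<mu>" using kernel_measurable[OF s, of x] by simp
    show "integrable \<mu> (\<lambda>y. p x y s * 1 + \<bar>p x y s * h 0 y\<bar>)"
      by (intro Bochner_Integration.integrable_add integrable_abs kernel_L2 Cinf0_L2 h s integrable_mult_left kernel_integrable)
    show "AE y in \<mu>. (\<lambda>k. p x y s * h k y) \<longlonglongrightarrow> p x y s * 1"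
      by (intro AE_I2 tendsto_mult tendsto_const h(3))
    show "AE y in \<mu>. norm (p x y s * h k y) \<le> p x y s * 1 + \<bar>p x y s * h 0 y\<bar>" for k
    proof (rule AE_I2)
      fix y
      have p: "0 < p x y s" by (rule kernel_pos[OF s])
      have "\<bar>h k y\<bar> \<le> 1 + \<bar>h 0 y\<bar>" using le1[of k y] mono[of 0 k y] by linarith
      from mult_left_mono[OF this, of "p x y s"] p
      show "norm (p x y s * h k y) \<le> p x y s * 1 + \<bar>p x y s * h 0 y\<bar>"
        by (simp add: abs_mult algebra_simps)
    qed
  qed
  then show ?thesis by (simp add: P_eq[OF s] kernel_integral[OF s])
qed

end

section \<open>A parabolic comparison principle\<close>

lemma flat_deriv: "(flat has_real_derivative flat_pow 2 r) (at r)"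
  using flat_pow_has_derivative[of 0 r] by (simp add: numeral_2_eq_2)

lemma flat_deriv2: "(flat_pow 2 has_real_derivative flat_pow 4 r - 2 * flat_pow 3 r) (at r)"
  using flat_pow_has_derivative[of 2 r] by (simp add: numeral_eq_Suc)

text \<open>Lets \<open>flat\<close> stand in for the positive part: bounds for the positive part of
  a function carry over to \<open>flat\<close> of it.\<close>

lemma flat_le:
  assumes "r \<le> 1 / 4"
  shows "flat r \<le> max 0 r"
proof (cases "0 < r")
  case True
  have "flat r \<le> 2 * r\<^sup>2" using flat_pow_le[OF True, of 0] by (simp add: numeral_2_eq_2)
  also have "\<dots> = (2 * r) * r" by (simp add: power2_eq_square)
  also have "\<dots> \<le> 1 * r" using assms True by (intro mult_right_mono) auto
  finally show ?thesis by simp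
qed (simp add: flat_pow_nonpos)

text \<open>That is, \<open>flat'\<^sup>2 \<le> 2 flat flat''\<close>, which lets the gradient of the weight control the weighted energy
  of a subsolution.\<close>

lemma flat_quadratic:
  assumes r: "0 < r" "r \<le> 1 / 4"
  shows "0 < flat_pow 4 r - 2 * flat_pow 3 r"
    and "(flat_pow 2 r)\<^sup>2 \<le> 2 * flat r * (flat_pow 4 r - 2 * flat_pow 3 r)"
proof -
  define e where "e = exp (- inverse r)"
  define y where "y = inverse r"
  have y: "4 \<le> y" using r by (simp add: y_def field_simps)
  have e: "0 < e" by (simp add: e_def)
  have f: "flat r = e" "flat_pow 2 r = e * y\<^sup>2" "flat_pow 3 r = e * y ^ 3" "flat_pow 4 r = e * y ^ 4"
    using r by (simp_all add: flat_pow_def e_def y_def)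
  have eq: "flat_pow 4 r - 2 * flat_pow 3 r = e * y ^ 3 * (y - 2)"
    unfolding f by (simp add: algebra_simps power4_eq_xxxx power3_eq_cube)
  show "0 < flat_pow 4 r - 2 * flat_pow 3 r" unfolding eq using e y by (intro mult_pos_pos) auto
  have "e\<^sup>2 * y ^ 3 * y \<le> e\<^sup>2 * y ^ 3 * (2 * (y - 2))" using y by (intro mult_left_mono mult_nonneg_nonneg) auto
  then show "(flat_pow 2 r)\<^sup>2 \<le> 2 * flat r * (flat_pow 4 r - 2 * flat_pow 3 r)"
    unfolding eq f by (simp add: power2_eq_square power3_eq_cube power4_eq_xxxx algebra_simps)
qed

context symmetric_diffusion
begin

text \<open>Integrating L(flat(w)) by parts against h^2 leaves a cross term in \<Gamma>(h, w). The
  term with the second derivative of \<open>flat\<close> and \<Gamma>(w) has the good sign and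
  absorbs it, so only \<Gamma>(h) flat(w) survives.\<close>

lemma energy_estimate:
  assumes h: "h \<in> Cinf0 A" and w: "w \<in> Cinf A" "\<And>x. w x \<le> 1 / 4"
  shows "(LINT x|\<mu>. (h x)\<^sup>2 * (flat_pow 2 (w x) * L w x)) \<le> (LINT x|\<mu>. 2 * (Gam L h h x * flat (w x)))"
proof -
  note hC = Cinf0_Cinf[OF h]
  have fp: "(\<lambda>x. flat_pow n (w x)) \<in> Cinf A" for n
    by (rule Cinf_compose[OF w(1) smooth_on_flat_pow]) auto
  have h2: "(\<lambda>x. (h x)\<^sup>2) \<in> Cinf0 A" using Cinf0_mult_left[OF h hC] by (simp add: power2_eq_square)
  define \<psi>2 where "\<psi>2 r = flat_pow 4 r - 2 * flat_pow 3 r" for r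
  have \<psi>2C: "(\<lambda>x. \<psi>2 (w x)) \<in> Cinf A"
    unfolding \<psi>2_def by (intro Cinf_diff Cinf_cmult fp)
  have Lf: "L (\<lambda>x. flat (w x)) x = flat_pow 2 (w x) * L w x + \<psi>2 (w x) * Gam L w w x" for x
    unfolding \<psi>2_def
    by (rule L_compose[OF w(1) open_UNIV _ smooth_on_flat_pow flat_deriv flat_deriv2]) auto
  have Gh2: "Gam L (\<lambda>x. (h x)\<^sup>2) (\<lambda>x. flat (w x)) x = 2 * h x * flat_pow 2 (w x) * Gam L h w x" for x
  proof -
    have "Gam L (\<lambda>x. (h x)\<^sup>2) (\<lambda>x. flat (w x)) x = 2 * h x * Gam L h (\<lambda>x. flat (w x)) x"
      by (rule form_compose[OF first_order_form_Gam hC fp Cinf0_Cinf[OF h2]])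
        (auto intro!: derivative_eq_intros)
    also have "Gam L h (\<lambda>x. flat (w x)) x = flat_pow 2 (w x) * Gam L w h x"
      unfolding Gam_sym[of h] by (rule form_compose[OF first_order_form_Gam w(1) hC fp flat_deriv])
    finally show ?thesis by (simp add: Gam_sym[of w h])
  qed
  let ?a = "\<lambda>x. (h x)\<^sup>2 * L (\<lambda>x. flat (w x)) x"
  let ?b = "\<lambda>x. (h x)\<^sup>2 * (\<psi>2 (w x) * Gam L w w x)"
  have ia: "integrable \<mu> ?a" by (intro integrable_Cinf0 Cinf0_mult_left h2 L_Cinf fp)
  have ib: "integrable \<mu> ?b" by (intro integrable_Cinf0 Cinf0_mult_left h2 Cinf_mult \<psi>2C Gam_Cinf w)
  have supp: "Gam L h g x = 0" if "g \<in> Cinf A" "x \<notin> closure {x. h x \<noteq> 0}" for g x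
    by (rule Gam_zero_outside[OF hC that])
  let ?c = "\<lambda>x. 2 * h x * flat_pow 2 (w x) * Gam L h w x"
  have cc: "continuous_on UNIV ?c"
    by (intro continuous_intros Cinf_continuous hC fp Gam_Cinf w)
  have ic: "integrable \<mu> ?c"
    by (rule integrable_compact_support(1)[OF cc Cinf0_compact[OF h]]) (drule not_in_closure_zero, simp)
  have cd: "continuous_on UNIV (\<lambda>x. 2 * (Gam L h h x * flat (w x)))"
    by (intro continuous_intros Cinf_continuous hC fp Gam_Cinf)
  have id: "integrable \<mu> (\<lambda>x. 2 * (Gam L h h x * flat (w x)))"
    by (rule integrable_compact_support(1)[OF cd Cinf0_compact[OF h]]) (simp add: supp hC)
  have "(LINT x|\<mu>. (h x)\<^sup>2 * (flat_pow 2 (w x) * L w x)) = (LINT x|\<mu>. ?a x - ?b x)"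
    by (rule Bochner_Integration.integral_cong[OF refl]) (simp add: Lf algebra_simps)
  also have "\<dots> = - (LINT x|\<mu>. ?c x) - (LINT x|\<mu>. ?b x)"
    using ia ib integration_by_parts[OF h2 fp] by (simp add: Gh2)
  also have "\<dots> = (LINT x|\<mu>. - ?c x - ?b x)" using ib ic by simp
  also have "\<dots> \<le> (LINT x|\<mu>. 2 * (Gam L h h x * flat (w x)))"
  proof (rule integral_mono)
    show "integrable \<mu> (\<lambda>x. - ?c x - ?b x)" using ib ic by simp
    show "integrable \<mu> (\<lambda>x. 2 * (Gam L h h x * flat (w x)))" by (rule id)
    fix x
    show "- ?c x - ?b x \<le> 2 * (Gam L h h x * flat (w x))"
    proof (cases "0 < w x")
      case False
      then show ?thesis by (simp add: flat_pow_nonpos \<psi>2_def)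
    next
      case True
      note q = flat_quadratic[OF True w(2), folded \<psi>2_def]
      let ?G = "Gam L h h x"
      \<comment> \<open>The weights are flat'(w) and h flat''(w), so that everything except flat'^2
        \<Gamma>(h) becomes a multiple of flat''(w). As flat''(w) is positive it can be divided out
        at the end.\<close>
      have "0 \<le> (flat_pow 2 (w x))\<^sup>2 * ?G + 2 * flat_pow 2 (w x) * (h x * \<psi>2 (w x)) * Gam L h w x
          + (h x * \<psi>2 (w x))\<^sup>2 * Gam L w w x"
        by (rule Gam_quadratic_nonneg[OF hC w(1)])
      also have "\<dots> = (flat_pow 2 (w x))\<^sup>2 * ?G - \<psi>2 (w x) * (- ?c x - ?b x)"
        by (simp add: power2_eq_square algebra_simps)
      finally have "\<psi>2 (w x) * (- ?c x - ?b x) \<le> (flat_pow 2 (w x))\<^sup>2 * ?G" by simp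
      also have "\<dots> \<le> (2 * flat (w x) * \<psi>2 (w x)) * ?G"
        using q(2) Gam_nonneg[OF hC, of x] by (rule mult_right_mono)
      also have "\<dots> = \<psi>2 (w x) * (2 * (?G * flat (w x)))" by (simp add: mult_ac)
      finally show ?thesis using q(1) by simp
    qed
  qed
  finally show ?thesis .
qed

end

context conservative_heat
begin

text \<open>The hypothesis \<open>bound\<close> serves twice: it gives an upper bound
  \<open>C\<close> up to time \<open>T\<close>, and it makes the positive part of \<open>u\<close>
  vanish at time 0. The order of limits matters: \<open>k\<close> stays fixed while the weight index
  \<open>j\<close> tends to infinity, because the majorant, the absolute value of
  \<open>P s (h k)\<close>, has its integral bounded by a constant that depends on
  \<open>k\<close>.\<close>

lemma parabolic_comparison:
  fixes u u' :: "real \<Rightarrow> 'm \<Rightarrow> real"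
  assumes h: "\<And>k. h k \<in> Cinf0 A" "\<And>k x. h k x \<le> h (Suc k) x" "\<And>x. (\<lambda>k. h k x) \<longlonglongrightarrow> 1"
    and h_grad: "\<And>e. 0 < e \<Longrightarrow> \<forall>\<^sub>F k in sequentially. \<forall>x. Gam L (h k) (h k) x \<le> e"
    and uC: "\<And>s. 0 < s \<Longrightarrow> u s \<in> Cinf A"
    and du: "\<And>s x. 0 < s \<Longrightarrow> ((\<lambda>s. u s x) has_real_derivative u' s x) (at s)"
    and cu: "continuous_on ({0<..} \<times> UNIV) (\<lambda>(s, x). u s x)" "continuous_on ({0<..} \<times> UNIV) (\<lambda>(s, x). u' s x)"
    and sub: "\<And>s x. 0 < s \<Longrightarrow> s \<le> T \<Longrightarrow> u' s x \<le> L (u s) x"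
    and bound: "\<And>s x. 0 < s \<Longrightarrow> s \<le> T \<Longrightarrow> u s x \<le> M * s"
    and T: "0 < T"
  shows "u T x \<le> 0"
proof -
  define C where "C = max 1 (\<bar>M\<bar> * T)"
  have C: "1 \<le> C" by (simp add: C_def)
  have uC': "u s x \<le> C" if "0 < s" "s \<le> T" for s x
  proof -
    have "u s x \<le> M * s" by (rule bound[OF that])
    also have "\<dots> \<le> \<bar>M\<bar> * T" using that by (intro mult_mono) auto
    finally show ?thesis by (simp add: C_def)
  qed
  have mono: "h i x \<le> h j x" if "i \<le> j" for i j x
    using lift_Suc_mono_le[of "\<lambda>k. h k x", OF h(2) that] .
  have le1: "h k x \<le> 1" for k x
    by (rule LIMSEQ_le_const[OF h(3)]) (use mono in blast)
  have key: "u T x \<le> C * (1 - P T (h k) x)" for k x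
  proof -
    note hk = h(1)[of k]
    obtain B where B: "0 \<le> B" "\<And>x. \<bar>L (h k) x\<bar> \<le> B" by (rule Cinf0_bounded[OF L_Cinf0[OF hk]]) (rule that)
    define N where "N = (LINT x|\<mu>. \<bar>h k x\<bar>)"
    have N: "0 \<le> N" unfolding N_def by (rule integral_nonneg_AE) simp
    \<comment> \<open>The subtracted function also solves the heat equation, so \<open>w\<close> is
      a subsolution. Since \<open>u\<close> is at most \<open>C\<close>, division by 4 C gives w
      \<le> P_s h_k / 4 \<le> 1/4, the range in which \<open>energy_estimate\<close>
      applies.\<close>
    define w where "w s x = inverse (4 * C) * (u s x - C * (1 - P s (h k) x))" for s x
    define w' where "w' s x = inverse (4 * C) * (u' s x + C * P s (L (h k)) x)" for s x
    have Ph1: "P s (h k) x \<le> 1" if s: "0 < s" for s x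
    proof -
      have "P s (h k) x \<le> (LINT y|\<mu>. p x y s)"
        unfolding P_eq[OF s]
        by (rule integral_mono[OF kernel_L2[OF s Cinf0_L2[OF hk]] kernel_integrable[OF s]])
          (use le1 kernel_pos[OF s] in \<open>simp add: mult_left_le less_imp_le\<close>)
      then show ?thesis by (simp add: kernel_integral[OF s])
    qed
    have w_le: "w s x \<le> 1 / 4" and w_le': "max 0 (w s x) \<le> \<bar>P s (h k) x\<bar>" if s: "0 < s" "s \<le> T" for s x
    proof -
      have "u s x - C * (1 - P s (h k) x) \<le> C * P s (h k) x" using uC'[OF s, of x] by (simp add: algebra_simps)
      then have "w s x \<le> inverse (4 * C) * (C * P s (h k) x)"
        unfolding w_def using C by (intro mult_left_mono) auto
      then have le: "w s x \<le> P s (h k) x / 4" using C by (simp add: field_simps)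
      then show "w s x \<le> 1 / 4" using Ph1[OF s(1), of x] by linarith
      show "max 0 (w s x) \<le> \<bar>P s (h k) x\<bar>" using le by linarith
    qed
    \<comment> \<open>At time 0 the subtracted function would be C (1 - h_k), which is nonnegative
      as \<open>h k\<close> is at most 1; \<open>heat_small_time\<close> limits the loss at time
      \<open>s\<close> to C B s.\<close>
    have w_small: "max 0 (w s x) \<le> (\<bar>M\<bar> + C * B) * s" if s: "0 < s" "s \<le> T" for s x
    proof -
      have "h k x - B * s \<le> P s (h k) x \<and> P s (h k) x \<le> h k x + B * s"
        using heat_small_time[OF hk B(2) s(1), of x] by linarith
      then have "P s (h k) x - 1 \<le> B * s" using le1[of k x] by linarith
      then have "C * (P s (h k) x - 1) \<le> C * (B * s)" using C by (intro mult_left_mono) auto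
      moreover have "u s x \<le> \<bar>M\<bar> * s"
        using bound[OF s, of x] s(1) by (intro order_trans[OF bound[OF s]] mult_right_mono) auto
      ultimately have "u s x - C * (1 - P s (h k) x) \<le> (\<bar>M\<bar> + C * B) * s" by (simp add: algebra_simps)
      then have "w s x \<le> inverse (4 * C) * ((\<bar>M\<bar> + C * B) * s)"
        unfolding w_def using C by (intro mult_left_mono) auto
      also have "\<dots> \<le> 1 * ((\<bar>M\<bar> + C * B) * s)"
        using C B(1) s(1) by (intro mult_right_mono) (auto simp: field_simps)
      finally show ?thesis using C B(1) s(1) by simp
    qed
    have wC: "w s \<in> Cinf A" if "0 < s" for s
      unfolding w_def by (intro Cinf_cmult Cinf_diff Cinf_const uC heat_Cinf hk that)
    have Lw: "w' s x \<le> L (w s) x" if s: "0 < s" "s \<le> T" for s x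
    proof -
      note PC = heat_Cinf[OF hk s(1)]
      have e: "w s = (\<lambda>x. inverse (4 * C) * u s x + inverse (4 * C) * ((- C) * 1 + C * P s (h k) x))"
        by (rule ext) (simp add: w_def algebra_simps)
      have "L (w s) x = inverse (4 * C) * (L (u s) x + C * P s (L (h k)) x)"
        unfolding e L_linear[OF uC[OF s(1)] Cinf_add[OF Cinf_cmult[OF Cinf_const] Cinf_cmult[OF PC]]]
          L_linear[OF Cinf_const PC] L_const heat_commute[OF s(1) hk] by (simp add: algebra_simps)
      then show ?thesis unfolding w'_def using sub[OF s, of x] C by simp
    qed
    have dw: "((\<lambda>s. w s x) has_real_derivative w' s x) (at s)" if "0 < s" for s x
      unfolding w_def w'_def
      by (rule derivative_eq_intros du heat_equation[OF _ hk] that refl | simp add: that)+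
    have cP: "continuous_on ({0<..} \<times> UNIV) (\<lambda>w. P (fst w) g (snd w))" if "g \<in> Cinf0 A" for g
      using smooth_flow_continuous[OF heat_smooth_flow[OF that]] by (simp add: case_prod_beta')
    have cu2: "continuous_on ({0<..} \<times> UNIV) (\<lambda>w. u (fst w) (snd w))"
      "continuous_on ({0<..} \<times> UNIV) (\<lambda>w. u' (fst w) (snd w))"
      using cu by (simp_all add: case_prod_beta')
    have cw: "continuous_on ({0<..} \<times> UNIV) (\<lambda>z. w (fst z) (snd z))"
      unfolding w_def by (intro continuous_intros cu2 cP hk)
    have cw': "continuous_on ({0<..} \<times> UNIV) (\<lambda>z. w' (fst z) (snd z))"
      unfolding w'_def by (intro continuous_intros cu2 cP L_Cinf0 hk)
    have cfl: "continuous_on ({0<..} \<times> UNIV) (\<lambda>z. flat_pow n (w (fst z) (snd z)))" for n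
      by (rule continuous_on_compose2[OF smooth_on_continuous[OF smooth_on_flat_pow] cw]) simp
    \<comment> \<open>A localized energy. The weight makes every integral finite, and its time
      derivative is small with \<Gamma>(h_j), uniformly in time.\<close>
    define E where "E j s = (LINT x|\<mu>. (h j x)\<^sup>2 * flat (w s x))" for j s
    have h2: "(\<lambda>x. (h j x)\<^sup>2) \<in> Cinf0 A" for j
      using Cinf0_mult_left[OF h(1) Cinf0_Cinf[OF h(1)]] by (simp add: power2_eq_square)
    have dE: "(E j has_real_derivative (LINT x|\<mu>. (h j x)\<^sup>2 * (flat_pow 2 (w s x) * w' s x))) (at s)"
      if s: "0 < s" for j s
      unfolding E_def
    proof (rule integral_flow_derivative[OF h2 _ _ _ s])
      show "continuous_on ({0<..} \<times> UNIV) (\<lambda>(s, x). flat (w s x))"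
        using cfl by (simp add: case_prod_beta')
      show "continuous_on ({0<..} \<times> UNIV) (\<lambda>(s, x). flat_pow 2 (w s x) * w' s x)"
        using continuous_on_mult[OF cfl cw'] by (simp add: case_prod_beta')
      show "((\<lambda>s. flat (w s x)) has_real_derivative flat_pow 2 (w s x) * w' s x) (at s)" if "0 < s" for s x
        by (rule DERIV_chain2[OF flat_deriv dw[OF that]])
    qed
    have cslice: "continuous_on UNIV (w' s)" if "0 < s" for s
      using continuous_on_compose2[OF cw', of UNIV "\<lambda>x. (s, x)"] that by (auto simp: continuous_intros)
    have fpC: "(\<lambda>x. flat_pow n (w s x)) \<in> Cinf A" if "0 < s" for n s
      by (rule Cinf_compose[OF wC[OF that] smooth_on_flat_pow]) auto
    have dE_le: "(LINT x|\<mu>. (h j x)\<^sup>2 * (flat_pow 2 (w s x) * w' s x)) \<le> 2 * e * N"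
      if e: "\<forall>x. Gam L (h j) (h j) x \<le> e" "0 \<le> e" and s: "0 < s" "s \<le> T" for j e s
    proof -
      have c1: "continuous_on UNIV (\<lambda>x. (h j x)\<^sup>2 * (flat_pow 2 (w s x) * w' s x))"
        by (intro continuous_on_mult Cinf_continuous[OF Cinf0_Cinf[OF h2]] Cinf_continuous[OF fpC] cslice s)
      have c2: "continuous_on UNIV (\<lambda>x. 2 * (Gam L (h j) (h j) x * flat (w s x)))"
        by (intro continuous_intros Cinf_continuous fpC Gam_Cinf Cinf0_Cinf h(1) s)
      have "(LINT x|\<mu>. (h j x)\<^sup>2 * (flat_pow 2 (w s x) * w' s x))
          \<le> (LINT x|\<mu>. (h j x)\<^sup>2 * (flat_pow 2 (w s x) * L (w s) x))"
      proof (rule integral_mono)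
        show "integrable \<mu> (\<lambda>x. (h j x)\<^sup>2 * (flat_pow 2 (w s x) * w' s x))"
          by (rule integrable_compact_support(1)[OF c1 Cinf0_compact[OF h(1)[of j]]]) (drule not_in_closure_zero, simp)
        show "integrable \<mu> (\<lambda>x. (h j x)\<^sup>2 * (flat_pow 2 (w s x) * L (w s) x))"
          by (intro integrable_Cinf0 Cinf0_mult_left h2 Cinf_mult fpC L_Cinf wC s)
        show "(h j x)\<^sup>2 * (flat_pow 2 (w s x) * w' s x) \<le> (h j x)\<^sup>2 * (flat_pow 2 (w s x) * L (w s) x)" for x
          by (intro mult_left_mono Lw s flat_pow_nonneg) simp
      qed
      also have "\<dots> \<le> (LINT x|\<mu>. 2 * (Gam L (h j) (h j) x * flat (w s x)))"
        by (rule energy_estimate[OF h(1) wC[OF s(1)] w_le[OF s]])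
      also have "\<dots> \<le> (LINT x|\<mu>. 2 * e * \<bar>P s (h k) x\<bar>)"
      proof (rule integral_mono)
        show "integrable \<mu> (\<lambda>x. 2 * (Gam L (h j) (h j) x * flat (w s x)))"
          by (rule integrable_compact_support(1)[OF c2 Cinf0_compact[OF h(1)[of j]]])
            (simp add: Gam_zero_outside Cinf0_Cinf h(1))
        show "integrable \<mu> (\<lambda>x. 2 * e * \<bar>P s (h k) x\<bar>)"
          by (intro integrable_mult_right integrable_abs heat_L1(1) s hk)
        fix x
        have "Gam L (h j) (h j) x * flat (w s x) \<le> e * \<bar>P s (h k) x\<bar>"
          using e order_trans[OF flat_le[OF w_le[OF s]] w_le'[OF s], of x]
          by (intro mult_mono) (auto simp: flat_pow_nonneg)
        then show "2 * (Gam L (h j) (h j) x * flat (w s x)) \<le> 2 * e * \<bar>P s (h k) x\<bar>" by simp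
      qed
      also have "\<dots> = 2 * e * (LINT x|\<mu>. \<bar>P s (h k) x\<bar>)" by simp
      also have "\<dots> \<le> 2 * e * N"
        unfolding N_def using e(2) by (intro mult_left_mono heat_L1(2) s hk) simp
      finally show ?thesis .
    qed
    have E_T: "E j T \<le> 2 * e * N * T" if e: "\<forall>x. Gam L (h j) (h j) x \<le> e" "0 \<le> e" for j e
    proof -
      define H where "H = (LINT x|\<mu>. (h j x)\<^sup>2)"
      \<comment> \<open>This constant depends on \<open>j\<close>. That is harmless, since the
        initial time \<open>r\<close> tends to 0 while \<open>j\<close> is fixed.\<close>
      define K where "K = (\<bar>M\<bar> + C * B) * H"
      have E_r: "E j r \<le> K * r" if r: "0 < r" "r \<le> T" for r
      proof -
        have "E j r \<le> (LINT x|\<mu>. (h j x)\<^sup>2 * ((\<bar>M\<bar> + C * B) * r))"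
          unfolding E_def
        proof (rule integral_mono)
          show "integrable \<mu> (\<lambda>x. (h j x)\<^sup>2 * flat (w r x))"
            by (intro integrable_Cinf0 Cinf0_mult_left h2 fpC r)
          show "integrable \<mu> (\<lambda>x. (h j x)\<^sup>2 * ((\<bar>M\<bar> + C * B) * r))"
            by (intro integrable_mult_left integrable_Cinf0 h2)
          show "(h j x)\<^sup>2 * flat (w r x) \<le> (h j x)\<^sup>2 * ((\<bar>M\<bar> + C * B) * r)" for x
            using order_trans[OF flat_le[OF w_le[OF r]] w_small[OF r]] by (intro mult_left_mono) auto
        qed
        also have "\<dots> = K * r" by (simp add: K_def H_def mult_ac)
        finally show ?thesis .
      qed
      have step: "E j T \<le> K * r + 2 * e * N * T" if r: "0 < r" "r < T" for r
      proof -
        have "\<exists>z. r < z \<and> z < T \<and> E j T - E j r = (T - r) * (LINT x|\<mu>. (h j x)\<^sup>2 * (flat_pow 2 (w z x) * w' z x))"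
          by (rule MVT2[OF r(2)]) (use dE r(1) in auto)
        then obtain z where z: "r < z" "z < T"
          "E j T - E j r = (T - r) * (LINT x|\<mu>. (h j x)\<^sup>2 * (flat_pow 2 (w z x) * w' z x))" by auto
        have "E j T - E j r \<le> (T - r) * (2 * e * N)"
          unfolding z(3) using dE_le[OF e, of z] z r by (intro mult_left_mono) auto
        also have "\<dots> \<le> T * (2 * e * N)" using r e(2) N by (intro mult_right_mono) auto
        finally show ?thesis using E_r[of r] r by (simp add: mult_ac)
      qed
      have "((\<lambda>r. K * r + 2 * e * N * T) \<longlongrightarrow> K * 0 + 2 * e * N * T) (at_right 0)"
        by (intro tendsto_intros)
      moreover have "\<forall>\<^sub>F r in at_right 0. E j T \<le> K * r + 2 * e * N * T"
        using T step by (auto simp: eventually_at_right[OF T])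
      ultimately have "E j T \<le> K * 0 + 2 * e * N * T" by (rule tendsto_lowerbound) simp
      then show ?thesis by simp
    qed
    have "\<forall>\<^sub>F j in sequentially. 1 / 2 < h j x" using order_tendstoD(1)[OF h(3), of "1 / 2" x] by simp
    \<comment> \<open>A fixed weight that is positive at the given \<open>x\<close>; the energies
      with larger index \<open>j\<close> dominate the integral formed with it.\<close>
    then obtain i where i: "1 / 2 < h i x" by (auto simp: eventually_sequentially)
    \<comment> \<open>Only the positive part of \<open>h i\<close> is kept: from h_i \<le> h_j alone
      the squares cannot be compared where \<open>h i\<close> is negative.\<close>
    define c where "c y = (max 0 (h i y))\<^sup>2 * flat (w T y)" for y
    have cc: "continuous_on UNIV c"
      unfolding c_def by (intro continuous_intros Cinf_continuous Cinf0_Cinf h(1) fpC T)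
    have ci: "integrable \<mu> c"
      by (rule integrable_compact_support(1)[OF cc Cinf0_compact[OF h(1)[of i]]]) (drule not_in_closure_zero, simp add: c_def)
    have c0: "0 \<le> c y" for y by (simp add: c_def flat_pow_nonneg)
    have c_le: "(LINT y|\<mu>. c y) \<le> 2 * e * N * T" if e: "0 < e" for e
    proof -
      obtain j0 where j0: "\<And>j. j0 \<le> j \<Longrightarrow> \<forall>x. Gam L (h j) (h j) x \<le> e"
        using h_grad[OF e] unfolding eventually_sequentially by blast
      define j where "j = max i j0"
      have "(LINT y|\<mu>. c y) \<le> E j T"
        unfolding E_def
      proof (rule integral_mono[OF ci])
        show "integrable \<mu> (\<lambda>x. (h j x)\<^sup>2 * flat (w T x))"
          by (intro integrable_Cinf0 Cinf0_mult_left h2 fpC T)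
        fix y
        have "(max 0 (h i y))\<^sup>2 \<le> (h j y)\<^sup>2"
          using mono[of i j y] by (auto simp: max_def j_def intro!: power_mono)
        then show "c y \<le> (h j y)\<^sup>2 * flat (w T y)"
          unfolding c_def by (intro mult_right_mono flat_pow_nonneg)
      qed
      also have "\<dots> \<le> 2 * e * N * T" using j0[of j] e by (intro E_T) (auto simp: j_def)
      finally show ?thesis .
    qed
    have "(LINT y|\<mu>. c y) \<le> 0"
    proof (rule ccontr)
      assume "\<not> ?thesis"
      then have I: "0 < (LINT y|\<mu>. c y)" by simp
      \<comment> \<open>With this \<open>e\<close> the integral equals 4 e N T + 4 e T, which
        exceeds the bound 2 e N T; the 1 added to \<open>N\<close> covers the case N = 0.\<close>
      define e where "e = (LINT y|\<mu>. c y) / (4 * (N + 1) * T)"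
      have e: "0 < e" using I N T by (simp add: e_def)
      have "4 * (N + 1) * T \<noteq> 0" using N T by simp
      then have "(LINT y|\<mu>. c y) = e * (4 * (N + 1) * T)" by (simp add: e_def)
      also have "\<dots> = 4 * (e * N * T) + 4 * (e * T)" by (simp add: algebra_simps)
      finally have "(LINT y|\<mu>. c y) = 4 * (e * N * T) + 4 * (e * T)" .
      moreover have "0 \<le> e * N * T" "0 < e * T" using e N T by simp_all
      ultimately show False using c_le[OF e] by simp
    qed
    moreover have "0 \<le> (LINT y|\<mu>. c y)" by (rule integral_nonneg_AE) (simp add: c0)
    ultimately have "c x = 0" by (intro integral_zero_imp_zero[OF cc ci c0]) simp
    then have "flat (w T x) = 0" using i by (simp add: c_def)
    then have "\<not> 0 < w T x" using flat_pow_pos[of "w T x" 0] by auto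
    then have "inverse (4 * C) * (u T x - C * (1 - P T (h k) x)) \<le> 0" by (simp add: w_def)
    then show ?thesis using C by (simp add: mult_le_0_iff)
  qed
  have "(\<lambda>k. C * (1 - P T (h k) x)) \<longlonglongrightarrow> C * (1 - 1)"
    by (intro tendsto_intros heat_cutoff_limit[OF h T])
  then show ?thesis using LIMSEQ_le_const[of _ _ "u T x"] key by simp
qed

end

section \<open>The Bochner formula\<close>

context smooth_manifold
begin

lemma ln_Cinf: "F \<in> Cinf A \<Longrightarrow> (\<And>x. 0 < F x) \<Longrightarrow> (\<lambda>y. ln (F y)) \<in> Cinf A"
  by (rule Cinf_compose[OF _ smooth_on_ln]) auto

lemma inverse_Cinf: "F \<in> Cinf A \<Longrightarrow> (\<And>x. 0 < F x) \<Longrightarrow> (\<lambda>y. inverse (F y)) \<in> Cinf A"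
  by (rule Cinf_compose[OF _ smooth_on_inverse]) auto

lemma form_sym: "first_order_form A Q \<Longrightarrow> f \<in> Cinf A \<Longrightarrow> g \<in> Cinf A \<Longrightarrow> Q f g = Q g f"
  unfolding first_order_form_def by blast

lemma form_Cinf: "first_order_form A Q \<Longrightarrow> f \<in> Cinf A \<Longrightarrow> g \<in> Cinf A \<Longrightarrow> Q f g \<in> Cinf A"
  unfolding first_order_form_def by blast

lemma form_linear:
  assumes "first_order_form A Q" "f \<in> Cinf A" "g \<in> Cinf A" "v \<in> Cinf A"
  shows "Q (\<lambda>y. a * f y + b * g y) v x = a * Q f v x + b * Q g v x"
  using assms unfolding first_order_form_def by auto

lemma form_leibniz:
  assumes "first_order_form A Q" "f \<in> Cinf A" "g \<in> Cinf A" "v \<in> Cinf A"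
  shows "Q (\<lambda>y. f y * g y) v x = f x * Q g v x + g x * Q f v x"
  using assms unfolding first_order_form_def by auto

lemma form_ln:
  assumes Q: "first_order_form A Q" and F: "F \<in> Cinf A" "\<And>x. 0 < F x" and v: "v \<in> Cinf A"
  shows "Q (\<lambda>y. ln (F y)) v x = Q F v x / F x"
  using form_compose[OF Q F(1) v ln_Cinf[OF F], of "inverse (F x)" x] F(2)[of x]
  by (simp add: DERIV_ln divide_inverse mult.commute)

lemma form_ln_ln:
  assumes Q: "first_order_form A Q" and F: "F \<in> Cinf A" "\<And>x. 0 < F x"
  shows "Q (\<lambda>y. ln (F y)) (\<lambda>y. ln (F y)) x = Q F F x / (F x)\<^sup>2"
  using form_ln[OF Q F ln_Cinf[OF F], of x] form_ln[OF Q F F(1), of x]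
    form_sym[OF Q F(1) ln_Cinf[OF F]] by (simp add: power2_eq_square)

lemma form_add_const:
  assumes Q: "first_order_form A Q" and f: "f \<in> Cinf A"
  shows "Q (\<lambda>y. f y + a) (\<lambda>y. f y + a) x = Q f f x"
proof -
  have C: "(\<lambda>y. f y + a) \<in> Cinf A" by (rule Cinf_add[OF f Cinf_const])
  have d: "((\<lambda>r. r + a) has_real_derivative 1) (at (f x))" for x by (auto intro!: derivative_eq_intros)
  have 1: "Q (\<lambda>y. f y + a) v x = Q f v x" if "v \<in> Cinf A" for v
    using form_compose[OF Q f that C d] by simp
  show ?thesis unfolding 1[OF C] form_sym[OF Q f C] by (rule 1[OF f])
qed

end

context diffusion_operator
begin

lemma L_ln:
  assumes F: "F \<in> Cinf A" "\<And>x. 0 < F x"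
  shows "L (\<lambda>y. ln (F y)) x = L F x / F x - Gam L (\<lambda>y. ln (F y)) (\<lambda>y. ln (F y)) x"
proof -
  have "L (\<lambda>y. ln (F y)) x = inverse (F x) * L F x + (- (inverse (F x))\<^sup>2) * Gam L F F x"
    by (rule L_compose[OF F(1) open_greaterThan[of 0]])
      (auto intro!: derivative_eq_intros smooth_on_ln F(2) simp: inverse_eq_divide power2_eq_square)
  then show ?thesis
    unfolding form_ln_ln[OF first_order_form_Gam F] by (simp add: divide_inverse mult.commute power_inverse)
qed

text \<open>If \<open>\<partial>\<^sub>t F = L F\<close>, the subtracted term is the time derivative of
  \<open>F Q(ln F, ln F) = Q(F, F) / F\<close>.\<close>

lemma bochner:
  assumes Q: "first_order_form A Q" and F: "F \<in> Cinf A" "\<And>x. 0 < F x"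
    and g: "g = (\<lambda>y. ln (F y))" and com: "Gam L g (Q g g) x = Q g (Gam L g g) x"
  shows "L (\<lambda>y. F y * Q g g y) x - (2 * Q F (L F) x / F x - Q F F x * L F x / (F x)\<^sup>2)
    = F x * (L (Q g g) x - 2 * Q g (L g) x)"
proof -
  note G = first_order_form_Gam
  have gC: "g \<in> Cinf A" unfolding g by (rule ln_Cinf[OF F])
  have iC: "(\<lambda>y. inverse (F y)) \<in> Cinf A" by (rule inverse_Cinf[OF F])
  note LF = L_Cinf[OF F(1)] note QC = form_Cinf[OF Q gC gC] note GC = Gam_Cinf[OF gC gC]
  have QF: "Q g v x = Q F v x / F x" if "v \<in> Cinf A" for v unfolding g by (rule form_ln[OF Q F that])
  have Qgg: "Q g g x = Q F F x / (F x)\<^sup>2" unfolding g by (rule form_ln_ln[OF Q F])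
  \<comment> \<open>The only use of the commutation hypothesis. It replaces \<Gamma>(g, Q(g)) by
    Q(g, \<Gamma>(g)), the term that also arises when Lg = LF/F - \<Gamma>(g) is inserted in Q(g,
    Lg).\<close>
  have 1: "Gam L F (Q g g) x = F x * Q g (Gam L g g) x"
    using form_ln[OF G F QC, of x] com F(2)[of x] by (simp add: g[symmetric])
  have Lg: "L g = (\<lambda>y. 1 * (L F y * inverse (F y)) + (- 1) * Gam L g g y)"
    unfolding g by (rule ext) (simp add: L_ln[OF F] divide_inverse)
  have i: "Q (\<lambda>y. inverse (F y)) g x = - Q F g x / (F x)\<^sup>2"
  proof -
    have "(inverse has_real_derivative - (1 / (F x)\<^sup>2)) (at (F x))"
      using F(2)[of x] by (auto intro!: derivative_eq_intros simp: inverse_eq_divide power2_eq_square)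
    from form_compose[OF Q F(1) gC iC this] show ?thesis by simp
  qed
  have "Q g (L g) x = Q (L g) g x" using form_sym[OF Q gC L_Cinf[OF gC]] by simp
  also have "\<dots> = Q (\<lambda>y. L F y * inverse (F y)) g x - Q (Gam L g g) g x"
    unfolding Lg form_linear[OF Q Cinf_mult[OF LF iC] GC gC] by simp
  also have "Q (\<lambda>y. L F y * inverse (F y)) g x = L F x * Q (\<lambda>y. inverse (F y)) g x + inverse (F x) * Q (L F) g x"
    by (rule form_leibniz[OF Q LF iC gC])
  also have "Q (L F) g x = Q F (L F) x / F x" using form_sym[OF Q LF gC] QF[OF LF] by simp
  also have "Q (\<lambda>y. inverse (F y)) g x = - (Q F F x / F x) / (F x)\<^sup>2"
    unfolding i using form_sym[OF Q F(1) gC] QF[OF F(1)] by simp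
  also have "Q (Gam L g g) g x = Q g (Gam L g g) x" using form_sym[OF Q GC gC] by simp
  finally have e: "Q g (L g) x = L F x * (- (Q F F x / F x) / (F x)\<^sup>2) + inverse (F x) * (Q F (L F) x / F x)
      - Q g (Gam L g g) x" .
  show ?thesis
    unfolding L_mult 1 Qgg e using F(2)[of x]
    by (simp add: field_simps power2_eq_square power3_eq_cube)
qed

end

section \<open>The Li-Yau inequality\<close>

text \<open>With \<open>b = s\<^sup>3\<close> and \<open>a = 3 s\<^sup>2 / (2 \<rho>\<^sub>2)\<close> one has \<open>b' = 2 \<rho>\<^sub>2 a\<close>; the number \<open>\<gamma>\<close> is chosen so that the
  coefficient of \<open>G\<close> vanishes, and \<open>\<alpha>' = 4 a \<gamma> / d\<close>, \<open>\<beta>' = - 2 a \<gamma>\<^sup>2 / d\<close>.\<close>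

lemma curvature_dimension_algebra:
  fixes s \<rho>\<^sub>1 \<rho>\<^sub>2 \<kappa> d l G Z \<Gamma>2 Z2 :: real
  assumes pos: "0 < s" "0 < \<rho>\<^sub>2" "0 < d" and D: "D = 1 + 3 * \<kappa> / (2 * \<rho>\<^sub>2)"
    and cd: "1 / d * l\<^sup>2 + (\<rho>\<^sub>1 - \<kappa> / (2 * \<rho>\<^sub>2 * s / 3)) * G + \<rho>\<^sub>2 * Z \<le> \<Gamma>2 + (2 * \<rho>\<^sub>2 * s / 3) * Z2"
  shows "0 \<le> 2 * (3 * s\<^sup>2 / (2 * \<rho>\<^sub>2)) * \<Gamma>2 + 2 * s ^ 3 * Z2 - 3 * s / \<rho>\<^sub>2 * G - 3 * s\<^sup>2 * Z
    - 3 / \<rho>\<^sub>2 * (\<rho>\<^sub>1 * s\<^sup>2 - D * s) * (l + G) + 3 * d / (4 * \<rho>\<^sub>2) * (\<rho>\<^sub>1 * s - D)\<^sup>2"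
proof -
  define a where "a = 3 * s\<^sup>2 / (2 * \<rho>\<^sub>2)"
  define \<gamma> where "\<gamma> = d / 2 * (\<rho>\<^sub>1 - D / s)"
  have a: "0 < a" using pos by (simp add: a_def)
  \<comment> \<open>The claim is an exact identity away from two nonnegative terms: 2 a times the
    slack in the curvature-dimension inequality, and 2 a / d times the square of l -
    \<gamma>.\<close>
  have "0 \<le> 2 * a * (\<Gamma>2 + (2 * \<rho>\<^sub>2 * s / 3) * Z2 - (1 / d * l\<^sup>2 + (\<rho>\<^sub>1 - \<kappa> / (2 * \<rho>\<^sub>2 * s / 3)) * G + \<rho>\<^sub>2 * Z))"
    using cd a by simp
  moreover have "0 \<le> 2 * a / d * (l - \<gamma>)\<^sup>2" using a pos by simp
  moreover have "2 * a * (\<Gamma>2 + (2 * \<rho>\<^sub>2 * s / 3) * Z2 - (1 / d * l\<^sup>2 + (\<rho>\<^sub>1 - \<kappa> / (2 * \<rho>\<^sub>2 * s / 3)) * G + \<rho>\<^sub>2 * Z))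
      + 2 * a / d * (l - \<gamma>)\<^sup>2
    = 2 * (3 * s\<^sup>2 / (2 * \<rho>\<^sub>2)) * \<Gamma>2 + 2 * s ^ 3 * Z2 - 3 * s / \<rho>\<^sub>2 * G - 3 * s\<^sup>2 * Z
    - 3 / \<rho>\<^sub>2 * (\<rho>\<^sub>1 * s\<^sup>2 - D * s) * (l + G) + 3 * d / (4 * \<rho>\<^sub>2) * (\<rho>\<^sub>1 * s - D)\<^sup>2"
    unfolding a_def \<gamma>_def D using pos by (simp add: field_simps power2_eq_square power3_eq_cube)
  ultimately show ?thesis by linarith
qed

text \<open>Applied to the four coefficient polynomials, it supplies the linear bound near time 0
  that the comparison principle asks for.\<close>

lemma vanishing_at_zero_bound:
  fixes c c' :: "real \<Rightarrow> real"
  assumes d: "\<And>s. (c has_real_derivative c' s) (at s)" and cont: "continuous_on UNIV c'" and 0: "c 0 = 0"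
  obtains K where "0 \<le> K" "\<And>s. 0 < s \<Longrightarrow> s \<le> T \<Longrightarrow> \<bar>c s\<bar> \<le> K * s"
proof -
  have "compact (c' ` {0..T})"
    by (intro compact_continuous_image continuous_on_subset[OF cont]) auto
  then obtain K where K: "\<And>s. s \<in> {0..T} \<Longrightarrow> \<bar>c' s\<bar> \<le> K"
    using compact_imp_bounded bounded_iff by (metis imageI real_norm_def)
  have "\<bar>c s\<bar> \<le> \<bar>K\<bar> * s" if s: "0 < s" "s \<le> T" for s
  proof -
    obtain z where z: "0 < z" "z < s" "c s - c 0 = (s - 0) * c' z"
      using MVT2[OF s(1), of c c'] d by blast
    have "\<bar>c' z\<bar> \<le> \<bar>K\<bar>" using K[of z] z s by auto
    then show ?thesis using z(3) s(1) 0 by (simp add: abs_mult mult.commute mult_left_mono)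
  qed
  then show ?thesis using that[of "\<bar>K\<bar>"] by simp
qed

context conservative_heat
begin

text \<open>The inequality u \<le> 0 at time \<open>T\<close> after \<epsilon> has tended to 0, with
  the polynomials written out. Dividing it by the coefficient of \<Gamma> and by
  \<open>P T f x\<close> gives the Li-Yau form.\<close>

lemma heat_li_yau:
  fixes Z :: "('m \<Rightarrow> real) \<Rightarrow> ('m \<Rightarrow> real) \<Rightarrow> 'm \<Rightarrow> real"
  assumes h: "\<And>k. h k \<in> Cinf0 A" "\<And>k x. h k x \<le> h (Suc k) x" "\<And>x. (\<lambda>k. h k x) \<longlonglongrightarrow> 1"
    and h_grad: "\<And>e. 0 < e \<Longrightarrow> \<forall>\<^sub>F k in sequentially. \<forall>x. Gam L (h k) (h k) x \<le> e"
    and Z: "first_order_form A Z"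
    and com: "\<And>g. g \<in> Cinf A \<Longrightarrow> Gam L g (Z g g) = Z g (Gam L g g)"
    and grad: "\<And>s x. 0 < s \<Longrightarrow> s \<le> T \<Longrightarrow> \<bar>Gam L (P s f) (P s f) x\<bar> \<le> M \<and> \<bar>Z (P s f) (P s f) x\<bar> \<le> M"
    and const: "0 < \<rho>\<^sub>2" "0 < d"
    and cd: "\<And>g \<nu> x. g \<in> Cinf A \<Longrightarrow> 0 < \<nu> \<Longrightarrow>
          Gam2 L g x + \<nu> * GamZ2 L Z g x
            \<ge> 1 / d * (L g x)\<^sup>2 + (\<rho>\<^sub>1 - \<kappa> / \<nu>) * Gam L g g x + \<rho>\<^sub>2 * Z g g x"
    and f: "f \<in> Cinf0 A" "\<And>x. 0 \<le> f x" "f x1 \<noteq> 0"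
    and T: "0 < T" and D: "D = 1 + 3 * \<kappa> / (2 * \<rho>\<^sub>2)"
  shows "3 * T\<^sup>2 / (2 * \<rho>\<^sub>2) * (Gam L (P T f) (P T f) x / P T f x) + T ^ 3 * (Z (P T f) (P T f) x / P T f x)
    + 3 / \<rho>\<^sub>2 * (\<rho>\<^sub>1 * T ^ 3 / 3 - D * T\<^sup>2 / 2) * L (P T f) x
    - 3 * d / (4 * \<rho>\<^sub>2) * (\<rho>\<^sub>1\<^sup>2 * T ^ 3 / 3 - \<rho>\<^sub>1 * D * T\<^sup>2 + D\<^sup>2 * T) * P T f x \<le> 0"
proof -
  define a b \<alpha> \<beta> where "a s = 3 * s\<^sup>2 / (2 * \<rho>\<^sub>2)" and "b s = s ^ 3"
    and "\<alpha> s = 3 / \<rho>\<^sub>2 * (\<rho>\<^sub>1 * s ^ 3 / 3 - D * s\<^sup>2 / 2)"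
    and "\<beta> s = - (3 * d / (4 * \<rho>\<^sub>2) * (\<rho>\<^sub>1\<^sup>2 * s ^ 3 / 3 - \<rho>\<^sub>1 * D * s\<^sup>2 + D\<^sup>2 * s))" for s :: real
  define a' b' \<alpha>' \<beta>' where "a' s = 3 * s / \<rho>\<^sub>2" and "b' s = 3 * s\<^sup>2"
    and "\<alpha>' s = 3 / \<rho>\<^sub>2 * (\<rho>\<^sub>1 * s\<^sup>2 - D * s)"
    and "\<beta>' s = - (3 * d / (4 * \<rho>\<^sub>2) * (\<rho>\<^sub>1 * s - D)\<^sup>2)" for s :: real
  have dcoef: "(a has_real_derivative a' s) (at s)" "(b has_real_derivative b' s) (at s)"
    "(\<alpha> has_real_derivative \<alpha>' s) (at s)" "(\<beta> has_real_derivative \<beta>' s) (at s)" for s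
    unfolding a_def b_def \<alpha>_def \<beta>_def a'_def b'_def \<alpha>'_def \<beta>'_def using const(1)
    by (auto intro!: derivative_eq_intros simp: field_simps power2_eq_square)
  have ccoef: "continuous_on UNIV a" "continuous_on UNIV b" "continuous_on UNIV \<alpha>" "continuous_on UNIV \<beta>"
    "continuous_on UNIV a'" "continuous_on UNIV b'" "continuous_on UNIV \<alpha>'" "continuous_on UNIV \<beta>'"
    unfolding a_def b_def \<alpha>_def \<beta>_def a'_def b'_def \<alpha>'_def \<beta>'_def using const(1)
    by (auto intro!: continuous_intros)
  note GF = first_order_form_Gam
  have Lf: "L f \<in> Cinf0 A" and LLf: "L (L f) \<in> Cinf0 A" by (intro L_Cinf0 f(1))+
  have Ppos: "0 < P s f x" if "0 < s" for s x by (rule heat_pos[OF that f])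
  have PC: "P s f \<in> Cinf A" if "0 < s" for s by (rule heat_Cinf[OF f(1) that])
  obtain B1 where "0 \<le> B1" and B1: "\<And>x. \<bar>f x\<bar> \<le> B1" by (rule Cinf0_bounded[OF f(1)]) (rule that)
  obtain B2 where "0 \<le> B2" and B2: "\<And>x. \<bar>L f x\<bar> \<le> B2" by (rule Cinf0_bounded[OF Lf]) (rule that)
  have key: "a T * (Gam L (P T f) (P T f) x / (P T f x + e)) + b T * (Z (P T f) (P T f) x / (P T f x + e))
      + \<alpha> T * P T (L f) x + \<beta> T * (P T f x + e) \<le> 0" if e: "0 < e" for e
  proof -
    define F where "F s x = P s f x + e" for s x
    define W where "W s = P s (L f)" for s
    define q where "q Q s x = Q (F s) (F s) x / F s x" for Q :: "('m \<Rightarrow> real) \<Rightarrow> ('m \<Rightarrow> real) \<Rightarrow> 'm \<Rightarrow> real" and s x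
    define q' where "q' Q s x = 2 * Q (F s) (W s) x / F s x - Q (F s) (F s) x * W s x / (F s x)\<^sup>2"
      for Q :: "('m \<Rightarrow> real) \<Rightarrow> ('m \<Rightarrow> real) \<Rightarrow> 'm \<Rightarrow> real" and s x
    define u where "u s x = a s * q (Gam L) s x + b s * q Z s x + \<alpha> s * W s x + \<beta> s * F s x" for s x
    define u' where "u' s x = (a' s * q (Gam L) s x + a s * q' (Gam L) s x) + (b' s * q Z s x + b s * q' Z s x)
        + (\<alpha>' s * W s x + \<alpha> s * P s (L (L f)) x) + (\<beta>' s * F s x + \<beta> s * W s x)" for s x
    have Fflow: "smooth_flow F" unfolding F_def by (intro smooth_flow_add_const heat_smooth_flow f(1))
    have Wflow: "smooth_flow W" unfolding W_def by (rule heat_smooth_flow[OF Lf])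
    have Fpos: "0 < F s x" if "0 < s" for s x using Ppos[OF that, of x] e by (simp add: F_def)
    have FC: "F s \<in> Cinf A" if "0 < s" for s by (rule smooth_flow_Cinf[OF Fflow that])
    have WC: "W s \<in> Cinf A" if "0 < s" for s by (rule smooth_flow_Cinf[OF Wflow that])
    have dF: "((\<lambda>s. F s x) has_real_derivative W s x) (at s)" if "0 < s" for s x
      unfolding F_def W_def by (auto intro!: derivative_eq_intros heat_equation[OF that f(1)])
    have dW: "((\<lambda>s. W s x) has_real_derivative P s (L (L f)) x) (at s)" if "0 < s" for s x
      unfolding W_def by (rule heat_equation[OF that Lf])
    have LFW: "L (F s) = W s" if s: "0 < s" for s
    proof
      fix x
      have "L (F s) x = L (\<lambda>y. 1 * P s f y + e * 1) x" by (simp add: F_def[abs_def])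
      also have "\<dots> = L (P s f) x" unfolding L_linear[OF PC[OF s] Cinf_const] L_const by simp
      finally show "L (F s) x = W s x" unfolding heat_commute[OF s f(1)] W_def .
    qed
    have LW: "L (W s) x = P s (L (L f)) x" if "0 < s" for s x
      unfolding W_def by (rule heat_commute[OF that Lf])
    have dq: "((\<lambda>s. q Q s x) has_real_derivative q' Q s x) (at s)"
      if Q: "first_order_form A Q" and s: "0 < s" for Q s x
    proof -
      note d = form_flow_derivative[OF Q Fflow Wflow Fflow Wflow dF dF s, of x]
      have "Q (W s) (F s) = Q (F s) (W s)" by (rule form_sym[OF Q WC FC]) (rule s)+
      then have d': "((\<lambda>s. Q (F s) (F s) x) has_real_derivative 2 * Q (F s) (W s) x) (at s)" using d by simp
      show ?thesis unfolding q_def q'_def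
        using Fpos[OF s, of x]
        by (auto intro!: derivative_eq_intros d' dF[OF s] simp: field_simps power2_eq_square)
    qed
    have cQ: "continuous_on ({0<..} \<times> UNIV) (\<lambda>z. Q (G (fst z)) (H (fst z)) (snd z))"
      if "first_order_form A Q" "smooth_flow G" "smooth_flow H" for Q G H
      using form_flow_continuous[OF that] by (simp add: case_prod_beta')
    have cf: "continuous_on ({0<..} \<times> UNIV) (\<lambda>z. G (fst z) (snd z))" if "smooth_flow G" for G
      using smooth_flow_continuous[OF that] by (simp add: case_prod_beta')
    have F0: "\<forall>z\<in>{0<..} \<times> UNIV. F (fst z) (snd z) \<noteq> 0" 
    proof
      fix z assume "z \<in> {0::real<..} \<times> (UNIV :: 'm set)"
      then show "F (fst z) (snd z) \<noteq> 0" using Fpos[of "fst z" "snd z"] by auto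
    qed
    have F02: "\<forall>z\<in>{0<..} \<times> UNIV. (F (fst z) (snd z))\<^sup>2 \<noteq> 0" using F0 by simp
    have cq: "continuous_on ({0<..} \<times> UNIV) (\<lambda>z. q Q (fst z) (snd z))"
      and cq': "continuous_on ({0<..} \<times> UNIV) (\<lambda>z. q' Q (fst z) (snd z))" if Q: "first_order_form A Q" for Q
      unfolding q_def q'_def
      by (intro continuous_on_divide continuous_on_diff continuous_on_mult continuous_on_const continuous_on_power
          cQ[OF Q] cf Fflow Wflow F0 F02)+
    have ct: "continuous_on ({0<..} \<times> UNIV) (\<lambda>z. r (fst z))" if "continuous_on UNIV r" for r :: "real \<Rightarrow> real"
      by (rule continuous_on_compose2[OF that]) (auto intro!: continuous_intros)
    have "\<exists>N. \<forall>s x. 0 < s \<longrightarrow> s \<le> T \<longrightarrow> u s x \<le> N * s"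
    proof -
      have z: "a 0 = 0" "b 0 = 0" "\<alpha> 0 = 0" "\<beta> 0 = 0"
        by (simp_all add: a_def b_def \<alpha>_def \<beta>_def)
      obtain Ka where Ka: "0 \<le> Ka" "\<And>s. 0 < s \<Longrightarrow> s \<le> T \<Longrightarrow> \<bar>a s\<bar> \<le> Ka * s"
        by (rule vanishing_at_zero_bound[OF dcoef(1) ccoef(5) z(1)]) (rule that)
      obtain Kb where Kb: "0 \<le> Kb" "\<And>s. 0 < s \<Longrightarrow> s \<le> T \<Longrightarrow> \<bar>b s\<bar> \<le> Kb * s"
        by (rule vanishing_at_zero_bound[OF dcoef(2) ccoef(6) z(2)]) (rule that)
      obtain Kc where Kc: "0 \<le> Kc" "\<And>s. 0 < s \<Longrightarrow> s \<le> T \<Longrightarrow> \<bar>\<alpha> s\<bar> \<le> Kc * s"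
        by (rule vanishing_at_zero_bound[OF dcoef(3) ccoef(7) z(3)]) (rule that)
      obtain Kd where Kd: "0 \<le> Kd" "\<And>s. 0 < s \<Longrightarrow> s \<le> T \<Longrightarrow> \<bar>\<beta> s\<bar> \<le> Kd * s"
        by (rule vanishing_at_zero_bound[OF dcoef(4) ccoef(8) z(4)]) (rule that)
      show ?thesis
      proof (intro exI[of _ "Ka * (M / e) + Kb * (M / e) + Kc * B2 + Kd * (B1 + e)"] allI impI)
        fix s x assume s: "0 < s" "s \<le> T"
        \<comment> \<open>Adding a constant does not change the numerator, and it bounds the
          denominator below by \<open>e\<close>. This bound degenerates as \<open>e\<close> tends to
          0, but the conclusion for each \<open>e\<close> does not contain it.\<close>
        have qle: "\<bar>q Q s x\<bar> \<le> M / e" if Q: "first_order_form A Q" and M: "\<bar>Q (P s f) (P s f) x\<bar> \<le> M" for Q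
        proof -
          have "Q (F s) (F s) x = Q (P s f) (P s f) x"
            unfolding F_def by (rule form_add_const[OF Q PC[OF s(1)]])
          moreover have "e \<le> F s x" using Ppos[OF s(1), of x] by (simp add: F_def)
          ultimately show ?thesis
            unfolding q_def abs_divide using M e by (intro frac_le) auto
        qed
        have WB: "\<bar>W s x\<bar> \<le> B2" unfolding W_def by (rule heat_bounded[OF s(1) Cinf0_L2[OF Lf] B2])
        have FB: "\<bar>F s x\<bar> \<le> B1 + e"
          using heat_bounded[OF s(1) Cinf0_L2[OF f(1)] B1, of x] e unfolding F_def by linarith
        have pr: "r * y \<le> (K * s) * Y" if "\<bar>r\<bar> \<le> K * s" "\<bar>y\<bar> \<le> Y" "0 \<le> K" for r y K Y :: real
        proof -
          have "r * y \<le> \<bar>r\<bar> * \<bar>y\<bar>" by (metis abs_ge_self abs_mult)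
          also have "\<dots> \<le> (K * s) * Y" using that s(1) by (intro mult_mono) auto
          finally show ?thesis .
        qed
        have "u s x \<le> (Ka * s) * (M / e) + (Kb * s) * (M / e) + (Kc * s) * B2 + (Kd * s) * (B1 + e)"
          unfolding u_def using Ka Kb Kc Kd grad[OF s, of x] s
          by (intro add_mono pr qle GF Z WB FB) auto
        then show "u s x \<le> (Ka * (M / e) + Kb * (M / e) + Kc * B2 + Kd * (B1 + e)) * s"
          by (simp add: algebra_simps)
      qed
    qed
    then obtain N where N: "\<forall>s x. 0 < s \<longrightarrow> s \<le> T \<longrightarrow> u s x \<le> N * s" ..
    have "u T x \<le> 0"
    proof (rule parabolic_comparison[where u = u and u' = u' and M = N, OF h h_grad])
      fix s :: real assume s: "0 < s"
      have qC: "q Q s \<in> Cinf A" if "first_order_form A Q" for Q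
        unfolding q_def divide_inverse
        by (intro Cinf_mult form_Cinf[OF that] inverse_Cinf FC s Fpos)
      show "u s \<in> Cinf A"
        unfolding u_def by (intro Cinf_add Cinf_cmult qC GF Z WC FC s)
    next
      fix s x assume s: "0 < (s::real)"
      show "((\<lambda>s. u s x) has_real_derivative u' s x) (at s)"
        unfolding u_def u'_def
        by (auto intro!: derivative_eq_intros dcoef dq[OF GF s] dq[OF Z s] dW[OF s] dF[OF s])
    next
      show "continuous_on ({0<..} \<times> UNIV) (\<lambda>(s, x). u s x)"
        unfolding u_def case_prod_beta'
        by (intro continuous_on_add continuous_on_mult ct ccoef cq GF Z cf Wflow Fflow)
      show "continuous_on ({0<..} \<times> UNIV) (\<lambda>(s, x). u' s x)"
        unfolding u'_def case_prod_beta'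
        by (intro continuous_on_add continuous_on_mult ct ccoef cq cq' GF Z cf Wflow Fflow heat_smooth_flow LLf)
    next
      fix s x assume s: "0 < (s::real)"
      define g where "g = (\<lambda>y. ln (F s y))"
      have gC: "g \<in> Cinf A" unfolding g_def by (rule ln_Cinf[OF FC[OF s] Fpos[OF s]])
      have qg: "q Q s = (\<lambda>y. F s y * Q g g y)" if "first_order_form A Q" for Q
        unfolding q_def g_def using form_ln_ln[OF that FC[OF s] Fpos[OF s]] Fpos[OF s]
        by (auto simp: power2_eq_square)
      have qgC: "(\<lambda>y. F s y * Q g g y) \<in> Cinf A" if "first_order_form A Q" for Q
        by (intro Cinf_mult FC s form_Cinf[OF that] gC)
      have us: "u s = (\<lambda>y. 1 * (a s * (F s y * Gam L g g y) + b s * (F s y * Z g g y)) + 1 * (\<alpha> s * W s y + \<beta> s * F s y))"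
        unfolding u_def qg[OF GF] qg[OF Z] by (simp add: add.assoc)
      have Lu: "L (u s) x = a s * L (\<lambda>y. F s y * Gam L g g y) x + b s * L (\<lambda>y. F s y * Z g g y) x
          + (\<alpha> s * P s (L (L f)) x + \<beta> s * W s x)"
        unfolding us L_linear[OF Cinf_add[OF Cinf_cmult[OF qgC[OF GF]] Cinf_cmult[OF qgC[OF Z]]]
            Cinf_add[OF Cinf_cmult[OF WC[OF s]] Cinf_cmult[OF FC[OF s]]]]
          L_linear[OF qgC[OF GF] qgC[OF Z]] L_linear[OF WC[OF s] FC[OF s]] LW[OF s] LFW[OF s]
        by (simp only: mult_1_left)
      \<comment> \<open>For Q = \<Gamma> the commutation condition is an identity between equal
        terms, hence \<open>refl\<close>; \<open>bZ\<close> needs the hypothesis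
        \<open>com\<close>.\<close>
      have bG: "L (\<lambda>y. F s y * Gam L g g y) x = q' (Gam L) s x + 2 * F s x * Gam2 L g x"
        using bochner[where Q = "Gam L" and F = "F s" and x = x, OF GF FC[OF s] Fpos[OF s] g_def refl]
        by (simp add: q'_def LFW[OF s] Gam2_def)
      have bZ: "L (\<lambda>y. F s y * Z g g y) x = q' Z s x + 2 * F s x * GamZ2 L Z g x"
        using bochner[where Q = Z and F = "F s" and x = x, OF Z FC[OF s] Fpos[OF s] g_def fun_cong[OF com[OF gC]]]
        by (simp add: q'_def LFW[OF s] GamZ2_def)
      \<comment> \<open>The formula for L(ln F), solved for LF. It expresses the contribution of
        \<alpha>' in the variables \<open>L g\<close> and \<Gamma>(g) of the curvature-dimension
        inequality.\<close>
      have W: "W s x = F s x * (L g x + Gam L g g x)"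
        using L_ln[OF FC[OF s] Fpos[OF s], of x] Fpos[OF s, of x] LFW[OF s] by (simp add: g_def field_simps)
      \<comment> \<open>This is b / a, the ratio for which \<open>2 * a\<close> times the
        curvature-dimension inequality contains exactly the terms 2 a \<Gamma>_2 and 2 b
        \<Gamma>_2^Z.\<close>
      have \<nu>: "0 < 2 * \<rho>\<^sub>2 * s / 3" using s const by simp
      note alg = curvature_dimension_algebra[OF s const D cd[OF gC \<nu>]]
      have "L (u s) x - u' s x = F s x * (2 * (3 * s\<^sup>2 / (2 * \<rho>\<^sub>2)) * Gam2 L g x + 2 * s ^ 3 * GamZ2 L Z g x
          - 3 * s / \<rho>\<^sub>2 * Gam L g g x - 3 * s\<^sup>2 * Z g g x
          - 3 / \<rho>\<^sub>2 * (\<rho>\<^sub>1 * s\<^sup>2 - D * s) * (L g x + Gam L g g x) + 3 * d / (4 * \<rho>\<^sub>2) * (\<rho>\<^sub>1 * s - D)\<^sup>2)"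
        unfolding Lu u'_def bG bZ fun_cong[OF qg[OF GF]] fun_cong[OF qg[OF Z]]
        unfolding W a_def b_def a'_def b'_def \<alpha>'_def \<beta>'_def
        by (simp add: algebra_simps add_divide_distrib diff_divide_distrib)
      moreover have "0 \<le> \<dots>" using alg Fpos[OF s, of x] by simp
      ultimately show "u' s x \<le> L (u s) x" by simp
    next
      show "u s x \<le> N * s" if "0 < s" "s \<le> T" for s x using N that by blast
    qed (assumption, rule T)
    moreover have FT: "Q (F T) (F T) x = Q (P T f) (P T f) x" if "first_order_form A Q" for Q
      unfolding F_def by (rule form_add_const[OF that PC[OF T]])
    ultimately show ?thesis
      unfolding u_def q_def FT[OF GF] FT[OF Z] by (simp add: W_def F_def)
  qed
  \<comment> \<open>Strict positivity at the one point \<open>x\<close> makes the quotients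
    continuous at e = 0; no uniformity in \<open>x\<close> is needed here.\<close>
  have pos: "P T f x \<noteq> 0" using Ppos[OF T, of x] by simp
  have "((\<lambda>e. a T * (Gam L (P T f) (P T f) x / (P T f x + e)) + b T * (Z (P T f) (P T f) x / (P T f x + e))
      + \<alpha> T * P T (L f) x + \<beta> T * (P T f x + e)) \<longlongrightarrow>
      a T * (Gam L (P T f) (P T f) x / (P T f x + 0)) + b T * (Z (P T f) (P T f) x / (P T f x + 0))
      + \<alpha> T * P T (L f) x + \<beta> T * (P T f x + 0)) (at_right 0)"
    by (intro tendsto_intros) (use pos in auto)
  then have "a T * (Gam L (P T f) (P T f) x / (P T f x + 0)) + b T * (Z (P T f) (P T f) x / (P T f x + 0))
      + \<alpha> T * P T (L f) x + \<beta> T * (P T f x + 0) \<le> 0"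
    by (rule tendsto_upperbound) (use key in \<open>auto simp: eventually_at_filter intro!: always_eventually\<close>)
  then show ?thesis
    unfolding heat_commute[OF T f(1)] a_def b_def \<alpha>_def \<beta>_def by simp
qed

end

theorem theorem6p1:
  fixes A :: "('m::{t2_space, second_countable_topology}, 'e::euclidean_space) chart set"
    and \<mu> :: "'m measure"
    and L :: "('m \<Rightarrow> real) \<Rightarrow> 'm \<Rightarrow> real"
    and GZ :: "('m \<Rightarrow> real) \<Rightarrow> ('m \<Rightarrow> real) \<Rightarrow> 'm \<Rightarrow> real"
    and P :: "real \<Rightarrow> ('m \<Rightarrow> real) \<Rightarrow> 'm \<Rightarrow> real"
    and p :: "'m \<Rightarrow> 'm \<Rightarrow> real \<Rightarrow> real"
    and h :: "nat \<Rightarrow> 'm \<Rightarrow> real"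
    and \<rho>\<^sub>1 \<rho>\<^sub>2 \<kappa> d :: real
    and f :: "'m \<Rightarrow> real"
  assumes setting: "subelliptic_diffusion A \<mu> L GZ P p"
    and h_test: "\<And>k. h k \<in> Cinf0 A"
    and h_incr: "\<And>k x. h k x \<le> h (Suc k) x"
    and h_lim: "\<And>x. (\<lambda>k. h k x) \<longlonglongrightarrow> 1"
    and h_grad: "(\<lambda>k. supnorm (Gam L (h k) (h k)) + supnorm (GZ (h k) (h k))) \<longlonglongrightarrow> 0"
    and commute: "\<And>g. g \<in> Cinf A \<Longrightarrow> Gam L g (GZ g g) = GZ g (Gam L g g)"
    and conservative: "\<And>t. 0 \<le> t \<Longrightarrow> P t (\<lambda>_. 1) = (\<lambda>_. 1)"
    and gradient_bound: "\<And>g T. g \<in> Cinf0 A \<Longrightarrow> 0 \<le> T \<Longrightarrow>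
          (SUP t\<in>{0..T}. supnorm (Gam L (P t g) (P t g)) + supnorm (GZ (P t g) (P t g))) < \<infinity>"
    and constants: "0 < \<rho>\<^sub>2" "0 \<le> \<kappa>" "0 < d"
    and curvature_dimension: "\<And>g \<nu> x. g \<in> Cinf A \<Longrightarrow> 0 < \<nu> \<Longrightarrow>
          Gam2 L g x + \<nu> * GamZ2 L GZ g x
            \<ge> 1 / d * (L g x)\<^sup>2 + (\<rho>\<^sub>1 - \<kappa> / \<nu>) * Gam L g g x + \<rho>\<^sub>2 * GZ g g x"
    and f_test: "f \<in> Cinf0 A"
    and f_nonneg: "\<And>x. 0 \<le> f x"
    and f_nonzero: "f \<noteq> (\<lambda>_. 0)"
  shows "\<forall>t>0. \<forall>x.
      Gam L (\<lambda>y. ln (P t f y)) (\<lambda>y. ln (P t f y)) x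
        + 2 * \<rho>\<^sub>2 / 3 * t * GZ (\<lambda>y. ln (P t f y)) (\<lambda>y. ln (P t f y)) x
      \<le> (1 + 3 * \<kappa> / (2 * \<rho>\<^sub>2) - 2 * \<rho>\<^sub>1 / 3 * t) * (L (P t f) x / P t f x)
        + d * \<rho>\<^sub>1\<^sup>2 / 6 * t
        - \<rho>\<^sub>1 * d / 2 * (1 + 3 * \<kappa> / (2 * \<rho>\<^sub>2))
        + d * (1 + 3 * \<kappa> / (2 * \<rho>\<^sub>2))\<^sup>2 / (2 * t)"
proof (intro allI impI)
  fix t :: real and x assume t: "0 < t"
  interpret subelliptic_diffusion A \<mu> L GZ P p by (rule setting)
  interpret H: conservative_heat A L \<mu> P p
    by unfold_locales
      (rule atlas diffusion L_one smooth_measure L_sym heat kernel conservative; assumption)+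
  \<comment> \<open>The comparison principle asks for smallness of \<Gamma>(h_k) uniformly in
    \<open>x\<close>, and the sup norm in hypothesis (a) provides it.\<close>
  have grad: "\<forall>\<^sub>F k in sequentially. \<forall>x. Gam L (h k) (h k) x \<le> e" if e: "0 < e" for e
  proof -
    have "\<forall>\<^sub>F k in sequentially. supnorm (Gam L (h k) (h k)) + supnorm (GZ (h k) (h k)) < ennreal e"
      using order_tendstoD(2)[OF h_grad, of "ennreal e"] e by simp
    then show ?thesis
    proof (rule eventually_mono, intro allI)
      fix k x assume k: "supnorm (Gam L (h k) (h k)) + supnorm (GZ (h k) (h k)) < ennreal e"
      have "ennreal \<bar>Gam L (h k) (h k) x\<bar> \<le> supnorm (Gam L (h k) (h k))"
        unfolding supnorm_def by (rule SUP_upper) simp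
      also have "\<dots> \<le> supnorm (Gam L (h k) (h k)) + supnorm (GZ (h k) (h k))" by simp
      also note k
      finally have "\<bar>Gam L (h k) (h k) x\<bar> < e" using e by (simp add: ennreal_less_iff)
      then show "Gam L (h k) (h k) x \<le> e" by simp
    qed
  qed
  define S where "S = (SUP s\<in>{0..t}. supnorm (Gam L (P s f) (P s f)) + supnorm (GZ (P s f) (P s f)))"
  have S: "S < \<infinity>" unfolding S_def by (rule gradient_bound[OF f_test less_imp_le[OF t]])
  have bnd: "\<bar>Gam L (P s f) (P s f) y\<bar> \<le> enn2real S \<and> \<bar>GZ (P s f) (P s f) y\<bar> \<le> enn2real S"
    if s: "0 < s" "s \<le> t" for s y
  proof -
    have "supnorm (Gam L (P s f) (P s f)) + supnorm (GZ (P s f) (P s f)) \<le> S"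
      unfolding S_def by (rule SUP_upper) (use s in simp)
    moreover have "ennreal \<bar>Gam L (P s f) (P s f) y\<bar> \<le> supnorm (Gam L (P s f) (P s f))"
      "ennreal \<bar>GZ (P s f) (P s f) y\<bar> \<le> supnorm (GZ (P s f) (P s f))"
      unfolding supnorm_def by (rule SUP_upper, simp)+
    ultimately have "ennreal \<bar>Gam L (P s f) (P s f) y\<bar> \<le> S" "ennreal \<bar>GZ (P s f) (P s f) y\<bar> \<le> S"
      by (meson add_increasing add_increasing2 order_trans zero_le)+
    moreover have "r \<le> enn2real S" if "ennreal r \<le> S" for r
    proof -
      have "ennreal (enn2real S) = S" using S by (simp add: ennreal_enn2real)
      with that have "ennreal r \<le> ennreal (enn2real S)" by simp
      then show ?thesis by (subst (asm) ennreal_le_iff) simp_all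
    qed
    ultimately show ?thesis by blast
  qed
  \<comment> \<open>One point with f > 0 suffices: the kernel is strictly positive, so
    \<open>P t f\<close> is positive everywhere and its logarithm makes sense.\<close>
  obtain x1 where x1: "f x1 \<noteq> 0" using f_nonzero by auto
  define D where "D = 1 + 3 * \<kappa> / (2 * \<rho>\<^sub>2)"
  define G where "G = P t f x"
  have G: "0 < P t f y" for y by (rule H.heat_pos[OF t f_test f_nonneg x1])
  have PC: "P t f \<in> Cinf A" by (rule H.heat_Cinf[OF f_test t])
  define a where "a = 3 * t\<^sup>2 / (2 * \<rho>\<^sub>2)"
  have a: "0 < a" using t constants by (simp add: a_def)
  let ?GG = "Gam L (P t f) (P t f) x" and ?ZZ = "GZ (P t f) (P t f) x" and ?l = "L (P t f) x"
  have "a * (?GG / G) + t ^ 3 * (?ZZ / G) + 3 / \<rho>\<^sub>2 * (\<rho>\<^sub>1 * t ^ 3 / 3 - D * t\<^sup>2 / 2) * ?l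
      - 3 * d / (4 * \<rho>\<^sub>2) * (\<rho>\<^sub>1\<^sup>2 * t ^ 3 / 3 - \<rho>\<^sub>1 * D * t\<^sup>2 + D\<^sup>2 * t) * G \<le> 0"
    unfolding a_def G_def
    by (rule H.heat_li_yau[OF h_test h_incr h_lim grad GZ_form commute bnd constants(1,3)
          curvature_dimension f_test f_nonneg x1 t D_def])
  \<comment> \<open>Factoring out a G normalizes the coefficient of \<Gamma>(ln P_t f) to 1. The
    coefficient of \<Gamma>^Z becomes t^3 / a = \<open>2 * \<rho>\<^sub>2 / 3 * t\<close>, and the
    polynomial coefficients turn into those of the claim.\<close>
  moreover have "a * (?GG / G) + t ^ 3 * (?ZZ / G) + 3 / \<rho>\<^sub>2 * (\<rho>\<^sub>1 * t ^ 3 / 3 - D * t\<^sup>2 / 2) * ?l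
      - 3 * d / (4 * \<rho>\<^sub>2) * (\<rho>\<^sub>1\<^sup>2 * t ^ 3 / 3 - \<rho>\<^sub>1 * D * t\<^sup>2 + D\<^sup>2 * t) * G
    = a * G * (?GG / G\<^sup>2 + 2 * \<rho>\<^sub>2 / 3 * t * (?ZZ / G\<^sup>2)
      - ((D - 2 * \<rho>\<^sub>1 / 3 * t) * (?l / G) + d * \<rho>\<^sub>1\<^sup>2 / 6 * t - \<rho>\<^sub>1 * d / 2 * D + d * D\<^sup>2 / (2 * t)))"
    using G[of x] t constants unfolding G_def[symmetric] a_def
    by (simp add: field_simps power2_eq_square power3_eq_cube)
  ultimately have "a * G * (?GG / G\<^sup>2 + 2 * \<rho>\<^sub>2 / 3 * t * (?ZZ / G\<^sup>2)
      - ((D - 2 * \<rho>\<^sub>1 / 3 * t) * (?l / G) + d * \<rho>\<^sub>1\<^sup>2 / 6 * t - \<rho>\<^sub>1 * d / 2 * D + d * D\<^sup>2 / (2 * t))) \<le> 0"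
    by (simp only:)
  moreover have "0 < a * G" using a G[of x] by (simp add: G_def)
  ultimately have "?GG / G\<^sup>2 + 2 * \<rho>\<^sub>2 / 3 * t * (?ZZ / G\<^sup>2)
      - ((D - 2 * \<rho>\<^sub>1 / 3 * t) * (?l / G) + d * \<rho>\<^sub>1\<^sup>2 / 6 * t - \<rho>\<^sub>1 * d / 2 * D + d * D\<^sup>2 / (2 * t)) \<le> 0"
    using mult_pos_pos not_le by blast
  then show "Gam L (\<lambda>y. ln (P t f y)) (\<lambda>y. ln (P t f y)) x
        + 2 * \<rho>\<^sub>2 / 3 * t * GZ (\<lambda>y. ln (P t f y)) (\<lambda>y. ln (P t f y)) x
      \<le> (1 + 3 * \<kappa> / (2 * \<rho>\<^sub>2) - 2 * \<rho>\<^sub>1 / 3 * t) * (L (P t f) x / P t f x)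
        + d * \<rho>\<^sub>1\<^sup>2 / 6 * t
        - \<rho>\<^sub>1 * d / 2 * (1 + 3 * \<kappa> / (2 * \<rho>\<^sub>2))
        + d * (1 + 3 * \<kappa> / (2 * \<rho>\<^sub>2))\<^sup>2 / (2 * t)"
    unfolding H.form_ln_ln[OF H.first_order_form_Gam PC G] H.form_ln_ln[OF GZ_form PC G] D_def[symmetric] G_def[symmetric]
    by linarith
qed

end
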